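(* For every $x\in\mathbb{R}_+$, $$\mathbb{D}_{|p_n|}(x)=\frac{2(1-e^{-x^2})}{x}+2x\int_0^1 e^{-(s-s\log s)x^2}\,ds+o(1)\qquad\text{as } n\to\infty,$$ where at $x=0$ the quotient $\frac{1-e^{-x^2}}{x}$ is understood as its limiting value $0$.
   Context: Let $a_0,a_1,a_2,\dots$ be i.i.d. complex random variables with density $\frac1\pi e^{-|z|^2}$ with respect to Lebesgue measure on $\mathbb{C}$. For a positive integer $n$, the Gaussian $SU(2)$ random polynomial is $p_n(z)=\sum_{j=0}^n a_j\sqrt{\binom nj}\,z^j$, $z\in\mathbb{C}$. Let $\mathbb{R}_+=[0,\infty)$. Almost surely the points $z$ with $p_n'(z)=0$ are exactly the points where the nonvanishing critical values of $|p_n|$ are attained, and the empirical measure of the nonvanishing critical values of $|p_n|$ is $\mathcal{C}_{|p_n|}=\sum_{z\in\mathbb{C}:\,p_n'(z)=0}\delta_{|p_n(z)|}$, a measure on $\mathbb{R}_+$. Its expected density $\mathbb{D}_{|p_n|}$ is the (continuous) function on $\mathbb{R}_+$ such that for every $\phi\in C_c^\infty(\mathbb{R}_+)$, $$\mathbb{E}\sum_{z:\,p_n'(z)=0}\phi(|p_n(z)|)=\int_0^\infty\phi(x)\,\mathbb{D}_{|p_n|}(x)\,dx.$$ The integrand uses the convention $s\log s=0$ at $s=0$. *)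

theory Defs
  imports "HOL-Probability.Probability" "HOL-Computational_Algebra.Polynomial"
begin

definition SU2_poly :: "(nat \<Rightarrow> complex) \<Rightarrow> nat \<Rightarrow> complex poly" where
  "SU2_poly c n = (\<Sum>j\<le>n. monom (c j * complex_of_real (sqrt (real (n choose j)))) j)"

definition standard_complex_gaussian_density :: "complex \<Rightarrow> ennreal" where
  "standard_complex_gaussian_density z = ennreal (exp (- (cmod z)\<^sup>2) / pi)"

(* C_c^\<infinity>([0,\<infinity>)): all derivatives exist up to the endpoint 0 (one-sided there), and the
   support may contain 0.  Only the values of \<phi> on [0,\<infinity>) matter; d k is the k-th derivative. *)
definition test_function_on_half_line :: "(real \<Rightarrow> real) \<Rightarrow> bool" where
  "test_function_on_half_line \<phi> \<longleftrightarrow>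
     (\<exists>d :: nat \<Rightarrow> real \<Rightarrow> real.
        (\<forall>x\<ge>0. d 0 x = \<phi> x) \<and>
        (\<forall>k. \<forall>x\<ge>0. (d k has_real_derivative d (Suc k) x) (at x within {0..}))) \<and>
     (\<exists>R. \<forall>x\<ge>0. x > R \<longrightarrow> \<phi> x = 0)"

(* The integral of \<phi> against the empirical measure of the critical values of |p|.  Each critical
   point is counted once, without multiplicity.  If p is constant the index set is infinite and
   the sum is 0 by convention; for p = SU2_poly c n with n \<ge> 1 this is a null event. *)
definition critical_value_sum :: "complex poly \<Rightarrow> (real \<Rightarrow> real) \<Rightarrow> real" where
  "critical_value_sum p \<phi> = (\<Sum>z\<in>{z. poly (pderiv p) z = 0}. \<phi> (cmod (poly p z)))"

definition is_expected_density ::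
  "'w measure \<Rightarrow> (nat \<Rightarrow> 'w \<Rightarrow> complex) \<Rightarrow> nat \<Rightarrow> (real \<Rightarrow> real) \<Rightarrow> bool" where
  "is_expected_density M a n D \<longleftrightarrow>
     continuous_on {0..} D \<and>
     (\<forall>\<phi>. test_function_on_half_line \<phi> \<longrightarrow>
        has_bochner_integral M (\<lambda>\<omega>. critical_value_sum (SU2_poly (\<lambda>j. a j \<omega>) n) \<phi>)
          (LBINT x:{0..}. \<phi> x * D x))"

(* A function on [0,\<infinity>) is represented by its extension by 0, so that the description is unique. *)
definition expected_density ::
  "'w measure \<Rightarrow> (nat \<Rightarrow> 'w \<Rightarrow> complex) \<Rightarrow> nat \<Rightarrow> real \<Rightarrow> real" where
  "expected_density M a n = (THE D. is_expected_density M a n D \<and> (\<forall>x<0. D x = 0))"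

end

theory Submission
  imports Defs "HOL-Complex_Analysis.Conformal_Mappings" "HOL-Real_Asymp.Real_Asymp"
begin

text \<open>
  Fix all coefficients except \<open>a\<^sub>1\<close>. Then \<open>p'(z) = 0\<close> says \<open>a\<^sub>1 = g(z)\<close> for a polynomial \<open>g\<close> in \<open>z\<close>, and the
  area formula for \<open>g : \<complex> \<rightarrow> \<complex>\<close> turns the integral over \<open>a\<^sub>1\<close> of the sum over critical points into
  \<open>\<integral> \<phi>(|p(z)|) |g'(z)|\<^sup>2 exp(-|g(z)|\<^sup>2) dz / \<pi>\<close>, where \<open>p\<close> has linear coefficient \<open>g(z)\<close>.
  After Fubini, for each \<open>z\<close> this is an expectation of a function of three linear forms in independent
  complex Gaussians. Only their Gram matrix matters, and its entries are binomial sums in \<open>t = |z|\<^sup>2\<close>. This gives the exact density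

    \<open>D\<^sub>n(x) = 2x(n-1) \<integral>\<^sub>0\<^sup>\<infinity> (n(n-1)t\<^sup>2x\<^sup>2 + 2(1+t)\<^sup>n) / (1+t)^(2n+2) exp(-x\<^sup>2(1+nt)/(1+t)\<^sup>n) dt\<close>.

  With \<open>t = r/n\<close> the integrand converges dominatedly, and \<open>s = exp(-r)\<close> with an integration by
  parts gives the stated limit.
\<close>

section \<open>Radial integrals and the area formula for polynomials\<close>

text \<open>The linear coefficient is the one to solve for because it is the constant term of
  \<open>p'\<close>, so \<open>g\<close> is a polynomial, without a pole at 0. On the critical set
  \<open>p(z) = p(z) - z p'(z)\<close>, and the right side has coefficients multiplied by
  \<open>1 - j\<close>: the linear one has dropped out, and likewise from \<open>p''\<close>. This
  is the origin of the three forms. Their Gram matrix can be singular; at \<open>z = 0\<close> the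
  second form vanishes once the index 1 is removed. Joint densities and inverse covariances are
  therefore avoided: the forms are replaced by a triangular image of three independent Gaussians,
  which exists for every Gram matrix, and only the first diagonal entry has to be positive. The sum
  over a random zero set needs its own measurability proof. The density is a definite description,
  so uniqueness has to be shown too, with explicit bump functions.\<close>

lemma measure_eqI_Iic:
  fixes M N :: "real measure"
  assumes sets: "sets M = sets borel" "sets N = sets borel"
    and eq: "\<And>x. emeasure M {..x} = emeasure N {..x}" and fin: "\<And>x. emeasure M {..x} \<noteq> \<infinity>"
  shows "M = N"
proof (rule measure_eqI_generator_eq)
  let ?E = "range atMost :: real set set"
  have "{..x} \<inter> {..y} = {..min x y}" for x y :: real by auto
  then show "Int_stable ?E" by (auto simp: Int_stable_def)
  show "?E \<subseteq> Pow UNIV" by simp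
  show "sets M = sigma_sets UNIV ?E" "sets N = sigma_sets UNIV ?E"
    by (simp_all add: sets borel_eq_atMost)
  show "range (\<lambda>i::nat. {..real i}) \<subseteq> ?E" by auto
  show "(\<Union>i::nat. {..real i}) = UNIV" by (auto intro: real_arch_simple)
  show "emeasure M {..real i} \<noteq> \<infinity>" for i by (rule fin)
  show "emeasure M X = emeasure N X" if "X \<in> ?E" for X using that eq by auto
qed

text \<open>A disc of squared radius \<open>x\<close> has area \<open>pi * x\<close>, linear in
  \<open>x\<close>, so the image of planar Lebesgue measure has constant density. This replaces
  polar coordinates; the squared modulus is the variable \<open>t\<close> in which all binomial sums
  are expressed.\<close>

lemma distr_cmod_square:
  "distr lborel borel (\<lambda>z::complex. (cmod z)\<^sup>2)
     = density lborel (\<lambda>t::real. ennreal pi * indicator {0..} t)" (is "?M = ?N")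
proof (rule measure_eqI_Iic)
  have M: "emeasure ?M {..x} = ennreal (pi * x)" for x
  proof (cases "x \<ge> 0")
    case True
    then have "(\<lambda>z::complex. (cmod z)\<^sup>2) -` {..x} = cball 0 (sqrt x)"
      by (auto simp: real_le_rsqrt sqrt_ge_absD)
    then show ?thesis
      using True by (simp add: emeasure_distr emeasure_cball unit_ball_vol_2)
  next
    case False
    then have "\<not> (cmod z)\<^sup>2 \<le> x" for z :: complex
      using zero_le_power2[of "cmod z"] by linarith
    then have "(\<lambda>z::complex. (cmod z)\<^sup>2) -` {..x} = {}" by auto
    then show ?thesis using False by (simp add: emeasure_distr ennreal_neg mult_nonneg_nonpos)
  qed
  have N: "emeasure ?N {..x} = ennreal (pi * x)" for x
  proof -
    have "emeasure ?N {..x} = (\<integral>\<^sup>+t. ennreal pi * indicator {0..x} t \<partial>lborel)"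
      by (subst emeasure_density) (auto intro!: nn_integral_cong split: split_indicator)
    also have "\<dots> = ennreal pi * emeasure lborel {0..x}"
      by (simp add: nn_integral_cmult)
    also have "\<dots> = ennreal (pi * x)"
      by (cases "x \<ge> 0") (simp_all add: ennreal_mult ennreal_neg mult_nonneg_nonpos)
    finally show ?thesis .
  qed
  show "emeasure ?M {..x} = emeasure ?N {..x}" "emeasure ?M {..x} \<noteq> \<infinity>" for x
    by (simp_all only: M N) simp
qed simp_all

lemma nn_integral_complex_radial:
  assumes [measurable]: "F \<in> borel_measurable borel"
  shows "(\<integral>\<^sup>+z. F ((cmod z)\<^sup>2) \<partial>(lborel::complex measure))
       = ennreal pi * (\<integral>\<^sup>+t\<in>{0..}. F t \<partial>lborel)"
proof -
  have "(\<integral>\<^sup>+z. F ((cmod z)\<^sup>2) \<partial>(lborel::complex measure))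
      = (\<integral>\<^sup>+t. F t \<partial>distr lborel borel (\<lambda>z::complex. (cmod z)\<^sup>2))"
    by (subst nn_integral_distr) auto
  also have "\<dots> = (\<integral>\<^sup>+t. ennreal pi * (F t * indicator {0..} t) \<partial>lborel)"
    unfolding distr_cmod_square by (subst nn_integral_density) (auto intro!: nn_integral_cong simp: ac_simps)
  finally show ?thesis by (simp add: nn_integral_cmult)
qed

text \<open>The companion for the plain modulus, for integrands that contain a test function of a
  modulus.\<close>

lemma distr_cmod:
  "distr lborel borel (cmod :: complex \<Rightarrow> real)
     = density lborel (\<lambda>r::real. ennreal (2 * pi * r) * indicator {0..} r)" (is "?M = ?N")
proof (rule measure_eqI_Iic)
  have M: "emeasure ?M {..x} = (if x \<ge> 0 then ennreal (pi * x\<^sup>2) else 0)" for x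
  proof -
    have "cmod -` {..x} = cball 0 x" by auto
    then show ?thesis
      by (simp add: emeasure_distr emeasure_cball unit_ball_vol_2 power2_eq_square)
  qed
  have N: "emeasure ?N {..x} = (if x \<ge> 0 then ennreal (pi * x\<^sup>2) else 0)" for x
  proof (cases "x \<ge> 0")
    case True
    have "emeasure ?N {..x} = (\<integral>\<^sup>+r. ennreal (2 * pi * r) * indicator {0..x} r \<partial>lborel)"
      by (subst emeasure_density) (auto intro!: nn_integral_cong split: split_indicator)
    also have "\<dots> = ennreal (pi * x\<^sup>2 - pi * 0\<^sup>2)"
      using True by (intro nn_integral_FTC_Icc) (auto intro!: derivative_eq_intros)
    finally show ?thesis using True by simp
  next
    case False
    have "emeasure ?N {..x} = (\<integral>\<^sup>+r. ennreal (2 * pi * r) * indicator {0..} r * indicator {..x} r \<partial>lborel)"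
      by (subst emeasure_density) auto
    also have "\<dots> = (\<integral>\<^sup>+r. 0 \<partial>(lborel :: real measure))"
      using False by (intro nn_integral_cong) (auto split: split_indicator)
    finally have "emeasure ?N {..x} = 0" by simp
    then show ?thesis using False by simp
  qed
  show "emeasure ?M {..x} = emeasure ?N {..x}" "emeasure ?M {..x} \<noteq> \<infinity>" for x
    by (simp_all only: M N) simp
qed simp_all

lemma nn_integral_complex_cmod:
  assumes [measurable]: "F \<in> borel_measurable borel"
  shows "(\<integral>\<^sup>+z. F (cmod z) \<partial>lborel) = (\<integral>\<^sup>+r\<in>{0..}. F r * ennreal (2 * pi * r) \<partial>lborel)"
proof -
  have "(\<integral>\<^sup>+z. F (cmod z) \<partial>lborel) = (\<integral>\<^sup>+r. F r \<partial>distr lborel borel cmod)"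
    by (subst nn_integral_distr) auto
  then show ?thesis
    unfolding distr_cmod by (subst (asm) nn_integral_density) (auto simp: ac_simps)
qed

lemma nn_integral_complex_affine:
  fixes F :: "complex \<Rightarrow> ennreal"
  assumes [measurable]: "F \<in> borel_measurable borel" and c: "c \<noteq> 0"
  shows "(\<integral>\<^sup>+z. F z \<partial>lborel) = ennreal (c\<^sup>2) * (\<integral>\<^sup>+z. F (t + c *\<^sub>R z) \<partial>lborel)"
proof -
  have "(\<integral>\<^sup>+z. F z \<partial>lborel) = (\<integral>\<^sup>+z. F z \<partial>density (distr lborel borel (\<lambda>z. t + c *\<^sub>R z)) (\<lambda>_. ennreal (c\<^sup>2)))"
    using lborel_affine[OF c, of t] by (simp add: power2_abs)
  also have "\<dots> = ennreal (c\<^sup>2) * (\<integral>\<^sup>+z. F (t + c *\<^sub>R z) \<partial>lborel)"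
    by (subst nn_integral_density, simp, simp, subst nn_integral_distr) (auto simp: nn_integral_cmult)
  finally show ?thesis .
qed

section \<open>Area formula for holomorphic injections and for polynomial fibres\<close>

definition vec_of_complex :: "complex \<Rightarrow> real^2" where
  "vec_of_complex z = vector [Re z, Im z]"

definition complex_of_vec :: "real^2 \<Rightarrow> complex" where
  "complex_of_vec v = Complex (v $ 1) (v $ 2)"

lemma vec_of_complex_inverse [simp]: "complex_of_vec (vec_of_complex z) = z"
  by (simp add: vec_of_complex_def complex_of_vec_def complex_eq_iff)

lemma complex_of_vec_inverse [simp]: "vec_of_complex (complex_of_vec v) = v"
  by (simp add: vec_of_complex_def complex_of_vec_def vec_eq_iff forall_2)

lemma linear_vec_of_complex: "linear vec_of_complex"
  by (rule linearI) (simp_all add: vec_of_complex_def vec_eq_iff forall_2)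

lemma linear_complex_of_vec: "linear complex_of_vec"
  by (rule linearI) (simp_all add: complex_of_vec_def complex_eq_iff)

lemma complex_of_vec_measurable [measurable]: "complex_of_vec \<in> borel_measurable borel"
  by (simp add: borel_measurable_continuous_onI linear_continuous_on linear_complex_of_vec linear_conv_bounded_linear[symmetric])

text \<open>Boxes go to boxes with the same side lengths. Hence the Jacobian change of variables on
  \<open>real^2\<close> can be read as a statement about \<open>complex\<close>.\<close>

lemma distr_complex_of_vec: "distr lborel borel complex_of_vec = lborel"
proof (rule lborel_eqI[symmetric])
  fix l u :: complex
  assume le: "\<And>b. b \<in> Basis \<Longrightarrow> l \<bullet> b \<le> u \<bullet> b"
  have B: "(Basis::(real^2) set) = {axis 1 1, axis 2 1}"
    by (auto simp: Basis_vec_def) (metis exhaust_2)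
  have ne: "(axis 1 1 :: real^2) \<noteq> axis 2 1" by (simp add: axis_eq_axis)
  have "complex_of_vec -` box l u = box (vec_of_complex l) (vec_of_complex u)"
    by (auto simp: box_def Basis_complex_def B inner_axis vec_of_complex_def complex_of_vec_def)
  moreover have "(\<Prod>b\<in>(Basis::(real^2) set). (vec_of_complex u - vec_of_complex l) \<bullet> b)
      = (\<Prod>b\<in>Basis. (u - l) \<bullet> b)"
    using ne by (simp add: B Basis_complex_def inner_axis vec_of_complex_def)
  moreover have "\<And>b. b \<in> Basis \<Longrightarrow> vec_of_complex l \<bullet> b \<le> vec_of_complex u \<bullet> b"
    using le[of 1] le[of \<i>] by (auto simp: B Basis_complex_def inner_axis vec_of_complex_def)
  ultimately show "emeasure (distr lborel borel complex_of_vec) (box l u) = ennreal (\<Prod>b\<in>Basis. (u - l) \<bullet> b)"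
    by (simp add: emeasure_distr emeasure_lborel_box)
qed simp

text \<open>Multiplication by \<open>f' z\<close> is a real linear map of determinant
  \<open>|f' z|^2\<close>, so the real change of variables gives the claim. Boundedness of
  \<open>A\<close> keeps the Jacobian integrable, which links the nonnegative, the Bochner and the
  gauge integral.\<close>

lemma emeasure_injective_image_complex:
  fixes f f' :: "complex \<Rightarrow> complex"
  assumes deriv: "\<And>z. (f has_field_derivative f' z) (at z)"
    and cont: "continuous_on UNIV f'"
    and A [measurable]: "A \<in> sets borel" and bdd: "bounded A"
    and inj: "inj_on f A" and [measurable]: "f ` A \<in> sets borel"
  shows "emeasure lborel (f ` A) = (\<integral>\<^sup>+z\<in>A. ennreal ((cmod (f' z))\<^sup>2) \<partial>lborel)"
proof -
  define S where "S = complex_of_vec -` A"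
  define F where "F = vec_of_complex \<circ> f \<circ> complex_of_vec"
  define F' where "F' = (\<lambda>v. vec_of_complex \<circ> (\<lambda>x. f' (complex_of_vec v) * x) \<circ> complex_of_vec)"
  have [measurable]: "f' \<in> borel_measurable borel"
    using cont by (rule borel_measurable_continuous_onI)
  have S[measurable]: "S \<in> sets borel"
    unfolding S_def using measurable_sets[OF complex_of_vec_measurable A] by simp
  have bl: "bounded_linear vec_of_complex" "bounded_linear complex_of_vec"
    by (simp_all add: linear_conv_bounded_linear[symmetric] linear_vec_of_complex linear_complex_of_vec)
  have derF: "(F has_derivative F' v) (at v within S)" for v
  proof -
    have "(F has_derivative F' v) (at v)"
      unfolding F_def F'_def
      by (intro diff_chain_at bounded_linear_imp_has_derivative bl)
         (use deriv in \<open>simp add: has_field_derivative_def\<close>)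
    then show ?thesis by (rule has_derivative_at_withinI)
  qed
  have det: "\<bar>det (matrix (F' v))\<bar> = (cmod (f' (complex_of_vec v)))\<^sup>2" for v
    by (simp add: det_2 matrix_def F'_def vec_of_complex_def complex_of_vec_def axis_def
        cmod_power2 power2_eq_square[symmetric])
  have injF: "inj_on F S"
    using inj unfolding inj_on_def F_def S_def
    by (metis comp_apply complex_of_vec_inverse vec_of_complex_inverse vimageE)
  have FS: "F ` S = complex_of_vec -` (f ` A)"
  proof (intro set_eqI iffI)
    fix v assume "v \<in> complex_of_vec -` (f ` A)"
    then obtain z where z: "z \<in> A" "complex_of_vec v = f z" by auto
    then have "v = F (vec_of_complex z)"
      by (metis F_def comp_apply complex_of_vec_inverse vec_of_complex_inverse)
    then show "v \<in> F ` S" using z by (auto simp: S_def)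
  qed (auto simp: F_def S_def)
  have FS_m [measurable]: "F ` S \<in> sets borel"
    unfolding FS using measurable_sets[OF complex_of_vec_measurable, of "f ` A"] by simp
  have transfer: "(\<integral>\<^sup>+z\<in>A. ennreal ((cmod (f' z))\<^sup>2) \<partial>lborel)
      = (\<integral>\<^sup>+v. ennreal (indicator S v * \<bar>det (matrix (F' v))\<bar>) \<partial>lborel)"
    apply (subst distr_complex_of_vec[symmetric], subst nn_integral_distr)
    by (auto intro!: nn_integral_cong simp: det S_def split: split_indicator)
  obtain K where K: "\<And>z. z \<in> A \<Longrightarrow> (cmod (f' z))\<^sup>2 \<le> K" "K \<ge> 0"
  proof -
    have "compact (f' ` closure A)"
      using bdd cont by (intro compact_continuous_image) (auto intro: continuous_on_subset simp: compact_closure)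
    then obtain b where b: "\<And>z. z \<in> closure A \<Longrightarrow> cmod (f' z) \<le> b"
      using compact_imp_bounded[of "f' ` closure A"] by (auto simp: bounded_iff)
    show ?thesis
      by (rule that[of "b\<^sup>2"]) (use b closure_subset in \<open>auto intro!: power_mono\<close>)
  qed
  have "(\<integral>\<^sup>+z\<in>A. ennreal ((cmod (f' z))\<^sup>2) \<partial>lborel) \<le> (\<integral>\<^sup>+z. ennreal K * indicator A z \<partial>lborel)"
    using K by (intro nn_integral_mono) (auto intro!: ennreal_leI split: split_indicator)
  also have "\<dots> = ennreal K * emeasure lborel A"
    by (simp add: nn_integral_cmult)
  also have "\<dots> < \<infinity>"
    using emeasure_bounded_finite[OF bdd] by (simp add: ennreal_mult_less_top)
  finally have fin: "(\<integral>\<^sup>+z\<in>A. ennreal ((cmod (f' z))\<^sup>2) \<partial>lborel) < \<infinity>" .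
  have [measurable]: "(\<lambda>v. \<bar>det (matrix (F' v))\<bar>) \<in> borel_measurable borel"
    unfolding det by measurable
  have int: "set_integrable lborel S (\<lambda>v. \<bar>det (matrix (F' v))\<bar>)"
    unfolding set_integrable_def
    by (rule integrableI_nonneg) (use fin transfer in auto)
  have HK: "(\<lambda>v. \<bar>det (matrix (F' v))\<bar>) integrable_on S"
    "integral S (\<lambda>v. \<bar>det (matrix (F' v))\<bar>) = (LINT v:S|lborel. \<bar>det (matrix (F' v))\<bar>)"
    using set_borel_integral_eq_integral[OF int] by auto
  have SL: "S \<in> sets lebesgue" by simp
  have "F ` S \<in> lmeasurable"
    using measurable_differentiable_image_eq[OF SL derF injF] HK by simp
  then have "emeasure lebesgue (F ` S) = ennreal (measure lebesgue (F ` S))"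
    by (rule emeasure_eq_measure2)
  moreover have "emeasure lebesgue (F ` S) = emeasure lborel (F ` S)"
    by (subst emeasure_completion) simp_all
  ultimately have "emeasure lborel (F ` S) = ennreal (measure lebesgue (F ` S))" by simp
  also have "\<dots> = ennreal (LINT v:S|lborel. \<bar>det (matrix (F' v))\<bar>)"
    using measure_differentiable_image_eq[OF SL derF injF HK(1)] HK(2) by simp
  also have "\<dots> = (\<integral>\<^sup>+v. ennreal (indicator S v * \<bar>det (matrix (F' v))\<bar>) \<partial>lborel)"
    unfolding set_lebesgue_integral_def
    using int by (subst nn_integral_eq_integral) (auto simp: set_integrable_def)
  finally have "emeasure lborel (F ` S) = \<dots>" .
  moreover have "emeasure (distr lborel borel complex_of_vec) (f ` A) = emeasure lborel (F ` S)"
    by (simp add: emeasure_distr FS)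
  ultimately show ?thesis using transfer by (simp add: distr_complex_of_vec)
qed

text \<open>The local inverse \<open>g\<close> is part of the conclusion because it turns a sum over
  the fibre of \<open>w\<close> into a sum over pieces of functions of \<open>w\<close>. Images of
  Borel subsets of \<open>B\<close> are Borel, being preimages under \<open>g\<close> cut down to
  the open image of \<open>B\<close>.\<close>

lemma nn_integral_injective_piece:
  fixes f f' :: "complex \<Rightarrow> complex" and h :: "complex \<Rightarrow> ennreal"
  assumes deriv: "\<And>z. (f has_field_derivative f' z) (at z)"
    and cont: "continuous_on UNIV f'"
    and B: "open B" "bounded B" "inj_on f B"
    and A [measurable]: "A \<in> sets borel" and AB: "A \<subseteq> B"
    and h [measurable]: "h \<in> borel_measurable borel"
  shows "\<exists>g. g \<in> borel_measurable borel \<and> f ` A \<in> sets borel \<and> (\<forall>z\<in>A. g (f z) = z) \<and>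
    (\<integral>\<^sup>+w\<in>f ` A. h (g w) \<partial>lborel) = (\<integral>\<^sup>+z\<in>A. h z * ennreal ((cmod (f' z))\<^sup>2) \<partial>lborel)"
proof -
  have hol: "f holomorphic_on B"
    using deriv by (meson field_differentiable_at_within field_differentiable_def holomorphic_on_def)
  have [measurable]: "f' \<in> borel_measurable borel"
    using cont by (rule borel_measurable_continuous_onI)
  have [measurable]: "f \<in> borel_measurable borel"
    using deriv by (intro borel_measurable_continuous_onI DERIV_continuous_on)
      (auto intro: has_field_derivative_at_within)
  obtain g0 where g0: "g0 holomorphic_on (f ` B)" "\<And>z. z \<in> B \<Longrightarrow> g0 (f z) = z"
    using holomorphic_has_inverse[OF hol B(1,3)] by metis
  have openfB: "open (f ` B)"
    by (rule open_mapping_thm3[OF hol B(1,3)])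
  \<comment> \<open>Extension by 0 off the open image makes the holomorphic inverse Borel on the
    whole plane.\<close>
  define g where "g = (\<lambda>w. if w \<in> f ` B then g0 w else 0)"
  have g_m [measurable]: "g \<in> borel_measurable borel"
    unfolding g_def using openfB g0(1)
    by (intro borel_measurable_continuous_on_if holomorphic_on_imp_continuous_on continuous_on_const) auto
  have gf: "g (f z) = z" if "z \<in> B" for z using that g0 by (auto simp: g_def)
  have img: "f ` C \<in> sets borel" if C: "C \<in> sets borel" "C \<subseteq> B" for C
  proof -
    have "f ` C = f ` B \<inter> g -` C"
      using C(2) gf by auto
    moreover have "g -` C \<in> sets borel"
      using measurable_sets[OF g_m C(1)] by simp
    ultimately show ?thesis using openfB by auto
  qed
  have fA [measurable]: "f ` A \<in> sets borel" by (rule img[OF A AB])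
  \<comment> \<open>The area formula for all Borel subsets of \<open>A\<close> at once says that two
    measures agree: Lebesgue measure on the image, and the push-forward of the Jacobian density.
    Integrating \<open>h (g w)\<close> against both gives the claim.\<close>
  have "density lborel (indicator (f ` A))
      = distr (density lborel (\<lambda>z. indicator A z * ennreal ((cmod (f' z))\<^sup>2))) borel f" (is "?L = ?R")
  proof (rule measure_eqI)
    fix W assume "W \<in> sets ?L"
    then have W[measurable]: "W \<in> sets borel" by simp
    have fW[measurable]: "f -` W \<in> sets borel"
      using measurable_sets[of f borel borel W] W by simp
    have sub: "A \<inter> f -` W \<subseteq> B" using AB by auto
    have "emeasure ?L W = emeasure lborel (f ` (A \<inter> f -` W))"
    proof -
      have [measurable]: "f ` (A \<inter> f -` W) \<in> sets borel" by (rule img[OF _ sub]) simp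
      have "f ` A \<inter> W = f ` (A \<inter> f -` W)" by auto
      then show ?thesis
        by (subst emeasure_density) (auto simp: indicator_inter_arith[symmetric])
    qed
    also have "\<dots> = (\<integral>\<^sup>+z\<in>A \<inter> f -` W. ennreal ((cmod (f' z))\<^sup>2) \<partial>lborel)"
      using deriv cont B sub
      by (intro emeasure_injective_image_complex img)
         (auto intro: bounded_subset[OF B(2)] inj_on_subset[OF B(3)])
    also have "\<dots> = emeasure ?R W"
      by (subst emeasure_distr, simp, simp, subst emeasure_density)
         (auto intro!: nn_integral_cong simp: indicator_inter_arith ac_simps split: split_indicator)
    finally show "emeasure ?L W = emeasure ?R W" .
  qed simp
  then have "(\<integral>\<^sup>+w. h (g w) \<partial>?L) = (\<integral>\<^sup>+w. h (g w) \<partial>?R)" by simp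
  moreover have "(\<integral>\<^sup>+w. h (g w) \<partial>?L) = (\<integral>\<^sup>+w\<in>f ` A. h (g w) \<partial>lborel)"
    by (subst nn_integral_density) (auto simp: ac_simps)
  moreover have "(\<integral>\<^sup>+w. h (g w) \<partial>?R) = (\<integral>\<^sup>+z\<in>A. h z * ennreal ((cmod (f' z))\<^sup>2) \<partial>lborel)"
    using gf AB by (subst nn_integral_distr, simp, simp, subst nn_integral_density)
      (auto intro!: nn_integral_cong simp: ac_simps split: split_indicator)
  ultimately have "(\<integral>\<^sup>+w\<in>f ` A. h (g w) \<partial>lborel)
      = (\<integral>\<^sup>+z\<in>A. h z * ennreal ((cmod (f' z))\<^sup>2) \<partial>lborel)"
    by simp
  then show ?thesis using g_m fA gf AB by (intro exI[of _ g] conjI ballI) auto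
qed

text \<open>Away from the finitely many critical points \<open>q\<close> is locally injective; by
  Lindelof countably many such neighbourhoods suffice, and made disjoint they reduce the formula to
  the injective case. Critical points and critical values form finite, hence null, sets.\<close>

lemma nn_integral_sum_poly_fibre:
  fixes q :: "complex poly" and h :: "complex \<Rightarrow> ennreal"
  assumes h [measurable]: "h \<in> borel_measurable borel"
  shows "(\<integral>\<^sup>+w. (\<Sum>z\<in>{z. poly q z = w}. h z) \<partial>lborel)
       = (\<integral>\<^sup>+z. h z * ennreal ((cmod (poly (pderiv q) z))\<^sup>2) \<partial>lborel)"
proof (cases "pderiv q = 0")
  case True
  then obtain c where q: "q = [:c:]"
    by (metis pderiv_eq_0_iff degree_eq_zeroE)
  \<comment> \<open>For a constant polynomial every fibre is empty or the whole plane, and a sum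
    over an infinite set is 0 by convention, so both sides of the formula vanish.\<close>
  have "(\<Sum>z\<in>{z. poly q z = w}. h z) = 0" for w
    by (cases "w = c") (simp_all add: q infinite_UNIV_char_0)
  then show ?thesis using True by simp
next
  case False
  define f where "f = poly q"
  define f' where "f' = poly (pderiv q)"
  have der: "(f has_field_derivative f' z) (at z)" for z
    unfolding f_def f'_def by (rule poly_DERIV)
  have cont: "continuous_on UNIV f'"
    unfolding f'_def by (intro continuous_intros)
  have [measurable]: "f' \<in> borel_measurable borel"
    using cont by (rule borel_measurable_continuous_onI)
  have fin: "finite {z. f z = w}" for w
  proof -
    have "q - [:w:] \<noteq> 0" using False by auto
    then have "finite {z. poly (q - [:w:]) z = 0}" by (rule poly_roots_finite)
    then show ?thesis by (simp add: f_def)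
  qed
  have fin': "finite {z. f' z = 0}"
    unfolding f'_def using False by (rule poly_roots_finite)
  define \<F> where "\<F> = {B. open B \<and> bounded B \<and> inj_on f B \<and> (\<forall>z\<in>B. f' z \<noteq> 0)}"
  have cover: "\<Union>\<F> = {z. f' z \<noteq> 0}"
  proof (intro subset_antisym subsetI)
    fix z assume z: "z \<in> {z. f' z \<noteq> 0}"
    have op: "open {z. f' z \<noteq> 0}"
      using cont by (intro open_Collect_neq) (auto simp: continuous_on_eq_continuous_within)
    have "deriv f z \<noteq> 0" using z DERIV_imp_deriv[OF der] by simp
    moreover have "f holomorphic_on {z. f' z \<noteq> 0}"
      using der by (meson field_differentiable_at_within field_differentiable_def holomorphic_on_def)
    ultimately obtain r where "r > 0" "ball z r \<subseteq> {z. f' z \<noteq> 0}" "inj_on f (ball z r)"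
      using has_complex_derivative_locally_injective[OF _ z op] by blast
    then have "ball z r \<in> \<F>" "z \<in> ball z r" by (auto simp: \<F>_def)
    then show "z \<in> \<Union>\<F>" by blast
  qed (auto simp: \<F>_def)
  obtain \<G> where \<G>: "\<G> \<subseteq> \<F>" "countable \<G>" "\<Union>\<G> = \<Union>\<F>"
    using Lindelof[of \<F>] by (auto simp: \<F>_def)
  \<comment> \<open>The empty set is added so that the family to be enumerated is nonempty.\<close>
  define B where "B = from_nat_into (insert {} \<G>)"
  have rB: "range B = insert {} \<G>"
    unfolding B_def using \<G> by (intro range_from_nat_into) auto
  have "{} \<in> \<F>" by (simp add: \<F>_def)
  then have B: "B i \<in> \<F>" for i using rB \<G> by (metis insert_subset rangeI subsetD)
  have UB: "(\<Union>i. B i) = {z. f' z \<noteq> 0}"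
    using rB \<G> cover by simp
  define A where "A = disjointed B"
  have AB: "A i \<subseteq> B i" for i unfolding A_def by (rule disjointed_subset)
  have A[measurable]: "A i \<in> sets borel" for i
  proof -
    have "range B \<subseteq> sets borel" using B by (auto simp: \<F>_def)
    from sets.range_disjointed_sets[OF this] show ?thesis by (auto simp: A_def)
  qed
  have disj: "disjoint_family A" unfolding A_def by (rule disjoint_family_disjointed)
  have UA: "(\<Union>i. A i) = {z. f' z \<noteq> 0}" unfolding A_def UN_disjointed_eq UB ..
  let ?P = "\<lambda>i g. g \<in> borel_measurable borel \<and> f ` A i \<in> sets borel \<and> (\<forall>z\<in>A i. g (f z) = z) \<and>
    (\<integral>\<^sup>+w\<in>f ` A i. h (g w) \<partial>lborel) = (\<integral>\<^sup>+z\<in>A i. h z * ennreal ((cmod (f' z))\<^sup>2) \<partial>lborel)"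
  have "\<exists>g. ?P i g" for i
  proof -
    have "open (B i)" "bounded (B i)" "inj_on f (B i)" using B[of i] by (auto simp: \<F>_def)
    then show ?thesis by (rule nn_integral_injective_piece[OF der cont _ _ _ A AB h])
  qed
  then have "\<exists>g. \<forall>i. ?P i (g i)"
    by (intro choice allI)
  then obtain g where g: "\<forall>i. ?P i (g i)"
    by (rule exE)
  have [measurable]: "g i \<in> borel_measurable borel" "f ` A i \<in> sets borel"
    and eq: "(\<integral>\<^sup>+w\<in>f ` A i. h (g i w) \<partial>lborel)
        = (\<integral>\<^sup>+z\<in>A i. h z * ennreal ((cmod (f' z))\<^sup>2) \<partial>lborel)" for i
    using spec[OF g, of i] by simp_all
  have gf: "g i (f z) = z" if "z \<in> A i" for i z
    using spec[OF g, of i] that by simp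
  \<comment> \<open>Critical values are excluded since a critical point in the fibre lies in none of
    the pieces. Each piece contains at most one point of the fibre, namely
    \<open>g i w\<close>.\<close>
  have fibre: "(\<Sum>z\<in>{z. f z = w}. h z) = (\<Sum>i. h (g i w) * indicator (f ` A i) w)"
    if w: "w \<notin> f ` {z. f' z = 0}" for w
  proof -
    have 1: "(\<Sum>z\<in>{z. f z = w}. h z * indicator (A i) z) = h (g i w) * indicator (f ` A i) w" for i
    proof (cases "w \<in> f ` A i")
      case True
      then obtain z0 where z0: "z0 \<in> A i" "w = f z0" by auto
      have "(\<Sum>z\<in>{z. f z = w}. h z * indicator (A i) z) = (\<Sum>z\<in>{z0}. h z * indicator (A i) z)"
        using fin z0 gf by (intro sum.mono_neutral_right) (auto split: split_indicator, metis)
      then show ?thesis using z0 gf by simp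
    qed (auto intro!: sum.neutral split: split_indicator)
    have 2: "(\<Sum>i. h z * indicator (A i) z) = h z" if "f z = w" for z
    proof -
      have "z \<in> (\<Union>i. A i)" using that w unfolding UA by auto
      then show ?thesis
        using suminf_indicator[OF disj, of z] by (simp add: indicator_def)
    qed
    have "(\<Sum>z\<in>{z. f z = w}. h z) = (\<Sum>z\<in>{z. f z = w}. \<Sum>i. h z * indicator (A i) z)"
      using 2 by (intro sum.cong) auto
    also have "\<dots> = (\<Sum>i. \<Sum>z\<in>{z. f z = w}. h z * indicator (A i) z)"
      by (rule suminf_sum[symmetric]) auto
    finally show ?thesis by (simp add: 1)
  qed
  have ae: "AE w in lborel. w \<notin> f ` {z. f' z = 0}"
    using fin' by (intro AE_not_in finite_imp_null_set_lborel finite_imageI)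
  have ae': "AE z in lborel. z \<notin> {z. f' z = 0}"
    using fin' by (intro AE_not_in finite_imp_null_set_lborel)
  have "(\<integral>\<^sup>+w. (\<Sum>z\<in>{z. f z = w}. h z) \<partial>lborel)
      = (\<integral>\<^sup>+w. (\<Sum>i. h (g i w) * indicator (f ` A i) w) \<partial>lborel)"
    using ae by (intro nn_integral_cong_AE) (auto elim!: eventually_mono simp: fibre)
  also have "\<dots> = (\<Sum>i. \<integral>\<^sup>+w\<in>f ` A i. h (g i w) \<partial>lborel)"
    by (rule nn_integral_suminf) measurable
  also have "\<dots> = (\<Sum>i. \<integral>\<^sup>+z\<in>A i. h z * ennreal ((cmod (f' z))\<^sup>2) \<partial>lborel)"
    by (simp add: eq)
  also have "\<dots> = (\<integral>\<^sup>+z\<in>(\<Union>i. A i). h z * ennreal ((cmod (f' z))\<^sup>2) \<partial>lborel)"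
    using disj by (intro nn_integral_disjoint_family[symmetric]) auto
  also have "\<dots> = (\<integral>\<^sup>+z. h z * ennreal ((cmod (f' z))\<^sup>2) \<partial>lborel)"
    unfolding UA by (intro nn_integral_cong) (auto split: split_indicator)
  finally show ?thesis by (simp add: f_def f'_def)
qed

section \<open>Complex Gaussian vectors\<close>

definition cgauss :: "complex measure" where
  "cgauss = density lborel standard_complex_gaussian_density"

lemma standard_complex_gaussian_density_measurable [measurable]:
  "standard_complex_gaussian_density \<in> borel_measurable borel"
  unfolding standard_complex_gaussian_density_def[abs_def] by measurable

lemma sets_cgauss [simp, measurable_cong]: "sets cgauss = sets borel"
  by (simp add: cgauss_def)

lemma space_cgauss [simp]: "space cgauss = UNIV"
  by (simp add: cgauss_def)

lemma nn_integral_cgauss: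
  "F \<in> borel_measurable borel \<Longrightarrow>
   (\<integral>\<^sup>+z. F z \<partial>cgauss) = (\<integral>\<^sup>+z. standard_complex_gaussian_density z * F z \<partial>lborel)"
  unfolding cgauss_def by (subst nn_integral_density) auto

lemma nn_integral_exp_Ici:
  assumes "c > 0"
  shows "(\<integral>\<^sup>+t\<in>{0..}. ennreal (exp (- c * t)) \<partial>lborel) = ennreal (1 / c)"
proof -
  have "1 = (\<integral>\<^sup>+t. ennreal (exponential_density c t) \<partial>lborel)"
    using prob_space.emeasure_space_1[OF prob_space_exponential_density[OF assms]]
    by (simp add: emeasure_density)
  also have "\<dots> = (\<integral>\<^sup>+t. ennreal c * (ennreal (exp (- c * t)) * indicator {0..} t) \<partial>lborel)"
    using assms by (intro nn_integral_cong)
      (auto simp: exponential_density_def ennreal_mult ac_simps split: split_indicator)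
  also have "\<dots> = ennreal c * (\<integral>\<^sup>+t\<in>{0..}. ennreal (exp (- c * t)) \<partial>lborel)"
    by (simp add: nn_integral_cmult)
  finally have "ennreal (1 / c) * 1
      = ennreal (1 / c) * (ennreal c * (\<integral>\<^sup>+t\<in>{0..}. ennreal (exp (- c * t)) \<partial>lborel))"
    by simp
  also have "\<dots> = ennreal (1 / c * c) * (\<integral>\<^sup>+t\<in>{0..}. ennreal (exp (- c * t)) \<partial>lborel)"
    using assms by (subst ennreal_mult) (auto simp: mult.assoc)
  finally show ?thesis using assms by simp
qed

lemma prob_space_cgauss: "prob_space cgauss"
proof
  have "emeasure cgauss (space cgauss) = (\<integral>\<^sup>+z. standard_complex_gaussian_density z \<partial>lborel)"
    by (simp add: cgauss_def emeasure_density)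
  also have "\<dots> = (\<integral>\<^sup>+(z::complex). ennreal (1 / pi) * ennreal (exp (- ((cmod z)\<^sup>2))) \<partial>lborel)"
    by (intro nn_integral_cong) (simp add: standard_complex_gaussian_density_def ennreal_mult'[symmetric])
  also have "\<dots> = ennreal (1 / pi) * (ennreal pi * (\<integral>\<^sup>+t\<in>{0..}. ennreal (exp (- 1 * t)) \<partial>lborel))"
    by (subst nn_integral_cmult, simp, subst nn_integral_complex_radial[of "\<lambda>t. ennreal (exp (- t))"]) auto
  also have "\<dots> = 1"
    by (subst nn_integral_exp_Ici) (auto simp: ennreal_mult'[symmetric])
  finally show "emeasure cgauss (space cgauss) = 1" .
qed

interpretation cgauss: prob_space cgauss by (rule prob_space_cgauss)
interpretation cgauss_pair: pair_sigma_finite cgauss cgauss ..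

lemma nn_integral_lborel_translate:
  fixes F :: "'a::euclidean_space \<Rightarrow> ennreal"
  assumes [measurable]: "F \<in> borel_measurable borel"
  shows "(\<integral>\<^sup>+y. F (y + c) \<partial>lborel) = (\<integral>\<^sup>+y. F y \<partial>lborel)"
proof -
  have "(\<integral>\<^sup>+y. F y \<partial>lborel) = (\<integral>\<^sup>+y. F y \<partial>distr lborel borel ((+) c))"
    by (simp add: lborel_distr_plus)
  also have "\<dots> = (\<integral>\<^sup>+y. F (y + c) \<partial>lborel)"
    by (subst nn_integral_distr) (auto simp: add.commute)
  finally show ?thesis ..
qed

lemma nn_integral_lborel_swap:
  fixes G :: "'a::euclidean_space \<times> 'b::euclidean_space \<Rightarrow> ennreal"
  assumes "G \<in> borel_measurable (borel \<Otimes>\<^sub>M borel)"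
  shows "(\<integral>\<^sup>+x. \<integral>\<^sup>+y. G (x, y) \<partial>lborel \<partial>lborel) = (\<integral>\<^sup>+y. \<integral>\<^sup>+x. G (x, y) \<partial>lborel \<partial>lborel)"
proof (rule lborel_pair.Fubini'[symmetric])
  show "(\<lambda>(x, y). G (x, y)) \<in> borel_measurable (lborel \<Otimes>\<^sub>M lborel)"
    using assms by simp
qed

text \<open>Translation invariance and Fubini make every shear measure preserving, and with
  \<open>C \<noteq> 0\<close> a matrix of determinant 1 is upper shear times lower shear times upper
  shear. No Jacobian in two complex variables is needed.\<close>

lemma nn_integral_unimodular:
  fixes H :: "complex \<times> complex \<Rightarrow> ennreal"
  assumes H [measurable]: "H \<in> borel_measurable (borel \<Otimes>\<^sub>M borel)"
    and det: "A * D - B * C = 1" and C: "C \<noteq> 0"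
  shows "(\<integral>\<^sup>+x. \<integral>\<^sup>+y. H (A * x + B * y, C * x + D * y) \<partial>lborel \<partial>lborel)
       = (\<integral>\<^sup>+x. \<integral>\<^sup>+y. H (x, y) \<partial>lborel \<partial>lborel)"
proof -
  have shear1: "(\<integral>\<^sup>+x. \<integral>\<^sup>+y. G (x, y + a * x) \<partial>lborel \<partial>lborel) = (\<integral>\<^sup>+x. \<integral>\<^sup>+y. G (x, y) \<partial>lborel \<partial>lborel)"
    if [measurable]: "G \<in> borel_measurable (borel \<Otimes>\<^sub>M borel)"
    for G :: "complex \<times> complex \<Rightarrow> ennreal" and a
    by (intro nn_integral_cong nn_integral_lborel_translate) measurable
  have shear2: "(\<integral>\<^sup>+x. \<integral>\<^sup>+y. G (x + a * y, y) \<partial>lborel \<partial>lborel) = (\<integral>\<^sup>+x. \<integral>\<^sup>+y. G (x, y) \<partial>lborel \<partial>lborel)"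
    if [measurable]: "G \<in> borel_measurable (borel \<Otimes>\<^sub>M borel)"
    for G :: "complex \<times> complex \<Rightarrow> ennreal" and a
  proof -
    have "(\<integral>\<^sup>+x. \<integral>\<^sup>+y. G (x + a * y, y) \<partial>lborel \<partial>lborel) = (\<integral>\<^sup>+y. \<integral>\<^sup>+x. G (x + a * y, y) \<partial>lborel \<partial>lborel)"
      by (rule nn_integral_lborel_swap[of "\<lambda>(x, y). G (x + a * y, y)", simplified]) measurable
    also have "\<dots> = (\<integral>\<^sup>+y. \<integral>\<^sup>+x. G (x, y) \<partial>lborel \<partial>lborel)"
      by (intro nn_integral_cong nn_integral_lborel_translate) measurable
    finally show ?thesis by (simp add: nn_integral_lborel_swap)
  qed
  \<comment> \<open>Multiplying out the shears with parameters \<open>p\<close>, \<open>C\<close>,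
    \<open>p'\<close> forces \<open>1 + p * C = A\<close> and \<open>1 + C * p' = D\<close>; the
    remaining entry is then \<open>B\<close> by the determinant condition.\<close>
  define p where "p = (A - 1) / C"
  define p' where "p' = (D - 1) / C"
  define G1 where "G1 = (\<lambda>(x, y). H (x + p * y, y))"
  define G2 where "G2 = (\<lambda>(x, y). G1 (x, y + C * x))"
  have [measurable]: "G1 \<in> borel_measurable (borel \<Otimes>\<^sub>M borel)"
    unfolding G1_def by measurable
  have [measurable]: "G2 \<in> borel_measurable (borel \<Otimes>\<^sub>M borel)"
    unfolding G2_def by measurable
  have "(\<integral>\<^sup>+x. \<integral>\<^sup>+y. H (x, y) \<partial>lborel \<partial>lborel) = (\<integral>\<^sup>+x. \<integral>\<^sup>+y. G1 (x, y) \<partial>lborel \<partial>lborel)"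
    unfolding G1_def by (simp add: shear2)
  also have "\<dots> = (\<integral>\<^sup>+x. \<integral>\<^sup>+y. G2 (x, y) \<partial>lborel \<partial>lborel)"
    unfolding G2_def by (simp add: shear1)
  also have "\<dots> = (\<integral>\<^sup>+x. \<integral>\<^sup>+y. G2 (x + p' * y, y) \<partial>lborel \<partial>lborel)"
    by (simp add: shear2)
  also have "\<dots> = (\<integral>\<^sup>+x. \<integral>\<^sup>+y. H (A * x + B * y, C * x + D * y) \<partial>lborel \<partial>lborel)"
  proof -
    have 1: "y + C * (x + p' * y) = C * x + D * y" for x y
      using C by (simp add: p'_def field_simps)
    have pC: "p * C = A - 1" and p'C: "p' * C = D - 1" using C by (simp_all add: p_def p'_def)
    have "(p' + p * D) * C = p' * C + (p * C) * D" by (simp add: algebra_simps)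
    also have "\<dots> = B * C" using det unfolding pC p'C by (simp add: algebra_simps)
    finally have "p' + p * D = B" using C by simp
    moreover have "x + p' * y + p * (C * x + D * y) = (1 + p * C) * x + (p' + p * D) * y" for x y
      by (simp add: algebra_simps)
    ultimately have 2: "x + p' * y + p * (C * x + D * y) = A * x + B * y" for x y
      by (simp add: pC)
    show ?thesis unfolding G2_def G1_def prod.case 1 2 ..
  qed
  finally show ?thesis ..
qed

text \<open>For \<open>p \<noteq> 0\<close> the rotation is a product of three shears; for \<open>p = 0\<close> the identity already
  clears the second entry.\<close>

lemma cgauss_rotation:
  fixes \<alpha> p :: complex
  obtains A B C D where "\<alpha> * B + p * D = 0" "A * cnj A + B * cnj B = 1" "C * cnj C + D * cnj D = 1"
    "A * cnj C + B * cnj D = 0"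
    "\<And>H. H \<in> borel_measurable (borel \<Otimes>\<^sub>M borel) \<Longrightarrow>
      (\<integral>\<^sup>+x. \<integral>\<^sup>+y. H (x, y) \<partial>cgauss \<partial>cgauss)
      = (\<integral>\<^sup>+x. \<integral>\<^sup>+y. H (A * x + B * y, C * x + D * y) \<partial>cgauss \<partial>cgauss)"
proof (cases "p = 0")
  case True
  \<comment> \<open>The positional arguments follow the order of occurrence \<open>B\<close>,
    \<open>D\<close>, \<open>A\<close>, \<open>C\<close>, so this is the identity matrix.\<close>
  then show ?thesis by (intro that[of 0 1 1 0]) auto
next
  case False
  define \<nu> where "\<nu> = complex_of_real (sqrt ((cmod \<alpha>)\<^sup>2 + (cmod p)\<^sup>2))"
  have pos: "(cmod \<alpha>)\<^sup>2 + (cmod p)\<^sup>2 > 0" using False by (simp add: add_nonneg_pos)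
  have nz: "\<nu> \<noteq> 0" using False by (simp add: \<nu>_def)
  have cn: "cnj \<nu> = \<nu>" by (simp add: \<nu>_def)
  have "\<nu> * \<nu> = complex_of_real ((cmod \<alpha>)\<^sup>2 + (cmod p)\<^sup>2)"
    unfolding \<nu>_def of_real_mult[symmetric] using pos by simp
  then have sq: "\<nu> * \<nu> = \<alpha> * cnj \<alpha> + p * cnj p"
    by (simp only: of_real_add complex_norm_square)
  \<comment> \<open>The second column is proportional to \<open>(- p, \<alpha>)\<close>, which the
    row \<open>(\<alpha>, p)\<close> annihilates; the first is the normalised conjugate of that row.
    So the matrix is unitary of determinant 1.\<close>
  define A B C D where ABCD: "A = cnj \<alpha> / \<nu>" "B = - p / \<nu>" "C = cnj p / \<nu>" "D = \<alpha> / \<nu>"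
  have *: "a / \<nu> * (b / \<nu>) = a * b / (\<alpha> * cnj \<alpha> + p * cnj p)" for a b
    by (simp add: sq[symmetric])
  have nz': "\<alpha> * cnj \<alpha> + p * cnj p \<noteq> 0" using nz by (simp add: sq[symmetric])
  have rows: "A * cnj A + B * cnj B = 1" "C * cnj C + D * cnj D = 1" "A * cnj C + B * cnj D = 0"
    and det: "A * D - B * C = 1" and clear: "\<alpha> * B + p * D = 0"
    using nz' by (simp_all add: ABCD cn * add_divide_distrib[symmetric] diff_divide_distrib[symmetric])
      (simp_all add: nz sq algebra_simps)
  have C: "C \<noteq> 0" using False nz by (simp add: ABCD)
  show ?thesis
  proof (rule that[OF clear rows])
    fix H :: "complex \<times> complex \<Rightarrow> ennreal"
    assume H [measurable]: "H \<in> borel_measurable (borel \<Otimes>\<^sub>M borel)"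
    let ?\<rho> = standard_complex_gaussian_density
    have lb: "(\<integral>\<^sup>+x. \<integral>\<^sup>+y. G (x, y) \<partial>cgauss \<partial>cgauss) = (\<integral>\<^sup>+x. \<integral>\<^sup>+y. ?\<rho> x * ?\<rho> y * G (x, y) \<partial>lborel \<partial>lborel)"
      if [measurable]: "G \<in> borel_measurable (borel \<Otimes>\<^sub>M borel)" for G
    proof -
      have "(\<integral>\<^sup>+y. G (x, y) \<partial>cgauss) = (\<integral>\<^sup>+y. ?\<rho> y * G (x, y) \<partial>lborel)" for x
        by (rule nn_integral_cgauss) measurable
      then have "(\<integral>\<^sup>+x. \<integral>\<^sup>+y. G (x, y) \<partial>cgauss \<partial>cgauss)
          = (\<integral>\<^sup>+x. ?\<rho> x * (\<integral>\<^sup>+y. ?\<rho> y * G (x, y) \<partial>lborel) \<partial>lborel)"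
        by (simp add: nn_integral_cgauss)
      then show ?thesis
        by (subst (asm) nn_integral_cmult[symmetric]) (auto simp: mult.assoc)
    qed
    \<comment> \<open>The product of the two densities depends only on the sum of the squared
      moduli, which a unitary map preserves; here it is orthonormality of the columns, not of the
      rows, that enters.\<close>
    have \<rho>: "?\<rho> (A * x + B * y) * ?\<rho> (C * x + D * y) = ?\<rho> x * ?\<rho> y" for x y
    proof -
      have cols: "A * cnj A + C * cnj C = 1" "B * cnj B + D * cnj D = 1"
        "A * cnj B + C * cnj D = 0" "B * cnj A + D * cnj C = 0"
        using nz' by (simp_all add: ABCD cn * add_divide_distrib[symmetric] diff_divide_distrib[symmetric])
          (simp_all add: nz sq algebra_simps)
      have "complex_of_real ((cmod (A * x + B * y))\<^sup>2 + (cmod (C * x + D * y))\<^sup>2)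
          = (A * cnj A + C * cnj C) * (x * cnj x) + (B * cnj B + D * cnj D) * (y * cnj y)
            + (A * cnj B + C * cnj D) * (x * cnj y) + (B * cnj A + D * cnj C) * (y * cnj x)"
        unfolding of_real_add complex_norm_square by (simp add: algebra_simps)
      also have "\<dots> = complex_of_real ((cmod x)\<^sup>2 + (cmod y)\<^sup>2)"
        unfolding cols of_real_add complex_norm_square by simp
      finally have "complex_of_real ((cmod (A * x + B * y))\<^sup>2 + (cmod (C * x + D * y))\<^sup>2)
          = complex_of_real ((cmod x)\<^sup>2 + (cmod y)\<^sup>2)" .
      then have "(cmod (A * x + B * y))\<^sup>2 + (cmod (C * x + D * y))\<^sup>2 = (cmod x)\<^sup>2 + (cmod y)\<^sup>2"
        using of_real_eq_iff by blast
      then have "- ((cmod (A * x + B * y))\<^sup>2) + - ((cmod (C * x + D * y))\<^sup>2)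
          = - ((cmod x)\<^sup>2) + - ((cmod y)\<^sup>2)" by linarith
      then show ?thesis
        unfolding standard_complex_gaussian_density_def
        by (simp add: ennreal_mult'[symmetric] mult_exp_exp del: add_uminus_conv_diff)
    qed
    have "(\<integral>\<^sup>+x. \<integral>\<^sup>+y. H (x, y) \<partial>cgauss \<partial>cgauss) = (\<integral>\<^sup>+x. \<integral>\<^sup>+y. ?\<rho> x * ?\<rho> y * H (x, y) \<partial>lborel \<partial>lborel)"
      by (rule lb[OF H])
    also have "\<dots> = (\<integral>\<^sup>+x. \<integral>\<^sup>+y. ?\<rho> (A * x + B * y) * ?\<rho> (C * x + D * y) * H (A * x + B * y, C * x + D * y) \<partial>lborel \<partial>lborel)"
      using nn_integral_unimodular[OF _ det C, of "\<lambda>(x, y). ?\<rho> x * ?\<rho> y * H (x, y)"] by simp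
    also have "\<dots> = (\<integral>\<^sup>+x. \<integral>\<^sup>+y. H (A * x + B * y, C * x + D * y) \<partial>cgauss \<partial>cgauss)"
      unfolding \<rho> using lb[of "\<lambda>(x, y). H (A * x + B * y, C * x + D * y)"] by simp
    finally show "(\<integral>\<^sup>+x. \<integral>\<^sup>+y. H (x, y) \<partial>cgauss \<partial>cgauss)
      = (\<integral>\<^sup>+x. \<integral>\<^sup>+y. H (A * x + B * y, C * x + D * y) \<partial>cgauss \<partial>cgauss)" .
  qed
qed

text \<open>The triple of Gaussian forms has the law of a lower triangular image of three independent
  Gaussians; by induction on the index set, one new variable is absorbed by three rotations.\<close>

lemma nn_integral_gaussian_linear_forms:
  fixes u v w :: "'i \<Rightarrow> complex"
  assumes "finite I"
  shows "\<exists>\<alpha> \<beta> \<gamma> \<delta> \<epsilon> \<zeta>.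
    \<alpha> * cnj \<alpha> = (\<Sum>j\<in>I. u j * cnj (u j)) \<and>
    \<beta> * cnj \<alpha> = (\<Sum>j\<in>I. v j * cnj (u j)) \<and>
    \<beta> * cnj \<beta> + \<gamma> * cnj \<gamma> = (\<Sum>j\<in>I. v j * cnj (v j)) \<and>
    \<delta> * cnj \<alpha> = (\<Sum>j\<in>I. w j * cnj (u j)) \<and>
    \<delta> * cnj \<beta> + \<epsilon> * cnj \<gamma> = (\<Sum>j\<in>I. w j * cnj (v j)) \<and>
    \<delta> * cnj \<delta> + \<epsilon> * cnj \<epsilon> + \<zeta> * cnj \<zeta> = (\<Sum>j\<in>I. w j * cnj (w j)) \<and>
    (\<forall>H \<in> borel_measurable (borel \<Otimes>\<^sub>M (borel \<Otimes>\<^sub>M borel)).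
      (\<integral>\<^sup>+x. H (\<Sum>j\<in>I. u j * x j, \<Sum>j\<in>I. v j * x j, \<Sum>j\<in>I. w j * x j) \<partial>PiM I (\<lambda>_. cgauss))
      = (\<integral>\<^sup>+x. \<integral>\<^sup>+y. \<integral>\<^sup>+z. H (\<alpha> * x, \<beta> * x + \<gamma> * y, \<delta> * x + \<epsilon> * y + \<zeta> * z) \<partial>cgauss \<partial>cgauss \<partial>cgauss))"
  using assms
proof (induction I rule: finite_induct)
  case empty
  interpret product_sigma_finite "\<lambda>_::'i. cgauss" ..
  show ?case
    by (rule exI[of _ 0])+ (simp add: space_PiM_empty cgauss.emeasure_space_1[simplified])
next
  case (insert i I)
  interpret product_sigma_finite "\<lambda>_::'i. cgauss" ..
  obtain \<alpha> \<beta> \<gamma> \<delta> \<epsilon> \<zeta> where gram: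
    "\<alpha> * cnj \<alpha> = (\<Sum>j\<in>I. u j * cnj (u j))"
    "\<beta> * cnj \<alpha> = (\<Sum>j\<in>I. v j * cnj (u j))"
    "\<beta> * cnj \<beta> + \<gamma> * cnj \<gamma> = (\<Sum>j\<in>I. v j * cnj (v j))"
    "\<delta> * cnj \<alpha> = (\<Sum>j\<in>I. w j * cnj (u j))"
    "\<delta> * cnj \<beta> + \<epsilon> * cnj \<gamma> = (\<Sum>j\<in>I. w j * cnj (v j))"
    "\<delta> * cnj \<delta> + \<epsilon> * cnj \<epsilon> + \<zeta> * cnj \<zeta> = (\<Sum>j\<in>I. w j * cnj (w j))"
    and law: "\<And>H. H \<in> borel_measurable (borel \<Otimes>\<^sub>M (borel \<Otimes>\<^sub>M borel)) \<Longrightarrow>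
      (\<integral>\<^sup>+x. H (\<Sum>j\<in>I. u j * x j, \<Sum>j\<in>I. v j * x j, \<Sum>j\<in>I. w j * x j) \<partial>PiM I (\<lambda>_. cgauss))
      = (\<integral>\<^sup>+x. \<integral>\<^sup>+y. \<integral>\<^sup>+z. H (\<alpha> * x, \<beta> * x + \<gamma> * y, \<delta> * x + \<epsilon> * y + \<zeta> * z) \<partial>cgauss \<partial>cgauss \<partial>cgauss)"
    using insert.IH by blast
  obtain A1 B1 C1 D1 where 1: "\<alpha> * B1 + u i * D1 = 0" "A1 * cnj A1 + B1 * cnj B1 = 1"
    "C1 * cnj C1 + D1 * cnj D1 = 1" "A1 * cnj C1 + B1 * cnj D1 = 0"
    and rot1: "\<And>H. H \<in> borel_measurable (borel \<Otimes>\<^sub>M borel) \<Longrightarrow>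
      (\<integral>\<^sup>+x. \<integral>\<^sup>+y. H (x, y) \<partial>cgauss \<partial>cgauss)
      = (\<integral>\<^sup>+x. \<integral>\<^sup>+y. H (A1 * x + B1 * y, C1 * x + D1 * y) \<partial>cgauss \<partial>cgauss)"
    by (rule cgauss_rotation) blast
  \<comment> \<open>After the first rotation the new variable is gone from the first form;
    \<open>q\<close> and \<open>r\<close> are its remaining coefficients in the second and third.
    The second rotation removes \<open>q\<close> and leaves \<open>r'\<close>, the third removes
    \<open>r'\<close>, after which the new variable integrates to 1.\<close>
  define \<alpha>' \<beta>' \<delta>' q r where "\<alpha>' = \<alpha> * A1 + u i * C1" "\<beta>' = \<beta> * A1 + v i * C1" "\<delta>' = \<delta> * A1 + w i * C1"
    "q = \<beta> * B1 + v i * D1" "r = \<delta> * B1 + w i * D1"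
  note d1 = this
  obtain A2 B2 C2 D2 where 2: "\<gamma> * B2 + q * D2 = 0" "A2 * cnj A2 + B2 * cnj B2 = 1"
    "C2 * cnj C2 + D2 * cnj D2 = 1" "A2 * cnj C2 + B2 * cnj D2 = 0"
    and rot2: "\<And>H. H \<in> borel_measurable (borel \<Otimes>\<^sub>M borel) \<Longrightarrow>
      (\<integral>\<^sup>+x. \<integral>\<^sup>+y. H (x, y) \<partial>cgauss \<partial>cgauss)
      = (\<integral>\<^sup>+x. \<integral>\<^sup>+y. H (A2 * x + B2 * y, C2 * x + D2 * y) \<partial>cgauss \<partial>cgauss)"
    by (rule cgauss_rotation) blast
  define \<gamma>' \<epsilon>' r' where "\<gamma>' = \<gamma> * A2 + q * C2" "\<epsilon>' = \<epsilon> * A2 + r * C2" "r' = \<epsilon> * B2 + r * D2"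
  note d2 = this
  obtain A3 B3 C3 D3 where 3: "\<zeta> * B3 + r' * D3 = 0" "A3 * cnj A3 + B3 * cnj B3 = 1"
    "C3 * cnj C3 + D3 * cnj D3 = 1" "A3 * cnj C3 + B3 * cnj D3 = 0"
    and rot3: "\<And>H. H \<in> borel_measurable (borel \<Otimes>\<^sub>M borel) \<Longrightarrow>
      (\<integral>\<^sup>+x. \<integral>\<^sup>+y. H (x, y) \<partial>cgauss \<partial>cgauss)
      = (\<integral>\<^sup>+x. \<integral>\<^sup>+y. H (A3 * x + B3 * y, C3 * x + D3 * y) \<partial>cgauss \<partial>cgauss)"
    by (rule cgauss_rotation) blast
  define \<zeta>' where d3: "\<zeta>' = \<zeta> * A3 + r' * C3"
  \<comment> \<open>A unitary change of a pair of variables preserves Hermitian products of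
    coefficient vectors; applied to each pair of forms this carries the Gram entries along.\<close>
  have rows: "(a * A + p * C) * cnj (b * A + s * C) + (a * B + p * D) * cnj (b * B + s * D) = a * cnj b + p * cnj s"
    if "A * cnj A + B * cnj B = 1" "C * cnj C + D * cnj D = 1" "A * cnj C + B * cnj D = 0"
    for a p b s A B C D
  proof -
    have "C * cnj A + D * cnj B = 0" using arg_cong[OF that(3), of cnj] by (simp add: mult.commute)
    moreover have "(a * A + p * C) * cnj (b * A + s * C) + (a * B + p * D) * cnj (b * B + s * D)
      = a * cnj b * (A * cnj A + B * cnj B) + p * cnj s * (C * cnj C + D * cnj D)
        + a * cnj s * (A * cnj C + B * cnj D) + p * cnj b * (C * cnj A + D * cnj B)"
      by (simp add: algebra_simps)
    ultimately show ?thesis by (simp add: that)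
  qed
  have g1: "\<alpha>' * cnj \<alpha>' = \<alpha> * cnj \<alpha> + u i * cnj (u i)"
    "\<beta>' * cnj \<alpha>' = \<beta> * cnj \<alpha> + v i * cnj (u i)"
    "\<delta>' * cnj \<alpha>' = \<delta> * cnj \<alpha> + w i * cnj (u i)"
    "\<beta>' * cnj \<beta>' + q * cnj q = \<beta> * cnj \<beta> + v i * cnj (v i)"
    "\<delta>' * cnj \<beta>' + r * cnj q = \<delta> * cnj \<beta> + w i * cnj (v i)"
    "\<delta>' * cnj \<delta>' + r * cnj r = \<delta> * cnj \<delta> + w i * cnj (w i)"
    using rows[OF 1(2-4), of \<alpha> "u i" \<alpha> "u i"] rows[OF 1(2-4), of \<beta> "v i" \<alpha> "u i"]
      rows[OF 1(2-4), of \<delta> "w i" \<alpha> "u i"] rows[OF 1(2-4), of \<beta> "v i" \<beta> "v i"]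
      rows[OF 1(2-4), of \<delta> "w i" \<beta> "v i"] rows[OF 1(2-4), of \<delta> "w i" \<delta> "w i"]
    unfolding d1[symmetric] 1(1) by simp_all
  have g2: "\<gamma>' * cnj \<gamma>' = \<gamma> * cnj \<gamma> + q * cnj q"
    "\<epsilon>' * cnj \<gamma>' = \<epsilon> * cnj \<gamma> + r * cnj q"
    "\<epsilon>' * cnj \<epsilon>' + r' * cnj r' = \<epsilon> * cnj \<epsilon> + r * cnj r"
    using rows[OF 2(2-4), of \<gamma> q \<gamma> q] rows[OF 2(2-4), of \<epsilon> r \<gamma> q] rows[OF 2(2-4), of \<epsilon> r \<epsilon> r]
    unfolding d2[symmetric] 2(1) by simp_all
  have g3: "\<zeta>' * cnj \<zeta>' = \<zeta> * cnj \<zeta> + r' * cnj r'"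
    using rows[OF 3(2-4), of \<zeta> r' \<zeta> r'] unfolding d3[symmetric] 3(1) by simp
  have law': "(\<integral>\<^sup>+x. H (\<Sum>j\<in>insert i I. u j * x j, \<Sum>j\<in>insert i I. v j * x j, \<Sum>j\<in>insert i I. w j * x j)
          \<partial>PiM (insert i I) (\<lambda>_. cgauss))
      = (\<integral>\<^sup>+x. \<integral>\<^sup>+y. \<integral>\<^sup>+z. H (\<alpha>' * x, \<beta>' * x + \<gamma>' * y, \<delta>' * x + \<epsilon>' * y + \<zeta>' * z) \<partial>cgauss \<partial>cgauss \<partial>cgauss)"
    if H [measurable]: "H \<in> borel_measurable (borel \<Otimes>\<^sub>M (borel \<Otimes>\<^sub>M borel))" for H
  proof -
    have swap: "(\<integral>\<^sup>+x. \<integral>\<^sup>+y. G x y \<partial>cgauss \<partial>cgauss) = (\<integral>\<^sup>+y. \<integral>\<^sup>+x. G x y \<partial>cgauss \<partial>cgauss)"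
      if "(\<lambda>(x, y). G x y) \<in> borel_measurable (cgauss \<Otimes>\<^sub>M cgauss)" for G
      by (rule cgauss_pair.Fubini'[OF that, symmetric])
    have sum_ins: "(\<Sum>j\<in>insert i I. c j * (x(i := \<xi>)) j) = (\<Sum>j\<in>I. c j * x j) + c i * \<xi>" for c x \<xi>
    proof -
      have "(\<Sum>j\<in>I. c j * (x(i := \<xi>)) j) = (\<Sum>j\<in>I. c j * x j)"
        using insert.hyps by (intro sum.cong) auto
      then show ?thesis using insert.hyps by (simp add: add.commute)
    qed
    define X1 where "X1 = (\<lambda>(x, y, z, \<xi>). H (\<alpha> * x + u i * \<xi>, \<beta> * x + \<gamma> * y + v i * \<xi>,
        \<delta> * x + \<epsilon> * y + \<zeta> * z + w i * \<xi>))"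
    define X2 where "X2 = (\<lambda>(x, y, z, \<xi>). H (\<alpha>' * x, \<beta>' * x + \<gamma> * y + q * \<xi>,
        \<delta>' * x + \<epsilon> * y + \<zeta> * z + r * \<xi>))"
    define X3 where "X3 = (\<lambda>(x, y, z, \<xi>). H (\<alpha>' * x, \<beta>' * x + \<gamma>' * y,
        \<delta>' * x + \<epsilon>' * y + \<zeta> * z + r' * \<xi>))"
    have [measurable]: "X1 \<in> borel_measurable (borel \<Otimes>\<^sub>M borel \<Otimes>\<^sub>M borel \<Otimes>\<^sub>M borel)"
      "X2 \<in> borel_measurable (borel \<Otimes>\<^sub>M borel \<Otimes>\<^sub>M borel \<Otimes>\<^sub>M borel)"
      "X3 \<in> borel_measurable (borel \<Otimes>\<^sub>M borel \<Otimes>\<^sub>M borel \<Otimes>\<^sub>M borel)"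
      unfolding X1_def X2_def X3_def by measurable
    have step1: "X1 (A1 * x + B1 * \<xi>, y, z, C1 * x + D1 * \<xi>) = X2 (x, y, z, \<xi>)" for x y z \<xi>
    proof -
      have "\<alpha> * (A1 * x + B1 * \<xi>) + u i * (C1 * x + D1 * \<xi>) = \<alpha>' * x + (\<alpha> * B1 + u i * D1) * \<xi>"
        by (simp add: d1 algebra_simps)
      then have a: "\<alpha> * (A1 * x + B1 * \<xi>) + u i * (C1 * x + D1 * \<xi>) = \<alpha>' * x" by (simp add: 1(1))
      show ?thesis unfolding X1_def X2_def prod.case a by (simp add: d1 algebra_simps)
    qed
    have step2: "X2 (x, A2 * y + B2 * \<xi>, z, C2 * y + D2 * \<xi>) = X3 (x, y, z, \<xi>)" for x y z \<xi>
    proof -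
      have "\<beta>' * x + \<gamma> * (A2 * y + B2 * \<xi>) + q * (C2 * y + D2 * \<xi>)
          = \<beta>' * x + \<gamma>' * y + (\<gamma> * B2 + q * D2) * \<xi>"
        by (simp add: d2 algebra_simps)
      then have a: "\<beta>' * x + \<gamma> * (A2 * y + B2 * \<xi>) + q * (C2 * y + D2 * \<xi>) = \<beta>' * x + \<gamma>' * y"
        by (simp add: 2(1))
      show ?thesis unfolding X2_def X3_def prod.case a by (simp add: d2 algebra_simps)
    qed
    have step3: "X3 (x, y, A3 * z + B3 * \<xi>, C3 * z + D3 * \<xi>)
        = H (\<alpha>' * x, \<beta>' * x + \<gamma>' * y, \<delta>' * x + \<epsilon>' * y + \<zeta>' * z)" for x y z \<xi>
    proof -
      have "\<delta>' * x + \<epsilon>' * y + \<zeta> * (A3 * z + B3 * \<xi>) + r' * (C3 * z + D3 * \<xi>)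
          = \<delta>' * x + \<epsilon>' * y + \<zeta>' * z + (\<zeta> * B3 + r' * D3) * \<xi>"
        by (simp add: d3 algebra_simps)
      then have a: "\<delta>' * x + \<epsilon>' * y + \<zeta> * (A3 * z + B3 * \<xi>) + r' * (C3 * z + D3 * \<xi>)
          = \<delta>' * x + \<epsilon>' * y + \<zeta>' * z"
        by (simp only: 3(1) mult_zero_left add_0_right)
      show ?thesis unfolding X3_def prod.case a ..
    qed
    \<comment> \<open>The new coordinate is integrated out first, so that the induction hypothesis,
      which concerns functions of the three sums over \<open>I\<close>, applies to what is
      left.\<close>
    define H' where "H' = (\<lambda>(a, b, c). \<integral>\<^sup>+\<xi>. H (a + u i * \<xi>, b + v i * \<xi>, c + w i * \<xi>) \<partial>cgauss)"
    have H'[measurable]: "H' \<in> borel_measurable (borel \<Otimes>\<^sub>M (borel \<Otimes>\<^sub>M borel))"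
      unfolding H'_def by measurable
    have "(\<integral>\<^sup>+x. H (\<Sum>j\<in>insert i I. u j * x j, \<Sum>j\<in>insert i I. v j * x j, \<Sum>j\<in>insert i I. w j * x j)
          \<partial>PiM (insert i I) (\<lambda>_. cgauss))
        = (\<integral>\<^sup>+x. H' (\<Sum>j\<in>I. u j * x j, \<Sum>j\<in>I. v j * x j, \<Sum>j\<in>I. w j * x j) \<partial>PiM I (\<lambda>_. cgauss))"
    proof -
      have "(\<lambda>x. H (\<Sum>j\<in>insert i I. u j * x j, \<Sum>j\<in>insert i I. v j * x j, \<Sum>j\<in>insert i I. w j * x j))
          \<in> borel_measurable (PiM (insert i I) (\<lambda>_. cgauss))"
        by measurable
      from product_nn_integral_insert[OF insert.hyps this] show ?thesis
        by (simp only: sum_ins H'_def prod.case)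
    qed
    also have "\<dots> = (\<integral>\<^sup>+x. \<integral>\<^sup>+y. \<integral>\<^sup>+z. \<integral>\<^sup>+\<xi>. X1 (x, y, z, \<xi>) \<partial>cgauss \<partial>cgauss \<partial>cgauss \<partial>cgauss)"
      by (subst law[OF H']) (simp add: H'_def X1_def)
    \<comment> \<open>Each rotation acts on two neighbouring integrals, so Fubini moves the new
      variable next to \<open>x\<close>, then next to \<open>y\<close>, then next to
      \<open>z\<close>.\<close>
    also have "\<dots> = (\<integral>\<^sup>+x. \<integral>\<^sup>+y. \<integral>\<^sup>+\<xi>. \<integral>\<^sup>+z. X1 (x, y, z, \<xi>) \<partial>cgauss \<partial>cgauss \<partial>cgauss \<partial>cgauss)"
      by (intro nn_integral_cong swap) measurable
    also have "\<dots> = (\<integral>\<^sup>+x. \<integral>\<^sup>+\<xi>. \<integral>\<^sup>+y. \<integral>\<^sup>+z. X1 (x, y, z, \<xi>) \<partial>cgauss \<partial>cgauss \<partial>cgauss \<partial>cgauss)"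
      by (intro nn_integral_cong swap) measurable
    also have "\<dots> = (\<integral>\<^sup>+x. \<integral>\<^sup>+\<xi>. \<integral>\<^sup>+y. \<integral>\<^sup>+z. X2 (x, y, z, \<xi>) \<partial>cgauss \<partial>cgauss \<partial>cgauss \<partial>cgauss)"
      by (subst rot1[of "\<lambda>(x, \<xi>). (\<integral>\<^sup>+y. \<integral>\<^sup>+z. X1 (x, y, z, \<xi>) \<partial>cgauss \<partial>cgauss)", unfolded prod.case]) (measurable, simp only: step1)
    also have "\<dots> = (\<integral>\<^sup>+x. \<integral>\<^sup>+y. \<integral>\<^sup>+\<xi>. \<integral>\<^sup>+z. X2 (x, y, z, \<xi>) \<partial>cgauss \<partial>cgauss \<partial>cgauss \<partial>cgauss)"
      by (intro nn_integral_cong swap) measurable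
    also have "\<dots> = (\<integral>\<^sup>+x. \<integral>\<^sup>+y. \<integral>\<^sup>+\<xi>. \<integral>\<^sup>+z. X3 (x, y, z, \<xi>) \<partial>cgauss \<partial>cgauss \<partial>cgauss \<partial>cgauss)"
      by (subst rot2[of "\<lambda>(y, \<xi>). (\<integral>\<^sup>+z. X2 (x, y, z, \<xi>) \<partial>cgauss)" for x, unfolded prod.case]) (measurable, simp only: step2)
    also have "\<dots> = (\<integral>\<^sup>+x. \<integral>\<^sup>+y. \<integral>\<^sup>+z. \<integral>\<^sup>+\<xi>. X3 (x, y, z, \<xi>) \<partial>cgauss \<partial>cgauss \<partial>cgauss \<partial>cgauss)"
      by (intro nn_integral_cong swap) measurable
    also have "\<dots> = (\<integral>\<^sup>+x. \<integral>\<^sup>+y. \<integral>\<^sup>+z. H (\<alpha>' * x, \<beta>' * x + \<gamma>' * y, \<delta>' * x + \<epsilon>' * y + \<zeta>' * z) \<partial>cgauss \<partial>cgauss \<partial>cgauss)"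
      by (subst rot3[of "\<lambda>(z, \<xi>). X3 (x, y, z, \<xi>)" for x y, unfolded prod.case])
         (measurable, use cgauss.emeasure_space_1 in \<open>simp add: step3\<close>)
    finally show ?thesis .
  qed
  have sums: "(\<Sum>j\<in>insert i I. c j * cnj (d j)) = (\<Sum>j\<in>I. c j * cnj (d j)) + c i * cnj (d i)" for c d :: "'i \<Rightarrow> complex"
    using insert.hyps by (simp add: add.commute)
  have e6: "\<delta>' * cnj \<delta>' + \<epsilon>' * cnj \<epsilon>' + \<zeta>' * cnj \<zeta>' = (\<Sum>j\<in>insert i I. w j * cnj (w j))"
  proof -
    have "\<delta>' * cnj \<delta>' + \<epsilon>' * cnj \<epsilon>' + \<zeta>' * cnj \<zeta>' = (\<delta>' * cnj \<delta>' + r * cnj r) + \<epsilon> * cnj \<epsilon> + \<zeta> * cnj \<zeta>"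
      using g2(3) g3 by (simp add: algebra_simps)
    then show ?thesis unfolding g1 sums gram(6)[symmetric] by (simp add: algebra_simps)
  qed
  have e5: "\<delta>' * cnj \<beta>' + \<epsilon>' * cnj \<gamma>' = (\<Sum>j\<in>insert i I. w j * cnj (v j))"
    unfolding g2 sums gram(5)[symmetric] using g1(5) by (simp add: algebra_simps)
  have e3: "\<beta>' * cnj \<beta>' + \<gamma>' * cnj \<gamma>' = (\<Sum>j\<in>insert i I. v j * cnj (v j))"
    unfolding g2 sums gram(3)[symmetric] using g1(4) by (simp add: algebra_simps)
  have e: "\<alpha>' * cnj \<alpha>' = (\<Sum>j\<in>insert i I. u j * cnj (u j))" "\<beta>' * cnj \<alpha>' = (\<Sum>j\<in>insert i I. v j * cnj (u j))"
    "\<delta>' * cnj \<alpha>' = (\<Sum>j\<in>insert i I. w j * cnj (u j))"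
    unfolding g1 gram sums by simp_all
  show ?case
    by (rule exI[of _ \<alpha>'], rule exI[of _ \<beta>'], rule exI[of _ \<gamma>'], rule exI[of _ \<delta>'], rule exI[of _ \<epsilon>'],
        rule exI[of _ \<zeta>'], intro conjI ballI e e3 e5 e6 law')
qed

section \<open>Gaussian second moments and the integral over a triangular triple\<close>

lemma nn_integral_cgauss_cmod_square: "(\<integral>\<^sup>+z. ennreal ((cmod z)\<^sup>2) \<partial>cgauss) = 1"
proof -
  have "(\<integral>\<^sup>+z. ennreal ((cmod z)\<^sup>2) \<partial>cgauss)
      = (\<integral>\<^sup>+(z::complex). ennreal (exp (- ((cmod z)\<^sup>2)) / pi * (cmod z)\<^sup>2) \<partial>lborel)"
    by (subst nn_integral_cgauss) (simp_all add: standard_complex_gaussian_density_def ennreal_mult'[symmetric])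
  also have "\<dots> = ennreal pi * (\<integral>\<^sup>+t\<in>{0..}. ennreal (exp (- t) / pi * t) \<partial>lborel)"
    by (rule nn_integral_complex_radial) measurable
  also have "\<dots> = (\<integral>\<^sup>+t. ennreal (erlang_density 1 1 t) \<partial>lborel)"
    by (subst nn_integral_cmult[symmetric])
       (auto intro!: nn_integral_cong simp: erlang_density_def ennreal_mult'[symmetric] split: split_indicator)
  also have "\<dots> = 1"
    using prob_space.emeasure_space_1[OF prob_space_erlang_density[of 1 1]]
    by (simp add: emeasure_density)
  finally show ?thesis .
qed

text \<open>The cross term is odd in \<open>z\<close>. Adding the reflected integrand removes it by
  the parallelogram law, so that only nonnegative integrands occur.\<close>

lemma nn_integral_cgauss_shifted_square:
  "(\<integral>\<^sup>+z. ennreal ((cmod (w + \<zeta> * z))\<^sup>2) \<partial>cgauss) = ennreal ((cmod w)\<^sup>2 + (cmod \<zeta>)\<^sup>2)"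
proof -
  let ?I = "\<integral>\<^sup>+z. ennreal ((cmod (w + \<zeta> * z))\<^sup>2) \<partial>cgauss"
  have "?I = (\<integral>\<^sup>+z. ennreal ((cmod (w - \<zeta> * z))\<^sup>2) \<partial>cgauss)"
    by (simp add: nn_integral_cgauss, subst nn_integral_complex_affine[of _ "-1" 0])
       (simp_all add: standard_complex_gaussian_density_def)
  then have "?I + ?I = (\<integral>\<^sup>+z. ennreal ((cmod (w + \<zeta> * z))\<^sup>2) + ennreal ((cmod (w - \<zeta> * z))\<^sup>2) \<partial>cgauss)"
    by (simp add: nn_integral_add)
  also have "\<dots> = (\<integral>\<^sup>+z. ennreal (2 * (cmod w)\<^sup>2) + ennreal (2 * (cmod \<zeta>)\<^sup>2) * ennreal ((cmod z)\<^sup>2) \<partial>cgauss)"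
  proof (intro nn_integral_cong)
    fix z
    have "(cmod (w + \<zeta> * z))\<^sup>2 + (cmod (w - \<zeta> * z))\<^sup>2 = 2 * (cmod w)\<^sup>2 + 2 * (cmod (\<zeta> * z))\<^sup>2"
      unfolding cmod_power2 by (simp add: power2_eq_square algebra_simps)
    then show "ennreal ((cmod (w + \<zeta> * z))\<^sup>2) + ennreal ((cmod (w - \<zeta> * z))\<^sup>2)
        = ennreal (2 * (cmod w)\<^sup>2) + ennreal (2 * (cmod \<zeta>)\<^sup>2) * ennreal ((cmod z)\<^sup>2)"
      by (simp add: ennreal_plus[symmetric] ennreal_mult'[symmetric] norm_mult power_mult_distrib del: ennreal_plus)
  qed
  also have "\<dots> = ennreal (2 * (cmod w)\<^sup>2) + ennreal (2 * (cmod \<zeta>)\<^sup>2)"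
    using cgauss.emeasure_space_1
    by (simp add: nn_integral_add nn_integral_cmult nn_integral_cgauss_cmod_square)
  also have "\<dots> = 2 * ennreal ((cmod w)\<^sup>2 + (cmod \<zeta>)\<^sup>2)"
    by (simp add: ennreal_plus[symmetric] ennreal_mult'[symmetric] algebra_simps
      ennreal_numeral[symmetric] del: ennreal_plus ennreal_numeral)
  finally have "2 * ?I = 2 * ennreal ((cmod w)\<^sup>2 + (cmod \<zeta>)\<^sup>2)"
    by (simp add: mult_2)
  then show ?thesis
    by (subst (asm) ennreal_mult_cancel_left) auto
qed

lemma standard_complex_gaussian_density_mult:
  "standard_complex_gaussian_density x * standard_complex_gaussian_density y
    = ennreal (exp (- ((cmod x)\<^sup>2 + (cmod y)\<^sup>2)) / pi\<^sup>2)"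
  by (simp add: standard_complex_gaussian_density_def ennreal_mult'[symmetric] exp_add[symmetric]
      power2_eq_square mult_exp_exp algebra_simps)

text \<open>Completing the square in \<open>y\<close>: the substitution \<open>y = \<eta> / sqrt s - cnj \<gamma> * b / s\<close>.\<close>

lemma nn_integral_cgauss_tilted:
  fixes \<gamma> b d \<epsilon> :: complex
  assumes l: "l \<ge> 0"
  defines "s \<equiv> 1 + (cmod \<gamma>)\<^sup>2"
  shows "(\<integral>\<^sup>+y. ennreal ((cmod (d + \<epsilon> * y))\<^sup>2 + l) * standard_complex_gaussian_density (b + \<gamma> * y) \<partial>cgauss)
    = ennreal (exp (- ((cmod b)\<^sup>2 / s)) / (pi * s)
        * ((cmod (d - \<epsilon> * cnj \<gamma> * b / of_real s))\<^sup>2 + (cmod \<epsilon>)\<^sup>2 / s + l))"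
proof -
  let ?\<rho> = standard_complex_gaussian_density
  have s: "s > 0" unfolding s_def by (simp add: add_pos_nonneg)
  define t where "t = - (cnj \<gamma> * b / of_real s)"
  define k where "k = 1 / sqrt s"
  have k: "k \<noteq> 0" "k\<^sup>2 = 1 / s" using s by (simp_all add: k_def power_divide)
  define c where "c = d - \<epsilon> * cnj \<gamma> * b / of_real s"
  let ?sq = "\<lambda>\<eta>. (cmod (c + (\<epsilon> * of_real k) * \<eta>))\<^sup>2"
  let ?e = "exp (- ((cmod b)\<^sup>2 / s))"
  let ?m = "(cmod c)\<^sup>2 + (cmod \<epsilon>)\<^sup>2 / s + l"
  have expo: "(cmod (t + k *\<^sub>R \<eta>))\<^sup>2 + (cmod (b + \<gamma> * (t + k *\<^sub>R \<eta>)))\<^sup>2 = (cmod \<eta>)\<^sup>2 + (cmod b)\<^sup>2 / s" for \<eta>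
  proof -
    let ?k = "complex_of_real k" and ?s = "complex_of_real s"
    have sk: "?k * ?k * ?s = 1"
    proof -
      have "?k * ?k * ?s = complex_of_real (k\<^sup>2 * s)" by (simp add: power2_eq_square)
      then show ?thesis using s by (simp add: k(2))
    qed
    have sg: "?s = 1 + \<gamma> * cnj \<gamma>"
      by (simp only: s_def of_real_add of_real_1 complex_norm_square)
    have ts: "t * ?s = - (cnj \<gamma> * b)" "cnj t * ?s = - (\<gamma> * cnj b)" using s by (simp_all add: t_def)
    have bb: "b * cnj b + \<gamma> * t * cnj b = b * cnj b / ?s"
    proof -
      have "?s * (b * cnj b + \<gamma> * t * cnj b) = (1 + \<gamma> * cnj \<gamma>) * (b * cnj b) + \<gamma> * (t * ?s) * cnj b"
        by (simp add: sg algebra_simps)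
      also have "\<dots> = b * cnj b" unfolding ts by (simp add: algebra_simps)
      finally show ?thesis using s by (simp add: field_simps)
    qed
    have "complex_of_real ((cmod (t + k *\<^sub>R \<eta>))\<^sup>2 + (cmod (b + \<gamma> * (t + k *\<^sub>R \<eta>)))\<^sup>2)
        = (t + ?k * \<eta>) * cnj (t + ?k * \<eta>) + (b + \<gamma> * (t + ?k * \<eta>)) * cnj (b + \<gamma> * (t + ?k * \<eta>))"
      by (simp only: of_real_add complex_norm_square scaleR_conv_of_real)
    also have "\<dots> = (?k * ?k * (1 + \<gamma> * cnj \<gamma>)) * (\<eta> * cnj \<eta>) + (b * cnj b + \<gamma> * t * cnj b)
        + (cnj t + ?k * cnj \<eta>) * (t * (1 + \<gamma> * cnj \<gamma>) + cnj \<gamma> * b)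
        + ?k * \<eta> * (cnj t * (1 + \<gamma> * cnj \<gamma>) + \<gamma> * cnj b)"
      by (simp add: algebra_simps)
    also have "\<dots> = \<eta> * cnj \<eta> + b * cnj b / ?s"
      unfolding sg[symmetric] ts bb sk by (simp add: algebra_simps)
    finally show ?thesis
      by (simp only: complex_norm_square[symmetric] of_real_divide[symmetric] of_real_add[symmetric]
          of_real_eq_iff)
  qed
  have shift: "d + \<epsilon> * (t + k *\<^sub>R \<eta>) = c + (\<epsilon> * of_real k) * \<eta>" for \<eta>
    by (simp add: c_def t_def scaleR_conv_of_real algebra_simps)
  have dens: "?\<rho> (t + k *\<^sub>R \<eta>) * ?\<rho> (b + \<gamma> * (t + k *\<^sub>R \<eta>)) = ennreal (?e / pi) * ?\<rho> \<eta>" for \<eta>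
    unfolding standard_complex_gaussian_density_mult expo
    by (simp add: standard_complex_gaussian_density_def ennreal_mult'[symmetric] power2_eq_square
        minus_add_distrib exp_add[symmetric] mult_exp_exp add.commute)
  have "(\<integral>\<^sup>+y. ennreal ((cmod (d + \<epsilon> * y))\<^sup>2 + l) * ?\<rho> (b + \<gamma> * y) \<partial>cgauss)
     = (\<integral>\<^sup>+y. ennreal ((cmod (d + \<epsilon> * y))\<^sup>2 + l) * (?\<rho> y * ?\<rho> (b + \<gamma> * y)) \<partial>lborel)"
    by (subst nn_integral_cgauss) (simp_all add: ac_simps)
  also have "\<dots> = ennreal (1 / s) * (\<integral>\<^sup>+\<eta>. ennreal (?sq \<eta> + l)
       * (ennreal (?e / pi) * ?\<rho> \<eta>) \<partial>lborel)"
    by (subst nn_integral_complex_affine[OF _ k(1), of _ t]) (simp_all only: k(2) shift dens, measurable)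
  also have "(\<integral>\<^sup>+\<eta>. ennreal (?sq \<eta> + l)
       * (ennreal (?e / pi) * ?\<rho> \<eta>) \<partial>lborel)
     = ennreal (?e / pi) * (\<integral>\<^sup>+\<eta>. ennreal (?sq \<eta> + l) \<partial>cgauss)"
    by (simp add: nn_integral_cgauss nn_integral_cmult[symmetric] ac_simps)
  also have "(\<integral>\<^sup>+\<eta>. ennreal (?sq \<eta> + l) \<partial>cgauss)
      = ennreal (?m)"
  proof -
    have "(\<integral>\<^sup>+\<eta>. ennreal (?sq \<eta> + l) \<partial>cgauss)
      = (\<integral>\<^sup>+\<eta>. ennreal (?sq \<eta>) + ennreal l \<partial>cgauss)"
      using l by (intro nn_integral_cong) (simp add: ennreal_plus)
    also have "\<dots> = ennreal ((cmod c)\<^sup>2 + (cmod (\<epsilon> * of_real k))\<^sup>2) + ennreal l"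
      using cgauss.emeasure_space_1 by (simp add: nn_integral_add nn_integral_cgauss_shifted_square)
    also have "(cmod (\<epsilon> * of_real k))\<^sup>2 = (cmod \<epsilon>)\<^sup>2 / s"
      by (simp add: norm_mult power_mult_distrib k(2))
    finally show ?thesis using l s by (simp add: ennreal_plus[symmetric] del: ennreal_plus)
  qed
  also have "ennreal (1 / s) * (ennreal (?e / pi) * ennreal (?m))
      = ennreal (1 / s * (?e / pi * (?m)))"
    using s by (subst ennreal_mult', simp, subst ennreal_mult') auto
  also have "1 / s * (?e / pi * (?m))
      = ?e / (pi * s) * (?m)"
    by simp
  finally show ?thesis unfolding c_def .
qed

text \<open>The test function sees only \<open>|x|\<close>, so \<open>z\<close> and \<open>y\<close>
  are integrated out first: the former adds its variance, the latter is a tilted Gaussian integral.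
  The remainder is radial in \<open>x\<close>, and the substitution
  \<open>r = |\<alpha>| * |x|\<close> makes the argument of \<open>\<phi>\<close> the integration
  variable. The 1 in \<open>s\<close> comes from the density evaluated at the second form, which
  acts like one more unit of variance.\<close>

lemma nn_integral_triangular_gaussian:
  fixes \<phi> :: "real \<Rightarrow> ennreal" and \<alpha> \<beta> \<gamma> \<delta> \<epsilon> \<zeta> :: complex
  assumes [measurable]: "\<phi> \<in> borel_measurable borel" and \<alpha>: "\<alpha> \<noteq> 0"
  defines "s \<equiv> 1 + (cmod \<gamma>)\<^sup>2" and "A \<equiv> (cmod \<alpha>)\<^sup>2"
  defines "V \<equiv> s + (cmod \<beta>)\<^sup>2" and "c \<equiv> \<delta> - \<epsilon> * cnj \<gamma> * \<beta> / of_real s"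
  shows "(\<integral>\<^sup>+x. \<integral>\<^sup>+y. \<integral>\<^sup>+z. \<phi> (cmod (\<alpha> * x)) * ennreal ((cmod (\<delta> * x + \<epsilon> * y + \<zeta> * z))\<^sup>2)
            * standard_complex_gaussian_density (\<beta> * x + \<gamma> * y) \<partial>cgauss \<partial>cgauss \<partial>cgauss)
    = (\<integral>\<^sup>+r\<in>{0..}. \<phi> r * ennreal (2 * r / (pi * (s * A)) * exp (- (r\<^sup>2 * (V / (s * A))))
          * ((cmod c)\<^sup>2 / A * r\<^sup>2 + ((cmod \<epsilon>)\<^sup>2 / s + (cmod \<zeta>)\<^sup>2))) \<partial>lborel)"
proof -
  let ?\<rho> = standard_complex_gaussian_density
  have s: "s > 0" unfolding s_def by (simp add: add_pos_nonneg)
  have A: "A > 0" using \<alpha> by (simp add: A_def)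
  define L where "L = (cmod \<epsilon>)\<^sup>2 / s + (cmod \<zeta>)\<^sup>2"
  define W where "W r = exp (- (r\<^sup>2 * (cmod \<beta>)\<^sup>2 / s)) / (pi * s) * ((cmod c)\<^sup>2 * r\<^sup>2 + L)" for r
  let ?g = "\<lambda>r. \<phi> (cmod \<alpha> * r) * ennreal (2 * r * exp (- r\<^sup>2) * W r) * indicator {0..} r"
  let ?f = "\<lambda>r. \<phi> r * ennreal (2 * r / (pi * (s * A)) * exp (- (r\<^sup>2 * (V / (s * A))))
          * ((cmod c)\<^sup>2 / A * r\<^sup>2 + L)) * indicator {0..} r"
  have L: "L \<ge> 0" using s by (simp add: L_def)
  have inner: "(\<integral>\<^sup>+y. \<integral>\<^sup>+z. \<phi> (cmod (\<alpha> * x)) * ennreal ((cmod (\<delta> * x + \<epsilon> * y + \<zeta> * z))\<^sup>2)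
            * ?\<rho> (\<beta> * x + \<gamma> * y) \<partial>cgauss \<partial>cgauss) = \<phi> (cmod \<alpha> * cmod x) * ennreal (W (cmod x))" for x
  proof -
    have "(\<integral>\<^sup>+y. \<integral>\<^sup>+z. \<phi> (cmod (\<alpha> * x)) * ennreal ((cmod (\<delta> * x + \<epsilon> * y + \<zeta> * z))\<^sup>2)
            * ?\<rho> (\<beta> * x + \<gamma> * y) \<partial>cgauss \<partial>cgauss)
      = (\<integral>\<^sup>+y. \<phi> (cmod (\<alpha> * x)) * (ennreal ((cmod (\<delta> * x + \<epsilon> * y))\<^sup>2 + (cmod \<zeta>)\<^sup>2) * ?\<rho> (\<beta> * x + \<gamma> * y)) \<partial>cgauss)"
      by (simp add: nn_integral_cmult nn_integral_multc nn_integral_cgauss_shifted_square mult.assoc)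
    also have "\<dots> = \<phi> (cmod (\<alpha> * x)) * ennreal (exp (- ((cmod (\<beta> * x))\<^sup>2 / s)) / (pi * s)
        * ((cmod (\<delta> * x - \<epsilon> * cnj \<gamma> * (\<beta> * x) / of_real s))\<^sup>2 + (cmod \<epsilon>)\<^sup>2 / s + (cmod \<zeta>)\<^sup>2))"
      by (subst nn_integral_cmult, measurable, subst nn_integral_cgauss_tilted) (simp_all add: s_def)
    also have "\<delta> * x - \<epsilon> * cnj \<gamma> * (\<beta> * x) / of_real s = c * x"
      by (simp add: c_def algebra_simps)
    finally show ?thesis
      by (simp add: W_def L_def norm_mult power_mult_distrib algebra_simps)
  qed
  have "(\<integral>\<^sup>+x. \<integral>\<^sup>+y. \<integral>\<^sup>+z. \<phi> (cmod (\<alpha> * x)) * ennreal ((cmod (\<delta> * x + \<epsilon> * y + \<zeta> * z))\<^sup>2)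
            * ?\<rho> (\<beta> * x + \<gamma> * y) \<partial>cgauss \<partial>cgauss \<partial>cgauss)
      = (\<integral>\<^sup>+x. ennreal (exp (- ((cmod x)\<^sup>2)) / pi) * (\<phi> (cmod \<alpha> * cmod x) * ennreal (W (cmod x))) \<partial>lborel)"
    unfolding inner by (subst nn_integral_cgauss) (simp_all add: standard_complex_gaussian_density_def W_def)
  also have "\<dots> = (\<integral>\<^sup>+r\<in>{0..}. ennreal (exp (- r\<^sup>2) / pi) * (\<phi> (cmod \<alpha> * r) * ennreal (W r)) * ennreal (2 * pi * r) \<partial>lborel)"
    by (rule nn_integral_complex_cmod) (simp add: W_def)
  also have "\<dots> = (\<integral>\<^sup>+r. ?g r \<partial>lborel)"
  proof (intro nn_integral_cong)
    fix r :: real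
    show "ennreal (exp (- r\<^sup>2) / pi) * (\<phi> (cmod \<alpha> * r) * ennreal (W r)) * ennreal (2 * pi * r) * indicator {0..} r
       = ?g r"
    proof (cases "r \<ge> 0")
      case True
      have W: "W r \<ge> 0" using L s by (simp add: W_def)
      have "ennreal (exp (- r\<^sup>2) / pi) * (\<phi> (cmod \<alpha> * r) * ennreal (W r)) * ennreal (2 * pi * r)
        = \<phi> (cmod \<alpha> * r) * (ennreal (exp (- r\<^sup>2) / pi) * ennreal (W r) * ennreal (2 * pi * r))"
        by (simp add: ac_simps)
      also have "ennreal (exp (- r\<^sup>2) / pi) * ennreal (W r) * ennreal (2 * pi * r) = ennreal (2 * r * exp (- r\<^sup>2) * W r)"
        using W True by (simp add: ennreal_mult[symmetric])
      finally show ?thesis by simp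
    qed simp
  qed
  also have "\<dots> = (\<integral>\<^sup>+r. ?f r \<partial>lborel)"
  proof -
    have ca: "cmod \<alpha> > 0" using \<alpha> by simp
    have "(\<integral>\<^sup>+r. ?f r \<partial>lborel) = ennreal \<bar>cmod \<alpha>\<bar> * (\<integral>\<^sup>+r. ?f (0 + cmod \<alpha> * r) \<partial>lborel)"
      using ca by (intro nn_integral_real_affine) auto
    also have "\<dots> = (\<integral>\<^sup>+r. ennreal (cmod \<alpha>) * ?f (cmod \<alpha> * r) \<partial>lborel)"
      by (simp add: nn_integral_cmult)
    also have "\<dots> = (\<integral>\<^sup>+r. ?g r \<partial>lborel)"
    proof (intro nn_integral_cong)
      fix r :: real
      show "ennreal (cmod \<alpha>) * ?f (cmod \<alpha> * r) = ?g r"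
      proof (cases "r \<ge> 0")
        case True
        have e: "exp (- ((cmod \<alpha> * r)\<^sup>2 * (V / (s * A)))) = exp (- r\<^sup>2) * exp (- (r\<^sup>2 * (cmod \<beta>)\<^sup>2 / s))"
        proof -
          have "(cmod \<alpha> * r)\<^sup>2 * (V / (s * A)) = r\<^sup>2 + r\<^sup>2 * (cmod \<beta>)\<^sup>2 / s"
            using A s by (simp add: V_def power_mult_distrib A_def field_simps)
          then show ?thesis by (simp add: mult_exp_exp)
        qed
        have "cmod \<alpha> * (2 * (cmod \<alpha> * r) / (pi * (s * A)) * exp (- ((cmod \<alpha> * r)\<^sup>2 * (V / (s * A))))
          * ((cmod c)\<^sup>2 / A * (cmod \<alpha> * r)\<^sup>2 + L)) = 2 * r * exp (- r\<^sup>2) * W r"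
        proof -
          have 1: "(cmod c)\<^sup>2 / A * (cmod \<alpha> * r)\<^sup>2 = (cmod c)\<^sup>2 * r\<^sup>2"
            using A by (simp add: A_def power_mult_distrib)
          have 2: "cmod \<alpha> * (2 * (cmod \<alpha> * r) / (pi * (s * A))) = 2 * r / (pi * s)"
            using ca by (simp add: A_def power2_eq_square)
          have "cmod \<alpha> * (2 * (cmod \<alpha> * r) / (pi * (s * A)) * exp (- ((cmod \<alpha> * r)\<^sup>2 * (V / (s * A))))
              * ((cmod c)\<^sup>2 / A * (cmod \<alpha> * r)\<^sup>2 + L))
            = (cmod \<alpha> * (2 * (cmod \<alpha> * r) / (pi * (s * A)))) * exp (- ((cmod \<alpha> * r)\<^sup>2 * (V / (s * A))))
              * ((cmod c)\<^sup>2 / A * (cmod \<alpha> * r)\<^sup>2 + L)"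
            by (simp only: mult.assoc)
          also have "\<dots> = 2 * r * exp (- r\<^sup>2) * W r"
            unfolding 1 2 e W_def by simp
          finally show ?thesis .
        qed
        moreover have "ennreal (cmod \<alpha>) * (\<phi> (cmod \<alpha> * r) * ennreal X) = \<phi> (cmod \<alpha> * r) * ennreal (cmod \<alpha> * X)" for X
          by (subst ennreal_mult') (auto simp: ac_simps)
        ultimately show ?thesis using True by (simp add: mult.assoc del: ennreal_mult')
      next
        case False
        then have "cmod \<alpha> * r < 0" using ca by (simp add: mult_pos_neg)
        then show ?thesis using False by simp
      qed
    qed
    finally show ?thesis ..
  qed
  finally show ?thesis by (simp add: L_def)
qed

section \<open>Measurability of sums over zeros\<close>

text \<open>On a nonempty compact set a continuous function has a zero iff its modulus takes
  arbitrarily small values there, and by density this can be tested on a countable subset. So an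
  existential over uncountably many points is measurable.\<close>

lemma sets_exists_zero_compact:
  fixes q :: "'w \<Rightarrow> complex \<Rightarrow> complex"
  assumes meas [measurable]: "\<And>z. (\<lambda>\<omega>. q \<omega> z) \<in> borel_measurable M"
    and cont: "\<And>\<omega>. continuous_on UNIV (q \<omega>)" and K: "compact K"
  shows "{\<omega>\<in>space M. \<exists>z\<in>K. q \<omega> z = 0} \<in> sets M"
proof -
  obtain D where D: "countable D" "D \<subseteq> K" "K \<subseteq> closure D"
    by (rule separable)
  have "{\<omega>\<in>space M. \<exists>z\<in>K. q \<omega> z = 0} = {\<omega>\<in>space M. \<forall>n::nat. \<exists>d\<in>D. cmod (q \<omega> d) < 1 / Suc n}"
  proof (intro Collect_cong conj_cong refl iffI allI)
    fix \<omega> n assume "\<exists>z\<in>K. q \<omega> z = 0"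
    then obtain z where z: "z \<in> K" "q \<omega> z = 0" by auto
    have "open {x. cmod (q \<omega> x) < 1 / Suc n}"
      using cont by (intro open_Collect_less continuous_intros)
    moreover have "z \<in> {x. cmod (q \<omega> x) < 1 / Suc n}" using z by simp
    ultimately have "\<exists>d\<in>D. d \<in> {x. cmod (q \<omega> x) < 1 / Suc n}"
      using z D(3) open_Int_closure_eq_empty[of "{x. cmod (q \<omega> x) < 1 / Suc n}" D] by blast
    then show "\<exists>d\<in>D. cmod (q \<omega> d) < 1 / Suc n" by simp
  next
    fix \<omega> assume *: "\<forall>n::nat. \<exists>d\<in>D. cmod (q \<omega> d) < 1 / Suc n"
    show "\<exists>z\<in>K. q \<omega> z = 0"
    proof (cases "K = {}")
      case False
      have "continuous_on K (\<lambda>z. cmod (q \<omega> z))"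
        using cont by (intro continuous_intros) (auto intro: continuous_on_subset)
      then obtain z where z: "z \<in> K" "\<And>y. y \<in> K \<Longrightarrow> cmod (q \<omega> z) \<le> cmod (q \<omega> y)"
        using continuous_attains_inf[OF K False] by blast
      have "cmod (q \<omega> z) < 1 / Suc n" for n :: nat
        using * z(2) D(2) by (meson order.strict_trans1 subsetD)
      then have "\<not> cmod (q \<omega> z) > 0"
        using nat_approx_posE by (metis less_asym)
      then show ?thesis using z by auto
    qed (use * D in auto)
  qed
  also have "\<dots> \<in> sets M"
    using D(1) by measurable
  finally show ?thesis .
qed

text \<open>Lower left corners of the half-open dyadic squares of side \<open>1 / 2 ^ m\<close>;
  \<open>grid_index\<close> labels the square that contains a point.\<close>

definition grid_point :: "nat \<Rightarrow> int \<times> int \<Rightarrow> complex" where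
  "grid_point m p = Complex (of_int (fst p) / 2 ^ m) (of_int (snd p) / 2 ^ m)"

definition grid_index :: "nat \<Rightarrow> complex \<Rightarrow> int \<times> int" where
  "grid_index m z = (\<lfloor>2 ^ m * Re z\<rfloor>, \<lfloor>2 ^ m * Im z\<rfloor>)"

lemma floor_div_power2_tendsto: "(\<lambda>m. real_of_int \<lfloor>2 ^ m * x\<rfloor> / 2 ^ m) \<longlonglongrightarrow> x"
proof (rule tendsto_sandwich)
  show "\<forall>\<^sub>F m in sequentially. x - (1 / 2) ^ m \<le> real_of_int \<lfloor>2 ^ m * x\<rfloor> / 2 ^ m"
  proof (intro always_eventually allI)
    fix m :: nat
    have "2 ^ m * x - 1 \<le> real_of_int \<lfloor>2 ^ m * x\<rfloor>" by linarith
    then have "(2 ^ m * x - 1) / 2 ^ m \<le> real_of_int \<lfloor>2 ^ m * x\<rfloor> / 2 ^ m"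
      by (rule divide_right_mono) simp
    then show "x - (1 / 2) ^ m \<le> real_of_int \<lfloor>2 ^ m * x\<rfloor> / 2 ^ m"
      by (simp add: diff_divide_distrib power_one_over)
  qed
  show "\<forall>\<^sub>F m in sequentially. real_of_int \<lfloor>2 ^ m * x\<rfloor> / 2 ^ m \<le> x"
    by (intro always_eventually allI) (simp add: divide_le_eq mult.commute)
  have "(\<lambda>m. x - (1 / 2) ^ m) \<longlonglongrightarrow> x - 0"
    by (intro tendsto_intros LIMSEQ_realpow_zero) auto
  then show "(\<lambda>m. x - (1 / 2) ^ m) \<longlonglongrightarrow> x" by simp
qed auto

lemma grid_point_index_tendsto: "(\<lambda>m. grid_point m (grid_index m z)) \<longlonglongrightarrow> z"
proof -
  have "(\<lambda>m. Complex (real_of_int \<lfloor>2 ^ m * Re z\<rfloor> / 2 ^ m) (real_of_int \<lfloor>2 ^ m * Im z\<rfloor> / 2 ^ m)) \<longlonglongrightarrow> Complex (Re z) (Im z)"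
    by (intro tendsto_Complex floor_div_power2_tendsto)
  then show ?thesis by (simp add: grid_point_def grid_index_def)
qed

text \<open>A half-open square is not compact, whereas zeros are detected measurably in compact
  sets; it is therefore exhausted by countably many closed boxes.\<close>

lemma grid_index_eq_iff:
  "grid_index m z = (k, l) \<longleftrightarrow>
    z \<in> (\<Union>j::nat. cbox (grid_point m (k, l)) (Complex ((of_int k + 1) / 2 ^ m - 1 / Suc j) ((of_int l + 1) / 2 ^ m - 1 / Suc j)))"
proof -
  \<comment> \<open>Stated for all large \<open>j\<close>, so that one common \<open>j\<close>
    serves both coordinates.\<close>
  have half: "x < b \<longleftrightarrow> (\<exists>j0::nat. \<forall>j\<ge>j0. x \<le> b - 1 / Suc j)" for x b :: real
  proof
    assume "x < b"
    then obtain j0 :: nat where "1 / Suc j0 < b - x" using nat_approx_posE[of "b - x"] by auto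
    then have "x \<le> b - 1 / Suc j" if "j \<ge> j0" for j
    proof -
      have "1 / real (Suc j) \<le> 1 / Suc j0" using that by (intro divide_left_mono) auto
      then show ?thesis using \<open>1 / Suc j0 < b - x\<close> by linarith
    qed
    then show "\<exists>j0::nat. \<forall>j\<ge>j0. x \<le> b - 1 / Suc j" by blast
  next
    assume "\<exists>j0::nat. \<forall>j\<ge>j0. x \<le> b - 1 / Suc j"
    then obtain j0 :: nat where "x \<le> b - 1 / Suc j0" by blast
    moreover have "1 / real (Suc j0) > 0" by simp
    ultimately show "x < b" by linarith
  qed
  have floor: "\<lfloor>2 ^ m * x\<rfloor> = i \<longleftrightarrow> i / 2 ^ m \<le> x \<and> x < (of_int i + 1) / 2 ^ m" for x and i :: int
    by (simp add: floor_eq_iff divide_le_eq less_divide_eq mult.commute)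
  have "grid_index m z = (k, l) \<longleftrightarrow>
      k / 2 ^ m \<le> Re z \<and> l / 2 ^ m \<le> Im z \<and> Re z < (of_int k + 1) / 2 ^ m \<and> Im z < (of_int l + 1) / 2 ^ m"
    by (auto simp: grid_index_def floor)
  also have "\<dots> \<longleftrightarrow> k / 2 ^ m \<le> Re z \<and> l / 2 ^ m \<le> Im z \<and>
      (\<exists>j::nat. Re z \<le> (of_int k + 1) / 2 ^ m - 1 / Suc j \<and> Im z \<le> (of_int l + 1) / 2 ^ m - 1 / Suc j)"
  proof -
    have "Re z < (of_int k + 1) / 2 ^ m \<and> Im z < (of_int l + 1) / 2 ^ m \<longleftrightarrow>
      (\<exists>j::nat. Re z \<le> (of_int k + 1) / 2 ^ m - 1 / Suc j \<and> Im z \<le> (of_int l + 1) / 2 ^ m - 1 / Suc j)" (is "?L \<longleftrightarrow> ?R")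
    proof
      assume ?L
      then obtain j1 j2 :: nat where "\<forall>j\<ge>j1. Re z \<le> (of_int k + 1) / 2 ^ m - 1 / Suc j"
        "\<forall>j\<ge>j2. Im z \<le> (of_int l + 1) / 2 ^ m - 1 / Suc j" unfolding half by blast
      then show ?R by (intro exI[of _ "max j1 j2"]) simp
    next
      assume ?R
      then obtain j :: nat where j: "Re z \<le> (of_int k + 1) / 2 ^ m - 1 / Suc j" "Im z \<le> (of_int l + 1) / 2 ^ m - 1 / Suc j" by blast
      have "1 / real (Suc j) > 0" by simp
      with j show ?L by linarith
    qed
    then show ?thesis by simp
  qed
  also have "\<dots> \<longleftrightarrow> z \<in> (\<Union>j::nat. cbox (grid_point m (k, l)) (Complex ((of_int k + 1) / 2 ^ m - 1 / Suc j) ((of_int l + 1) / 2 ^ m - 1 / Suc j)))"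
    by (auto simp: in_cbox_complex_iff grid_point_def)
  finally show ?thesis .
qed

text \<open>The random zero set is replaced by the dyadic squares that meet it, with
  \<open>F\<close> taken at the corner. For fixed \<open>\<omega>\<close> the finitely many zeros
  eventually lie in different squares, all inside a finite window, and the corners converge to the
  zeros; so the sum is a pointwise limit of measurable functions.\<close>

lemma borel_measurable_sum_zeros:
  fixes q :: "'w \<Rightarrow> complex \<Rightarrow> complex" and F :: "'w \<Rightarrow> complex \<Rightarrow> real"
  assumes q [measurable]: "\<And>z. (\<lambda>\<omega>. q \<omega> z) \<in> borel_measurable M"
    and F [measurable]: "\<And>z. (\<lambda>\<omega>. F \<omega> z) \<in> borel_measurable M"
    and q_cont: "\<And>\<omega>. continuous_on UNIV (q \<omega>)" and F_cont: "\<And>\<omega>. continuous_on UNIV (F \<omega>)"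
    and fin: "\<And>\<omega>. finite {z. q \<omega> z = 0}"
  shows "(\<lambda>\<omega>. \<Sum>z\<in>{z. q \<omega> z = 0}. F \<omega> z) \<in> borel_measurable M"
proof -
  define Z where "Z \<omega> = {z. q \<omega> z = 0}" for \<omega>
  define E where "E m p = {\<omega>\<in>space M. \<exists>z\<in>Z \<omega>. grid_index m z = p}" for m p
  have E[measurable]: "E m p \<in> sets M" for m p
  proof -
    obtain k l where p: "p = (k, l)" by (cases p)
    let ?K = "\<lambda>j::nat. cbox (grid_point m (k, l)) (Complex ((of_int k + 1) / 2 ^ m - 1 / Suc j) ((of_int l + 1) / 2 ^ m - 1 / Suc j))"
    have "E m p = (\<Union>j. {\<omega>\<in>space M. \<exists>z\<in>?K j. q \<omega> z = 0})"
      unfolding E_def p grid_index_eq_iff Z_def by (intro set_eqI) (simp, metis)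
    also have "\<dots> \<in> sets M"
      by (intro sets.countable_UN image_subsetI sets_exists_zero_compact[OF q q_cont compact_cbox])
    finally show ?thesis .
  qed
  \<comment> \<open>Labels up to \<open>4 ^ m\<close> at mesh \<open>1 / 2 ^ m\<close> cover
    coordinates up to about \<open>2 ^ m\<close>, so the window is finite for each \<open>m\<close>
    and exhausts the plane.\<close>
  define R where "R m = {- (4 ^ m) .. 4 ^ m :: int} \<times> {- (4 ^ m) .. 4 ^ m :: int}" for m :: nat
  define f where "f m \<omega> = (\<Sum>p\<in>R m. indicator (E m p) \<omega> * F \<omega> (grid_point m p))" for m \<omega>
  have "(\<lambda>\<omega>. \<Sum>z\<in>Z \<omega>. F \<omega> z) \<in> borel_measurable M"
  proof (rule borel_measurable_LIMSEQ_real)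
    show "f m \<in> borel_measurable M" for m
      unfolding f_def by measurable
    fix \<omega> assume \<omega>: "\<omega> \<in> space M"
    have finZ: "finite (Z \<omega>)" using fin by (simp add: Z_def)
    have inj: "\<forall>\<^sub>F m in sequentially. \<forall>z\<in>Z \<omega>. \<forall>z'\<in>Z \<omega>. z \<noteq> z' \<longrightarrow> grid_index m z \<noteq> grid_index m z'"
    proof (intro eventually_ball_finite finZ ballI)
      fix z z' assume "z \<in> Z \<omega>" "z' \<in> Z \<omega>"
      show "\<forall>\<^sub>F m in sequentially. z \<noteq> z' \<longrightarrow> grid_index m z \<noteq> grid_index m z'"
      proof (cases "z = z'")
        case False
        have "(\<lambda>m. grid_point m (grid_index m z) - grid_point m (grid_index m z')) \<longlonglongrightarrow> z - z'"
          by (intro tendsto_diff grid_point_index_tendsto)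
        then have "\<forall>\<^sub>F m in sequentially. grid_point m (grid_index m z) - grid_point m (grid_index m z') \<noteq> 0"
          using False by (intro tendsto_imp_eventually_ne) auto
        then show ?thesis by (rule eventually_mono) auto
      qed simp
    qed
    have range: "\<forall>\<^sub>F m in sequentially. \<forall>z\<in>Z \<omega>. grid_index m z \<in> R m"
    proof (intro eventually_ball_finite finZ ballI)
      fix z assume "z \<in> Z \<omega>"
      have "filterlim (\<lambda>m::nat. (2::real) ^ m) at_top sequentially"
        by real_asymp
      then have "\<forall>\<^sub>F m in sequentially. cmod z + 1 \<le> 2 ^ m"
        by (simp add: filterlim_at_top)
      then show "\<forall>\<^sub>F m in sequentially. grid_index m z \<in> R m"
      proof (rule eventually_mono)
        fix m :: nat assume m: "cmod z + 1 \<le> 2 ^ m"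
        have *: "\<lfloor>2 ^ m * x\<rfloor> \<in> {- (4 ^ m) .. 4 ^ m}" if "\<bar>x\<bar> \<le> cmod z" for x
        proof -
          have "\<bar>2 ^ m * x\<bar> \<le> 2 ^ m * (2 ^ m - 1)"
            unfolding abs_mult using that m by (intro mult_mono) auto
          also have "\<dots> = real_of_int (4 ^ m) - 2 ^ m"
            by (simp add: algebra_simps power_mult_distrib[symmetric])
          finally have "\<bar>2 ^ m * x\<bar> \<le> real_of_int (4 ^ m) - 1"
            using one_le_power[of "2::real" m] by linarith
          then have lo: "real_of_int (- (4 ^ m)) \<le> 2 ^ m * x" and hi: "2 ^ m * x \<le> real_of_int (4 ^ m)"
            by (simp_all add: abs_le_iff)
          have "- (4 ^ m) \<le> \<lfloor>2 ^ m * x\<rfloor>" using lo by (simp only: le_floor_iff)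
          moreover have "\<lfloor>2 ^ m * x\<rfloor> \<le> \<lfloor>real_of_int (4 ^ m)\<rfloor>" using hi by (rule floor_mono)
          ultimately show ?thesis by (simp only: floor_of_int atLeastAtMost_iff)
        qed
        show "grid_index m z \<in> R m"
          using *[OF abs_Re_le_cmod] *[OF abs_Im_le_cmod] by (simp add: grid_index_def R_def)
      qed
    qed
    have ev: "\<forall>\<^sub>F m in sequentially. (\<Sum>z\<in>Z \<omega>. F \<omega> (grid_point m (grid_index m z))) = f m \<omega>"
      using inj range
    proof eventually_elim
      fix m
      assume i: "\<forall>z\<in>Z \<omega>. \<forall>z'\<in>Z \<omega>. z \<noteq> z' \<longrightarrow> grid_index m z \<noteq> grid_index m z'"
        and r: "\<forall>z\<in>Z \<omega>. grid_index m z \<in> R m"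
      have inj: "inj_on (grid_index m) (Z \<omega>)" using i by (auto simp: inj_on_def)
      have "f m \<omega> = (\<Sum>p\<in>grid_index m ` Z \<omega>. indicator (E m p) \<omega> * F \<omega> (grid_point m p))"
        unfolding f_def using r
        by (intro sum.mono_neutral_right) (auto simp: R_def[of m] E_def indicator_def, metis image_eqI)
      also have "\<dots> = (\<Sum>p\<in>grid_index m ` Z \<omega>. F \<omega> (grid_point m p))"
        using \<omega> by (intro sum.cong) (auto simp: E_def indicator_def)
      finally show "(\<Sum>z\<in>Z \<omega>. F \<omega> (grid_point m (grid_index m z))) = f m \<omega>"
        by (simp add: sum.reindex[OF inj])
    qed
    have lim: "(\<lambda>m. \<Sum>z\<in>Z \<omega>. F \<omega> (grid_point m (grid_index m z))) \<longlonglongrightarrow> (\<Sum>z\<in>Z \<omega>. F \<omega> z)"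
      by (rule tendsto_sum, rule continuous_on_tendsto_compose[OF F_cont grid_point_index_tendsto]) auto
    show "(\<lambda>m. f m \<omega>) \<longlonglongrightarrow> (\<Sum>z\<in>Z \<omega>. F \<omega> z)"
      by (rule Lim_transform_eventually[OF lim ev])
  qed
  then show ?thesis by (simp add: Z_def)
qed

section \<open>The Gram matrix of the SU(2) polynomial\<close>

text \<open>The identity \<open>(n choose j) * (j choose k) = (n choose k) * ((n - k) choose (j -
  k))\<close> reduces it to the binomial theorem. As \<open>i \<le> k\<close>, truncation in
  \<open>j - i\<close> affects only terms with \<open>j < k\<close>, which vanish. The quotient of
  powers avoids a truncated exponent \<open>n - k\<close>, so the formula can be used uniformly in
  \<open>n\<close>.\<close>

lemma sum_binomial_binomial_power:
  fixes t :: real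
  assumes "1 + t \<noteq> 0" "i \<le> k"
  shows "(\<Sum>j\<le>n. real (n choose j) * real (j choose k) * t ^ (j - i))
       = real (n choose k) * t ^ (k - i) * ((1 + t) ^ n / (1 + t) ^ k)"
proof (cases "k \<le> n")
  case True
  have "(\<Sum>j\<le>n. real (n choose j) * real (j choose k) * t ^ (j - i))
      = (\<Sum>j\<in>{k..n}. real (n choose j) * real (j choose k) * t ^ (j - i))"
    by (rule sum.mono_neutral_right) auto
  also have "\<dots> = (\<Sum>j\<in>{k..n}. real (n choose k) * t ^ (k - i) * (real ((n - k) choose (j - k)) * t ^ (j - k)))"
  proof (rule sum.cong[OF refl])
    fix j assume j: "j \<in> {k..n}"
    then have "real (n choose j) * real (j choose k) = real (n choose k) * real ((n - k) choose (j - k))"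
      by (simp only: of_nat_mult[symmetric]) (simp add: choose_mult)
    moreover have "t ^ (j - i) = t ^ (k - i) * t ^ (j - k)"
      using j assms(2) by (simp add: power_add[symmetric])
    ultimately show "real (n choose j) * real (j choose k) * t ^ (j - i)
      = real (n choose k) * t ^ (k - i) * (real ((n - k) choose (j - k)) * t ^ (j - k))"
      by simp
  qed
  also have "\<dots> = real (n choose k) * t ^ (k - i) * (\<Sum>j\<in>{k..n}. real ((n - k) choose (j - k)) * t ^ (j - k))"
    by (simp add: sum_distrib_left)
  also have "(\<Sum>j\<in>{k..n}. real ((n - k) choose (j - k)) * t ^ (j - k)) = (\<Sum>j\<le>n - k. real ((n - k) choose j) * t ^ j)"
    using True by (intro sum.reindex_bij_witness[of _ "\<lambda>j. j + k" "\<lambda>j. j - k"]) auto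
  also have "\<dots> = (1 + t) ^ (n - k)"
    using binomial_ring[of t 1 "n - k"] by (simp add: add.commute)
  also have "\<dots> = (1 + t) ^ n / (1 + t) ^ k"
    using True assms(1) by (simp add: power_diff)
  finally show ?thesis .
next
  case False
  then have "(\<Sum>j\<le>n. real (n choose j) * real (j choose k) * t ^ (j - i)) = 0"
    by (intro sum.neutral) auto
  then show ?thesis using False by simp
qed

lemma real_choose_2: "real (n choose 2) = real n * (real n - 1) / 2"
  by (induction n) (simp_all add: numeral_2_eq_2 algebra_simps)

lemma real_choose_3: "real (n choose 3) = real n * (real n - 1) * (real n - 2) / 6"
proof (induction n)
  case (Suc n)
  have "Suc n choose 3 = (n choose 2) + (n choose 3)" by (simp add: numeral_3_eq_3 numeral_2_eq_2)
  then show ?case using Suc by (simp add: real_choose_2 field_simps)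
qed simp

lemma real_choose_4: "real (n choose 4) = real n * (real n - 1) * (real n - 2) * (real n - 3) / 24"
proof (induction n)
  case (Suc n)
  have "Suc n choose 4 = (n choose 3) + (n choose 4)" by (simp add: eval_nat_numeral)
  then show ?case using Suc by (simp add: real_choose_3 field_simps)
qed simp

text \<open>The Gram matrix of the forms \<open>p(z)\<close>, \<open>p'(z) / sqrt n\<close>, \<open>p''(z) / sqrt n\<close> restricted to
  \<open>p'(z) = 0\<close>, with \<open>t = cmod z ^ 2\<close> and the powers of \<open>z\<close> divided out.\<close>

lemma SU2_gram_sums:
  fixes t :: real
  assumes t: "t \<ge> 0" and n: "n \<ge> 1"
  defines "T \<equiv> 1 + t" and "E \<equiv> (1 + t) ^ n" and "N \<equiv> real n"
  shows "(\<Sum>j\<le>n. real (n choose j) * (1 - real j)\<^sup>2 * t ^ j) = E / T\<^sup>2 * (T\<^sup>2 - N * t * T + N * (N - 1) * t\<^sup>2)"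
    and "(\<Sum>j\<le>n. real (n choose j) * (real j * (real j - 1)) * t ^ (j - 1)) = N * (N - 1) * t * E / T\<^sup>2"
    and "(\<Sum>j\<le>n. real (n choose j) * (real j)\<^sup>2 * t ^ (j - 1)) = N * (1 + N * t) * E / T\<^sup>2"
    and "(\<Sum>j\<le>n. real (n choose j) * (real j * (real j - 1)\<^sup>2) * t ^ (j - 2))
      = N * (N - 1) * (1 + (N - 1) * t) * E / T ^ 3"
    and "(\<Sum>j\<le>n. real (n choose j) * ((real j)\<^sup>2 * (real j - 1)) * t ^ (j - 2))
      = N * (N - 1) * (2 + N * t) * E / T ^ 3"
    and "(\<Sum>j\<le>n. real (n choose j) * ((real j)\<^sup>2 * (real j - 1)\<^sup>2) * t ^ (j - 2))
      = N * (N - 1) * ((N - 2) * (N - 3) * t\<^sup>2 + 4 * (N - 2) * t * T + 2 * T\<^sup>2) * E / T ^ 4"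
proof -
  have T: "T \<noteq> 0" "1 + t \<noteq> 0" using t by (auto simp: T_def)
  have M: "(\<Sum>j\<le>n. real (n choose j) * real (j choose k) * t ^ (j - i)) = real (n choose k) * t ^ (k - i) * (E / T ^ k)"
    if "i \<le> k" for i k
    using sum_binomial_binomial_power[OF T(2) that, of n] by (simp only: E_def T_def)
  have c: "real (j choose 0) = 1" "real (j choose 1) = real j" for j by simp_all
  note cs = c real_choose_2 real_choose_3 real_choose_4
  \<comment> \<open>Expansions of the weights in the basis \<open>j choose k\<close>, for which the
    sums are known. The zero summand in the second one brings it into the two-term shape of
    \<open>lin1\<close>.\<close>
  have 1: "(1 - real j)\<^sup>2 = 1 * real (j choose 0) + (-1) * real (j choose 1) + 2 * real (j choose 2)" for j
    unfolding cs by (simp add: power2_eq_square field_simps)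
  have 2: "real j * (real j - 1) = 2 * real (j choose 2) + 0 * real (j choose 2)" for j
    unfolding cs by (simp add: power2_eq_square field_simps)
  have 3: "(real j)\<^sup>2 = 1 * real (j choose 1) + 2 * real (j choose 2)" for j
    unfolding cs by (simp add: power2_eq_square field_simps)
  have 4: "real j * (real j - 1)\<^sup>2 = 6 * real (j choose 3) + 2 * real (j choose 2)" for j
    unfolding cs by (simp add: power2_eq_square field_simps)
  have 5: "(real j)\<^sup>2 * (real j - 1) = 6 * real (j choose 3) + 4 * real (j choose 2)" for j
    unfolding cs by (simp add: power2_eq_square field_simps)
  have 6: "(real j)\<^sup>2 * (real j - 1)\<^sup>2 = 24 * real (j choose 4) + 24 * real (j choose 3) + 4 * real (j choose 2)" for j
    unfolding cs by (simp add: power2_eq_square field_simps)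
  have lin1: "(\<Sum>j\<le>n. real (n choose j) * (a * f j + b * g j) * t ^ h j)
      = a * (\<Sum>j\<le>n. real (n choose j) * f j * t ^ h j) + b * (\<Sum>j\<le>n. real (n choose j) * g j * t ^ h j)"
    for a b :: real and f g and h :: "nat \<Rightarrow> nat"
    by (simp add: sum_distrib_left sum.distrib[symmetric] algebra_simps)
  have lin2: "(\<Sum>j\<le>n. real (n choose j) * (a * f j + b * g j + c * k j) * t ^ h j)
      = a * (\<Sum>j\<le>n. real (n choose j) * f j * t ^ h j) + b * (\<Sum>j\<le>n. real (n choose j) * g j * t ^ h j)
        + c * (\<Sum>j\<le>n. real (n choose j) * k j * t ^ h j)"
    for a b c :: real and f g k and h :: "nat \<Rightarrow> nat"
    by (simp add: sum_distrib_left sum.distrib[symmetric] algebra_simps)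
  have M12: "(\<Sum>j\<le>n. real (n choose j) * real (j choose 2) * t ^ (j - 1)) = real (n choose 2) * t ^ 1 * (E / T ^ 2)"
    using M[of 1 2] by simp
  have M11: "(\<Sum>j\<le>n. real (n choose j) * real (j choose 1) * t ^ (j - 1)) = real (n choose 1) * t ^ 0 * (E / T ^ 1)"
    using M[of 1 1] by simp
  have M23: "(\<Sum>j\<le>n. real (n choose j) * real (j choose 3) * t ^ (j - 2)) = real (n choose 3) * t ^ 1 * (E / T ^ 3)"
    using M[of 2 3] by simp
  have M22: "(\<Sum>j\<le>n. real (n choose j) * real (j choose 2) * t ^ (j - 2)) = real (n choose 2) * t ^ 0 * (E / T ^ 2)"
    using M[of 2 2] by simp
  have M24: "(\<Sum>j\<le>n. real (n choose j) * real (j choose 4) * t ^ (j - 2)) = real (n choose 4) * t ^ 2 * (E / T ^ 4)"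
    using M[of 2 4] by simp
  note pw = power2_eq_square power3_eq_cube power4_eq_xxxx
  have M0: "(\<Sum>j\<le>n. real (n choose j) * real (j choose k) * t ^ j) = real (n choose k) * t ^ k * (E / T ^ k)" for k
    using M[of 0 k] by simp
  show "(\<Sum>j\<le>n. real (n choose j) * (1 - real j)\<^sup>2 * t ^ j) = E / T\<^sup>2 * (T\<^sup>2 - N * t * T + N * (N - 1) * t\<^sup>2)"
    unfolding 1 lin2 M0 using T(1)
    by (simp add: real_choose_2 real_choose_3 real_choose_4 N_def[symmetric],
      (simp add: pw field_simps, (simp add: T_def algebra_simps)?)?)
  show "(\<Sum>j\<le>n. real (n choose j) * (real j * (real j - 1)) * t ^ (j - 1)) = N * (N - 1) * t * E / T\<^sup>2"
    unfolding 2 lin1 M12 using T(1)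
    by (simp add: real_choose_2 real_choose_3 real_choose_4 N_def[symmetric],
      (simp add: pw field_simps, (simp add: T_def algebra_simps)?)?)
  show "(\<Sum>j\<le>n. real (n choose j) * (real j)\<^sup>2 * t ^ (j - 1)) = N * (1 + N * t) * E / T\<^sup>2"
    unfolding 3 lin1 M11 M12 using T(1)
    by (simp add: real_choose_2 real_choose_3 real_choose_4 N_def[symmetric],
      (simp add: pw field_simps, (simp add: T_def algebra_simps)?)?)
  show "(\<Sum>j\<le>n. real (n choose j) * (real j * (real j - 1)\<^sup>2) * t ^ (j - 2))
      = N * (N - 1) * (1 + (N - 1) * t) * E / T ^ 3"
    unfolding 4 lin1 M23 M22 using T(1)
    by (simp add: real_choose_2 real_choose_3 real_choose_4 N_def[symmetric],
      (simp add: pw field_simps, (simp add: T_def algebra_simps)?)?)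
  show "(\<Sum>j\<le>n. real (n choose j) * ((real j)\<^sup>2 * (real j - 1)) * t ^ (j - 2))
      = N * (N - 1) * (2 + N * t) * E / T ^ 3"
    unfolding 5 lin1 M23 M22 using T(1)
    by (simp add: real_choose_2 real_choose_3 real_choose_4 N_def[symmetric],
      (simp add: pw field_simps, (simp add: T_def algebra_simps)?)?)
  show "(\<Sum>j\<le>n. real (n choose j) * ((real j)\<^sup>2 * (real j - 1)\<^sup>2) * t ^ (j - 2))
      = N * (N - 1) * ((N - 2) * (N - 3) * t\<^sup>2 + 4 * (N - 2) * t * T + 2 * T\<^sup>2) * E / T ^ 4"
    unfolding 6 lin2 M24 M23 M22 using T(1)
    by (simp add: real_choose_2 real_choose_3 real_choose_4 N_def[symmetric],
      (simp add: pw field_simps, (simp add: T_def algebra_simps)?)?)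
qed

text \<open>\<open>A\<close>, \<open>V\<close> and \<open>W\<close> are the diagonal entries of the
  Gram matrix with 1 added to the second; the entries below the diagonal are
  \<open>cnj z * b\<close>, \<open>(cnj z)\<^sup>2 * d\<close> and \<open>cnj z * e\<close>.
  \<open>D\<close> is the leading 2 by 2 determinant, and the right side of the last claim is the
  full determinant, so the conditional variance is a quotient of determinants. Thus the triangular
  factor, known only through its Gram matrix, disappears from the integral.\<close>

lemma cholesky_schur_complement:
  fixes \<alpha> \<beta> \<gamma> \<delta> \<epsilon> \<zeta> z :: complex and A b V d e W :: real
  assumes \<alpha>: "\<alpha> * cnj \<alpha> = of_real A" and \<beta>: "\<beta> * cnj \<alpha> = cnj z * of_real b"
    and \<gamma>: "\<beta> * cnj \<beta> + \<gamma> * cnj \<gamma> = of_real (V - 1)"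
    and \<delta>: "\<delta> * cnj \<alpha> = (cnj z)\<^sup>2 * of_real d"
    and \<epsilon>: "\<delta> * cnj \<beta> + \<epsilon> * cnj \<gamma> = cnj z * of_real e"
    and \<zeta>: "\<delta> * cnj \<delta> + \<epsilon> * cnj \<epsilon> + \<zeta> * cnj \<zeta> = of_real W"
    and A: "A > 0"
  defines "t \<equiv> (cmod z)\<^sup>2" and "s \<equiv> 1 + (cmod \<gamma>)\<^sup>2"
  defines "D \<equiv> V * A - t * b\<^sup>2"
  shows "(cmod \<alpha>)\<^sup>2 = A" "s + (cmod \<beta>)\<^sup>2 = V" "s * A = D"
    "(cmod (\<delta> - \<epsilon> * cnj \<gamma> * \<beta> / of_real s))\<^sup>2 / A = t\<^sup>2 * (d * V - e * b)\<^sup>2 / D\<^sup>2"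
    "((cmod \<epsilon>)\<^sup>2 / s + (cmod \<zeta>)\<^sup>2) * D = W * D - t\<^sup>2 * d\<^sup>2 * V - t * A * e\<^sup>2 + 2 * t\<^sup>2 * e * d * b"
proof -
  have s: "s > 0" unfolding s_def by (simp add: add_pos_nonneg)
  show n1: "(cmod \<alpha>)\<^sup>2 = A"
    using \<alpha> unfolding complex_norm_square[symmetric] of_real_eq_iff .
  have n2: "(cmod \<beta>)\<^sup>2 * A = t * b\<^sup>2"
    using arg_cong[OF \<beta>, of "\<lambda>x. (cmod x)\<^sup>2"] by (simp add: norm_mult power_mult_distrib n1 t_def)
  have n3: "(cmod \<beta>)\<^sup>2 + (cmod \<gamma>)\<^sup>2 = V - 1"
    using \<gamma> unfolding complex_norm_square[symmetric] of_real_add[symmetric] of_real_eq_iff .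
  have n4: "(cmod \<delta>)\<^sup>2 * A = t\<^sup>2 * d\<^sup>2"
    using arg_cong[OF \<delta>, of "\<lambda>x. (cmod x)\<^sup>2"]
    by (simp add: norm_mult norm_power power_mult_distrib n1 t_def)
  have n6: "(cmod \<delta>)\<^sup>2 + (cmod \<epsilon>)\<^sup>2 + (cmod \<zeta>)\<^sup>2 = W"
    using \<zeta> unfolding complex_norm_square[symmetric] of_real_add[symmetric] of_real_eq_iff .
  show V: "s + (cmod \<beta>)\<^sup>2 = V" using n3 by (simp add: s_def)
  show D: "s * A = D"
  proof -
    have "(s + (cmod \<beta>)\<^sup>2) * A = s * A + t * b\<^sup>2" by (simp add: n2 distrib_right)
    then show ?thesis unfolding V D_def by linarith
  qed
  have bb: "\<beta> * cnj \<beta> = of_real ((cmod \<beta>)\<^sup>2)" by (simp only: complex_norm_square)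
  define c where "c = \<delta> - \<epsilon> * cnj \<gamma> * \<beta> / of_real s"
  \<comment> \<open>Multiplying by \<open>s\<close> and \<open>cnj \<alpha>\<close> clears all
    divisions, so that only Gram entries remain; the modulus is taken afterwards.\<close>
  have "c * of_real s * cnj \<alpha> = \<delta> * cnj \<alpha> * of_real s - (cnj z * of_real e - \<delta> * cnj \<beta>) * (\<beta> * cnj \<alpha>)"
    using s unfolding c_def \<epsilon>[symmetric] by (simp add: field_simps)
  also have "\<dots> = (\<delta> * cnj \<alpha>) * (of_real s + \<beta> * cnj \<beta>) - cnj z * of_real e * (\<beta> * cnj \<alpha>)"
    by (simp add: algebra_simps)
  also have "\<dots> = (cnj z)\<^sup>2 * of_real (d * V - e * b)"
    unfolding bb of_real_add[symmetric] V \<delta> \<beta> by (simp add: algebra_simps power2_eq_square)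
  finally have "(cmod (c * of_real s * cnj \<alpha>))\<^sup>2 = (cmod ((cnj z)\<^sup>2 * of_real (d * V - e * b)))\<^sup>2"
    by simp
  then have "(cmod c)\<^sup>2 * s\<^sup>2 * A = t\<^sup>2 * (d * V - e * b)\<^sup>2"
    by (simp only: norm_mult norm_power power_mult_distrib n1 t_def norm_of_real complex_mod_cnj power2_abs)
  then show "(cmod (\<delta> - \<epsilon> * cnj \<gamma> * \<beta> / of_real s))\<^sup>2 / A = t\<^sup>2 * (d * V - e * b)\<^sup>2 / D\<^sup>2"
    unfolding c_def[symmetric] D[symmetric] using s A
    by (simp add: field_simps power2_eq_square)
  \<comment> \<open>The product of the squared moduli of \<open>\<epsilon>\<close> and
    \<open>\<gamma>\<close> is that of \<open>cnj z * e - \<delta> * cnj \<beta>\<close>. After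
    multiplication by \<open>A = \<alpha> * cnj \<alpha>\<close> its cross terms become products of
    Gram entries.\<close>
  have eg: "A * ((cmod \<epsilon>)\<^sup>2 * (cmod \<gamma>)\<^sup>2) = A * t * e\<^sup>2 - 2 * e * d * b * t\<^sup>2 + t\<^sup>2 * d\<^sup>2 * (cmod \<beta>)\<^sup>2"
  proof -
    have x: "\<epsilon> * cnj \<gamma> = cnj z * of_real e - \<delta> * cnj \<beta>" using \<epsilon> by (simp add: algebra_simps)
    have db: "(cnj \<delta> * \<alpha>) * (\<beta> * cnj \<alpha>) = z\<^sup>2 * cnj z * of_real (d * b)"
      using arg_cong[OF \<delta>, of cnj] unfolding \<beta> by (simp add: algebra_simps)
    then have "cnj z * ((cnj \<delta> * \<alpha>) * (\<beta> * cnj \<alpha>)) = (z * cnj z) * (z * cnj z) * of_real (d * b)"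
      by (simp add: power2_eq_square algebra_simps)
    then have y: "cnj z * ((cnj \<delta> * \<alpha>) * (\<beta> * cnj \<alpha>)) = of_real (t\<^sup>2 * d * b)"
      by (simp add: complex_norm_square[symmetric] t_def power2_eq_square)
    then have y': "z * ((\<delta> * cnj \<alpha>) * (cnj \<beta> * \<alpha>)) = of_real (t\<^sup>2 * d * b)"
    proof -
      have "z * ((\<delta> * cnj \<alpha>) * (cnj \<beta> * \<alpha>)) = cnj (cnj z * ((cnj \<delta> * \<alpha>) * (\<beta> * cnj \<alpha>)))"
        by simp
      then show ?thesis unfolding y by simp
    qed
    have "complex_of_real (A * ((cmod \<epsilon>)\<^sup>2 * (cmod \<gamma>)\<^sup>2)) = (\<alpha> * cnj \<alpha>) * ((\<epsilon> * cnj \<gamma>) * cnj (\<epsilon> * cnj \<gamma>))"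
      unfolding \<alpha> of_real_mult complex_norm_square by (simp add: algebra_simps)
    also have "\<dots> = (\<alpha> * cnj \<alpha>) * (z * cnj z) * of_real (e\<^sup>2)
        - of_real e * (cnj z * ((cnj \<delta> * \<alpha>) * (\<beta> * cnj \<alpha>)))
        - of_real e * (z * ((\<delta> * cnj \<alpha>) * (cnj \<beta> * \<alpha>)))
        + ((\<delta> * cnj \<delta>) * (\<alpha> * cnj \<alpha>)) * (\<beta> * cnj \<beta>)"
      unfolding x by (simp add: algebra_simps power2_eq_square)
    also have "\<dots> = of_real (A * t * e\<^sup>2 - e * (t\<^sup>2 * d * b) - e * (t\<^sup>2 * d * b) + (cmod \<delta>)\<^sup>2 * A * (cmod \<beta>)\<^sup>2)"
      unfolding y y' complex_norm_square[symmetric] t_def[symmetric] n1 by simp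
    finally show ?thesis unfolding of_real_eq_iff n4 by (simp add: algebra_simps)
  qed
  have "((cmod \<epsilon>)\<^sup>2 / s + (cmod \<zeta>)\<^sup>2) * D = A * ((cmod \<epsilon>)\<^sup>2 + s * (cmod \<zeta>)\<^sup>2)"
    unfolding D[symmetric] using s by (simp add: field_simps)
  also have "A * ((cmod \<epsilon>)\<^sup>2 + s * (cmod \<zeta>)\<^sup>2)
      = W * (s * A) - ((cmod \<delta>)\<^sup>2 * A) * s - A * ((cmod \<epsilon>)\<^sup>2 * (cmod \<gamma>)\<^sup>2)"
    unfolding n6[symmetric] by (simp add: s_def algebra_simps)
  also have "\<dots> = W * D - t\<^sup>2 * d\<^sup>2 * (s + (cmod \<beta>)\<^sup>2) - t * A * e\<^sup>2 + 2 * t\<^sup>2 * e * d * b"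
    unfolding eg n4 D by (simp add: algebra_simps)
  finally show "((cmod \<epsilon>)\<^sup>2 / s + (cmod \<zeta>)\<^sup>2) * D = W * D - t\<^sup>2 * d\<^sup>2 * V - t * A * e\<^sup>2 + 2 * t\<^sup>2 * e * d * b"
    unfolding V .
qed

text \<open>Once powers of \<open>E\<close> and \<open>T\<close> are factored out, the remaining
  polynomials in \<open>t\<close> and \<open>N\<close> collapse to \<open>T\<^sup>2\<close>,
  \<open>- T\<close> and \<open>2 * T\<^sup>2\<close>. The square roots cancel because
  \<open>b\<close> and \<open>d\<close> carry the same factor \<open>sqrt N\<close> and enter
  through \<open>b\<^sup>2\<close>, \<open>d\<^sup>2\<close>, \<open>d * b\<close> or the square of
  \<open>d * V - e * b\<close>.\<close>

lemma SU2_gram_reduction: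
  fixes t N E :: real
  assumes t: "t \<ge> 0" and N: "N > 0" and E: "E > 0"
  defines "T \<equiv> 1 + t"
  defines "A \<equiv> E / T\<^sup>2 * (T\<^sup>2 - N * t * T + N * (N - 1) * t\<^sup>2)"
    and "S2 \<equiv> N * (N - 1) * t * E / T\<^sup>2" and "V \<equiv> (1 + N * t) * E / T\<^sup>2"
    and "S4 \<equiv> N * (N - 1) * (1 + (N - 1) * t) * E / T ^ 3" and "e \<equiv> (N - 1) * (2 + N * t) * E / T ^ 3"
    and "W \<equiv> (N - 1) * ((N - 2) * (N - 3) * t\<^sup>2 + 4 * (N - 2) * t * T + 2 * T\<^sup>2) * E / T ^ 4"
  defines "b \<equiv> - S2 / sqrt N" and "d \<equiv> - S4 / sqrt N"
  shows "V * A - t * b\<^sup>2 = E\<^sup>2 / T\<^sup>2"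
    "t\<^sup>2 * (d * V - e * b)\<^sup>2 / (E\<^sup>2 / T\<^sup>2)\<^sup>2 = N * (N - 1)\<^sup>2 * t\<^sup>2 / T ^ 4"
    "(W * (E\<^sup>2 / T\<^sup>2) - t\<^sup>2 * d\<^sup>2 * V - t * A * e\<^sup>2 + 2 * t\<^sup>2 * e * d * b) / (E\<^sup>2 / T\<^sup>2) = 2 * (N - 1) * E / T ^ 4"
proof -
  have T: "T > 0" using t by (simp add: T_def)
  have tT: "t = T - 1" by (simp add: T_def)
  have q: "sqrt N > 0" "sqrt N * sqrt N = N" using N by simp_all
  have key: "- (N * X) / sqrt N = - sqrt N * X" for X using q by (simp add: field_simps)
  have b1: "b = - sqrt N * ((N - 1) * t * E / T\<^sup>2)"
    and d1: "d = - sqrt N * ((N - 1) * (1 + (N - 1) * t) * E / T ^ 3)"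
    unfolding key[symmetric] b_def d_def S2_def S4_def by (simp_all add: mult.assoc)
  have b2: "b\<^sup>2 = N * (N - 1)\<^sup>2 * t\<^sup>2 * E\<^sup>2 / T ^ 4"
    unfolding b1 using N by (simp add: power_divide power_mult_distrib power_mult[symmetric])
  have d2: "d\<^sup>2 = N * (N - 1)\<^sup>2 * (1 + (N - 1) * t)\<^sup>2 * E\<^sup>2 / T ^ 6"
    unfolding d1 using N by (simp add: power_divide power_mult_distrib power_mult[symmetric])
  have "d * b = (sqrt N * sqrt N) * ((N - 1) * (1 + (N - 1) * t) * E / T ^ 3) * ((N - 1) * t * E / T\<^sup>2)"
  proof -
    have "(- r * X) * (- r * Y) = (r * r) * X * Y" for r X Y :: real by (simp add: ac_simps)
    then show ?thesis unfolding b1 d1 .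
  qed
  then have db: "d * b = N * (N - 1)\<^sup>2 * t * (1 + (N - 1) * t) * E\<^sup>2 / T ^ 5"
    unfolding q by (simp add: eval_nat_numeral ac_simps)
  have "V * A - t * b\<^sup>2 = E\<^sup>2 / T ^ 4 * ((1 + N * t) * (T\<^sup>2 - N * t * T + N * (N - 1) * t\<^sup>2) - N * (N - 1)\<^sup>2 * t ^ 3)"
    unfolding b2 V_def A_def using T by (simp add: field_simps) (simp add: eval_nat_numeral algebra_simps)
  also have "(1 + N * t) * (T\<^sup>2 - N * t * T + N * (N - 1) * t\<^sup>2) - N * (N - 1)\<^sup>2 * t ^ 3 = T\<^sup>2"
    unfolding T_def by (simp add: eval_nat_numeral algebra_simps)
  finally show "V * A - t * b\<^sup>2 = E\<^sup>2 / T\<^sup>2" using T by (simp add: field_simps eval_nat_numeral)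
  have "d * V - e * b = sqrt N * (N - 1) * (E\<^sup>2 / T ^ 5) * ((2 + N * t) * (N - 1) * t - (1 + (N - 1) * t) * (1 + N * t))"
  proof -
    show ?thesis unfolding V_def e_def b1 d1 using T
      by (simp add: field_simps) (simp add: eval_nat_numeral algebra_simps)
  qed
  also have "(2 + N * t) * (N - 1) * t - (1 + (N - 1) * t) * (1 + N * t) = - T"
    unfolding T_def by (simp add: algebra_simps)
  finally have dV: "d * V - e * b = sqrt N * (N - 1) * ((E\<^sup>2 / T ^ 5) * (- T))"
    by (simp only: mult.assoc)
  have "(E\<^sup>2 / T ^ 5) * (- T) = - (E\<^sup>2 / T ^ 4)"
    using T by (simp add: eval_nat_numeral)
  then have dVeb: "d * V - e * b = - sqrt N * (N - 1) * (E\<^sup>2 / T ^ 4)"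
    unfolding dV by simp
  show "t\<^sup>2 * (d * V - e * b)\<^sup>2 / (E\<^sup>2 / T\<^sup>2)\<^sup>2 = N * (N - 1)\<^sup>2 * t\<^sup>2 / T ^ 4"
  proof -
    have "(d * V - e * b)\<^sup>2 = N * (N - 1)\<^sup>2 * E ^ 4 / T ^ 8"
      unfolding dVeb using N by (simp add: power_mult_distrib power_divide power_mult[symmetric])
    then show ?thesis using T E by (simp add: eval_nat_numeral)
  qed
  have "W * (E\<^sup>2 / T\<^sup>2) - t\<^sup>2 * d\<^sup>2 * V - t * A * e\<^sup>2 + 2 * t\<^sup>2 * e * (d * b)
    = (N - 1) * (E ^ 3 / T ^ 8) * (((N - 2) * (N - 3) * t\<^sup>2 + 4 * (N - 2) * t * T + 2 * T\<^sup>2) * T\<^sup>2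
        - t\<^sup>2 * N * (N - 1) * (1 + (N - 1) * t)\<^sup>2 * (1 + N * t)
        - t * (T\<^sup>2 - N * t * T + N * (N - 1) * t\<^sup>2) * (N - 1) * (2 + N * t)\<^sup>2
        + 2 * N * (N - 1)\<^sup>2 * t ^ 3 * (1 + (N - 1) * t) * (2 + N * t))"
  proof -
    have 1: "W * (E\<^sup>2 / T\<^sup>2) = (N - 1) * (E ^ 3 / T ^ 8) * (((N - 2) * (N - 3) * t\<^sup>2 + 4 * (N - 2) * t * T + 2 * T\<^sup>2) * T\<^sup>2)"
      unfolding W_def using T by (simp add: eval_nat_numeral ac_simps)
    have 2: "t\<^sup>2 * d\<^sup>2 * V = (N - 1) * (E ^ 3 / T ^ 8) * (t\<^sup>2 * N * (N - 1) * (1 + (N - 1) * t)\<^sup>2 * (1 + N * t))"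
      unfolding d2 V_def using T by (simp add: eval_nat_numeral ac_simps)
    have 3: "t * A * e\<^sup>2 = (N - 1) * (E ^ 3 / T ^ 8) * (t * (T\<^sup>2 - N * t * T + N * (N - 1) * t\<^sup>2) * (N - 1) * (2 + N * t)\<^sup>2)"
      unfolding A_def e_def using T by (simp add: eval_nat_numeral ac_simps)
    have 4: "2 * t\<^sup>2 * e * (d * b) = (N - 1) * (E ^ 3 / T ^ 8) * (2 * N * (N - 1)\<^sup>2 * t ^ 3 * (1 + (N - 1) * t) * (2 + N * t))"
      unfolding db e_def using T by (simp add: eval_nat_numeral ac_simps) (simp add: algebra_simps)
    show ?thesis unfolding 1 2 3 4 by (simp only: right_diff_distrib distrib_left)
  qed
  also have "((N - 2) * (N - 3) * t\<^sup>2 + 4 * (N - 2) * t * T + 2 * T\<^sup>2) * T\<^sup>2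
        - t\<^sup>2 * N * (N - 1) * (1 + (N - 1) * t)\<^sup>2 * (1 + N * t)
        - t * (T\<^sup>2 - N * t * T + N * (N - 1) * t\<^sup>2) * (N - 1) * (2 + N * t)\<^sup>2
        + 2 * N * (N - 1)\<^sup>2 * t ^ 3 * (1 + (N - 1) * t) * (2 + N * t) = 2 * T\<^sup>2"
    unfolding T_def by algebra
  finally have WD: "W * (E\<^sup>2 / T\<^sup>2) - t\<^sup>2 * d\<^sup>2 * V - t * A * e\<^sup>2 + 2 * t\<^sup>2 * e * (d * b)
      = (N - 1) * (E ^ 3 / T ^ 8) * (2 * T\<^sup>2)" .
  have assoc: "2 * t\<^sup>2 * e * d * b = 2 * t\<^sup>2 * e * (d * b)" by simp
  show "(W * (E\<^sup>2 / T\<^sup>2) - t\<^sup>2 * d\<^sup>2 * V - t * A * e\<^sup>2 + 2 * t\<^sup>2 * e * d * b) / (E\<^sup>2 / T\<^sup>2) = 2 * (N - 1) * E / T ^ 4"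
    unfolding assoc WD using T E by (simp add: eval_nat_numeral)
qed

text \<open>Intensity in \<open>(z, r)\<close>, with \<open>t = |z|^2\<close>, of critical points at
  \<open>z\<close> whose value has modulus \<open>r\<close>. It is radial in \<open>z\<close>, which
  leaves a one-dimensional integral over \<open>t\<close>.\<close>

definition critical_kernel :: "nat \<Rightarrow> real \<Rightarrow> real \<Rightarrow> real" where
  "critical_kernel n t r =
     2 * r * (1 + t)\<^sup>2 / (pi * ((1 + t) ^ n)\<^sup>2) * exp (- (r\<^sup>2 * ((1 + real n * t) / (1 + t) ^ n)))
       * (real n * (real n - 1)\<^sup>2 * t\<^sup>2 / (1 + t) ^ 4 * r\<^sup>2 + 2 * (real n - 1) * (1 + t) ^ n / (1 + t) ^ 4)"

text \<open>\<open>u\<close>, \<open>v\<close>, \<open>w\<close> are the coefficients of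
  \<open>p - z p'\<close>, \<open>p' / sqrt n\<close> and \<open>p'' / sqrt n\<close> without the
  linear one. The density at the second form is the weight of the value that the linear coefficient
  must take (up to sign, which the density does not see), and the squared third form is the
  Jacobian.\<close>

lemma SU2_conditional_integral:
  fixes z :: complex and \<phi> :: "real \<Rightarrow> ennreal"
  assumes n: "n \<ge> 1" and [measurable]: "\<phi> \<in> borel_measurable borel"
  defines "I \<equiv> {..n} - {1}" and "c \<equiv> (\<lambda>j. complex_of_real (sqrt (real (n choose j))))"
  defines "u \<equiv> (\<lambda>j. c j * (1 - of_nat j) * z ^ j)"
    and "v \<equiv> (\<lambda>j. c j * of_nat j * z ^ (j - 1) / of_real (sqrt (real n)))"
    and "w \<equiv> (\<lambda>j. c j * of_nat j * (of_nat j - 1) * z ^ (j - 2) / of_real (sqrt (real n)))"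
  shows "(\<integral>\<^sup>+x. \<phi> (cmod (\<Sum>j\<in>I. u j * x j)) * ennreal ((cmod (\<Sum>j\<in>I. w j * x j))\<^sup>2)
            * standard_complex_gaussian_density (\<Sum>j\<in>I. v j * x j) \<partial>PiM I (\<lambda>_. cgauss))
    = (\<integral>\<^sup>+r\<in>{0..}. \<phi> r * ennreal (critical_kernel n ((cmod z)\<^sup>2) r) \<partial>lborel)"
proof -
  define t where "t = (cmod z)\<^sup>2"
  define T where "T = 1 + t"
  define E where "E = (1 + t) ^ n"
  define N where "N = real n"
  define q where "q = sqrt N"
  have t: "t \<ge> 0" by (simp add: t_def)
  have N: "N \<ge> 1" using n by (simp add: N_def)
  have q: "q > 0" "q * q = N" using N by (simp_all add: q_def)
  have T: "T > 0" using t by (simp add: T_def)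
  have E: "E > 0" using t by (simp add: E_def)
  define A where "A = E / T\<^sup>2 * (T\<^sup>2 - N * t * T + N * (N - 1) * t\<^sup>2)"
  define S2 where "S2 = N * (N - 1) * t * E / T\<^sup>2"
  define V where "V = (1 + N * t) * E / T\<^sup>2"
  define S4 where "S4 = N * (N - 1) * (1 + (N - 1) * t) * E / T ^ 3"
  define e where "e = (N - 1) * (2 + N * t) * E / T ^ 3"
  define W where "W = (N - 1) * ((N - 2) * (N - 3) * t\<^sup>2 + 4 * (N - 2) * t * T + 2 * T\<^sup>2) * E / T ^ 4"
  define b where "b = - S2 / q"
  define d where "d = - S4 / q"
  let ?C = "\<lambda>j. real (n choose j)"
  have cc: "c j * cnj (c j) = of_real (?C j)" for j
    by (simp add: c_def of_real_mult[symmetric] del: of_real_mult)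
  have tz: "complex_of_real t = z * cnj z" by (simp only: t_def complex_norm_square)
  have zz: "z ^ i * cnj (z ^ i) = of_real (t ^ i)" for i
    by (simp add: tz power_mult_distrib)
  have qq: "of_real q * cnj (of_real q) = complex_of_real N"
    using q by (simp add: of_real_mult[symmetric] del: of_real_mult)
  have sqn: "sqrt (real n) = q" by (simp add: q_def N_def)
  have uu: "u j * cnj (u j) = of_real (?C j * (1 - real j)\<^sup>2 * t ^ j)" for j
  proof -
    have "u j * cnj (u j) = (c j * cnj (c j)) * (1 - of_nat j)\<^sup>2 * (z ^ j * cnj (z ^ j))"
      by (simp add: u_def power2_eq_square)
    then show ?thesis unfolding cc zz by simp
  qed
  have vu: "v j * cnj (u j) = of_real (- (?C j * (real j * (real j - 1)) * t ^ (j - 1)) / q) * cnj z" for j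
  proof (cases j)
    case (Suc i)
    have "v j * cnj (u j) = (c j * cnj (c j)) * of_nat j * (1 - of_nat j) * (z ^ i * cnj (z ^ i)) * cnj z / of_real q"
      by (simp add: u_def v_def sqn Suc)
    then show ?thesis unfolding cc zz by (simp add: Suc algebra_simps)
  qed (simp add: v_def)
  have wu: "w j * cnj (u j) = of_real (- (?C j * (real j * (real j - 1)\<^sup>2) * t ^ (j - 2)) / q) * (cnj z)\<^sup>2" for j
  proof (cases "j < 2")
    case False
    then obtain i where i: "j = i + 2" by (metis add.commute le_Suc_ex not_less)
    have "w j * cnj (u j) = (c j * cnj (c j)) * of_nat j * (of_nat j - 1) * (1 - of_nat j) * (z ^ i * cnj (z ^ i)) * (cnj z)\<^sup>2 / of_real q"
      by (simp add: u_def w_def sqn i power_add power2_eq_square)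
    then show ?thesis unfolding cc zz by (simp add: i power2_eq_square algebra_simps)
  qed (auto simp: w_def less_2_cases_iff)
  have vv: "v j * cnj (v j) = of_real (?C j * (real j)\<^sup>2 * t ^ (j - 1) / N)" for j
  proof -
    have "v j * cnj (v j) = (c j * cnj (c j)) * (of_nat j)\<^sup>2 * (z ^ (j - 1) * cnj (z ^ (j - 1))) / (of_real q * cnj (of_real q))"
      by (simp add: v_def sqn power2_eq_square)
    then show ?thesis unfolding cc zz qq by simp
  qed
  have wv: "w j * cnj (v j) = of_real (?C j * ((real j)\<^sup>2 * (real j - 1)) * t ^ (j - 2) / N) * cnj z" for j
  proof (cases "j < 2")
    case False
    then obtain i where i: "j = i + 2" by (metis add.commute le_Suc_ex not_less)
    have "w j * cnj (v j) = (c j * cnj (c j)) * (of_nat j)\<^sup>2 * (of_nat j - 1) * (z ^ i * cnj (z ^ i)) * cnj z / (of_real q * cnj (of_real q))"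
      by (simp add: v_def w_def sqn i power_add power2_eq_square)
    then show ?thesis unfolding cc zz qq by (simp add: i power2_eq_square algebra_simps)
  qed (auto simp: w_def less_2_cases_iff)
  have ww: "w j * cnj (w j) = of_real (?C j * ((real j)\<^sup>2 * (real j - 1)\<^sup>2) * t ^ (j - 2) / N)" for j
  proof -
    have "w j * cnj (w j) = (c j * cnj (c j)) * (of_nat j)\<^sup>2 * (of_nat j - 1)\<^sup>2 * (z ^ (j - 2) * cnj (z ^ (j - 2))) / (of_real q * cnj (of_real q))"
      by (simp add: w_def sqn power2_eq_square)
    then show ?thesis unfolding cc zz qq by simp
  qed
  \<comment> \<open>The removed index 1 contributes 0 to every sum except that of
    \<open>v j * cnj (v j)\<close>, where it contributes exactly 1. Hence the entry
    \<open>V - 1\<close> below, which the 1 in \<open>s\<close> completes to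
    \<open>V\<close>.\<close>
  have full: "(\<Sum>j\<in>I. f j) = (\<Sum>j\<le>n. f j) - f 1" for f :: "nat \<Rightarrow> real"
    unfolding I_def using n by (subst sum_diff1) auto
  note sums = SU2_gram_sums[OF t n, folded T_def E_def N_def]
  have gram: "(\<Sum>j\<in>I. u j * cnj (u j)) = of_real A"
    "(\<Sum>j\<in>I. v j * cnj (u j)) = cnj z * of_real b"
    "(\<Sum>j\<in>I. v j * cnj (v j)) = of_real (V - 1)"
    "(\<Sum>j\<in>I. w j * cnj (u j)) = (cnj z)\<^sup>2 * of_real d"
    "(\<Sum>j\<in>I. w j * cnj (v j)) = cnj z * of_real e"
    "(\<Sum>j\<in>I. w j * cnj (w j)) = of_real W"
    unfolding uu vu vv wu wv ww sum_distrib_right[symmetric] of_real_sum[symmetric] full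
      sum_divide_distrib[symmetric] sum_negf sums
    using N n by (simp_all add: A_def b_def S2_def V_def d_def S4_def e_def W_def N_def[symmetric])
      (simp add: diff_divide_distrib)
  have finI: "finite I" by (simp add: I_def)
  obtain \<alpha> \<beta> \<gamma> \<delta> \<epsilon> \<zeta> where
    "\<alpha> * cnj \<alpha> = (\<Sum>j\<in>I. u j * cnj (u j))"
    "\<beta> * cnj \<alpha> = (\<Sum>j\<in>I. v j * cnj (u j))"
    "\<beta> * cnj \<beta> + \<gamma> * cnj \<gamma> = (\<Sum>j\<in>I. v j * cnj (v j))"
    "\<delta> * cnj \<alpha> = (\<Sum>j\<in>I. w j * cnj (u j))"
    "\<delta> * cnj \<beta> + \<epsilon> * cnj \<gamma> = (\<Sum>j\<in>I. w j * cnj (v j))"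
    "\<delta> * cnj \<delta> + \<epsilon> * cnj \<epsilon> + \<zeta> * cnj \<zeta> = (\<Sum>j\<in>I. w j * cnj (w j))"
    and law: "\<forall>H \<in> borel_measurable (borel \<Otimes>\<^sub>M (borel \<Otimes>\<^sub>M borel)).
      (\<integral>\<^sup>+x. H (\<Sum>j\<in>I. u j * x j, \<Sum>j\<in>I. v j * x j, \<Sum>j\<in>I. w j * x j) \<partial>PiM I (\<lambda>_. cgauss))
      = (\<integral>\<^sup>+x. \<integral>\<^sup>+y. \<integral>\<^sup>+z. H (\<alpha> * x, \<beta> * x + \<gamma> * y, \<delta> * x + \<epsilon> * y + \<zeta> * z) \<partial>cgauss \<partial>cgauss \<partial>cgauss)"
    using nn_integral_gaussian_linear_forms[OF finI, of u v w] by blast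
  note chol = this(1-6)[unfolded gram]
  \<comment> \<open>The constant coefficient alone contributes 1, so the first form never
    degenerates, even at \<open>z = 0\<close>.\<close>
  have "A \<ge> 1"
  proof -
    have "(\<Sum>j\<in>{0}. ?C j * (1 - real j)\<^sup>2 * t ^ j) \<le> (\<Sum>j\<le>n. ?C j * (1 - real j)\<^sup>2 * t ^ j)"
      using t by (intro sum_mono2) auto
    then show ?thesis unfolding sums A_def by simp
  qed
  then have A: "A > 0" by simp
  note schur = cholesky_schur_complement[OF chol A, folded t_def]
  note red = SU2_gram_reduction[OF t _ E, of N, folded T_def, folded A_def S2_def V_def S4_def e_def W_def,
      folded q_def, folded b_def d_def]
  have \<alpha>: "\<alpha> \<noteq> 0" using schur(1) A by auto
  define s where "s = 1 + (cmod \<gamma>)\<^sup>2"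
  define H where "H = (\<lambda>(a, b', c'). \<phi> (cmod a) * ennreal ((cmod c')\<^sup>2) * standard_complex_gaussian_density b')"
  have H: "H \<in> borel_measurable (borel \<Otimes>\<^sub>M (borel \<Otimes>\<^sub>M borel))"
    unfolding H_def by measurable
  have D: "V * A - t * b\<^sup>2 = E\<^sup>2 / T\<^sup>2" using red(1) N by simp
  have sA: "s * A = E\<^sup>2 / T\<^sup>2" using schur(3) unfolding D s_def .
  have cc': "(cmod (\<delta> - \<epsilon> * cnj \<gamma> * \<beta> / of_real s))\<^sup>2 / A = N * (N - 1)\<^sup>2 * t\<^sup>2 / T ^ 4"
    using schur(4) red(2) N unfolding D s_def by simp
  have LL: "(cmod \<epsilon>)\<^sup>2 / s + (cmod \<zeta>)\<^sup>2 = 2 * (N - 1) * E / T ^ 4"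
  proof -
    have N0: "N > 0" using N by simp
    have "E\<^sup>2 / T\<^sup>2 \<noteq> 0" using E T by simp
    then have "(cmod \<epsilon>)\<^sup>2 / s + (cmod \<zeta>)\<^sup>2
        = (W * (E\<^sup>2 / T\<^sup>2) - t\<^sup>2 * d\<^sup>2 * V - t * A * e\<^sup>2 + 2 * t\<^sup>2 * e * d * b) / (E\<^sup>2 / T\<^sup>2)"
      using schur(5)[unfolded D] unfolding s_def by (subst nonzero_eq_divide_eq)
    then show ?thesis unfolding red(3)[OF N0] .
  qed
  have VV: "V / (s * A) = (1 + N * t) / E"
    unfolding sA V_def using E T by (simp add: power2_eq_square)
  have "(\<integral>\<^sup>+x. \<phi> (cmod (\<Sum>j\<in>I. u j * x j)) * ennreal ((cmod (\<Sum>j\<in>I. w j * x j))\<^sup>2)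
            * standard_complex_gaussian_density (\<Sum>j\<in>I. v j * x j) \<partial>PiM I (\<lambda>_. cgauss))
     = (\<integral>\<^sup>+x. \<integral>\<^sup>+y. \<integral>\<^sup>+z. \<phi> (cmod (\<alpha> * x)) * ennreal ((cmod (\<delta> * x + \<epsilon> * y + \<zeta> * z))\<^sup>2)
            * standard_complex_gaussian_density (\<beta> * x + \<gamma> * y) \<partial>cgauss \<partial>cgauss \<partial>cgauss)"
    using bspec[OF law H] by (simp add: H_def)
  also have "\<dots> = (\<integral>\<^sup>+r\<in>{0..}. \<phi> r * ennreal (2 * r / (pi * (s * A)) * exp (- (r\<^sup>2 * (V / (s * A))))
          * (N * (N - 1)\<^sup>2 * t\<^sup>2 / T ^ 4 * r\<^sup>2 + 2 * (N - 1) * E / T ^ 4)) \<partial>lborel)"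
    using nn_integral_triangular_gaussian[of \<phi> \<alpha> \<delta> \<epsilon> \<zeta> \<beta> \<gamma>, OF _ \<alpha>]
    unfolding schur(1,2) s_def[symmetric] cc' LL schur(2)[folded s_def] by simp
  also have "\<dots> = (\<integral>\<^sup>+r\<in>{0..}. \<phi> r * ennreal (critical_kernel n t r) \<partial>lborel)"
  proof -
    have "2 * r / (pi * (s * A)) * exp (- (r\<^sup>2 * (V / (s * A))))
          * (N * (N - 1)\<^sup>2 * t\<^sup>2 / T ^ 4 * r\<^sup>2 + 2 * (N - 1) * E / T ^ 4) = critical_kernel n t r" for r
      unfolding critical_kernel_def VV unfolding sA T_def E_def N_def by simp
    then show ?thesis by simp
  qed
  finally show ?thesis unfolding t_def .
qed

section \<open>The density and its limit\<close>

definition critical_integrand :: "nat \<Rightarrow> real \<Rightarrow> real \<Rightarrow> real" where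
  "critical_integrand n x t = (real n * (real n - 1) * t\<^sup>2 * x\<^sup>2 + 2 * (1 + t) ^ n) / (1 + t) ^ (2 * n + 2)
        * exp (- (x\<^sup>2 * ((1 + real n * t) / (1 + t) ^ n)))"

definition critical_density :: "nat \<Rightarrow> real \<Rightarrow> real" where
  "critical_density n x = 2 * x * (real n - 1) * (LBINT t:{0..}. critical_integrand n x t)"

lemma critical_integrand_measurable [measurable]: "critical_integrand n x \<in> borel_measurable borel"
  unfolding critical_integrand_def[abs_def] by measurable

lemma critical_kernel_eq:
  assumes "t \<ge> 0"
  shows "pi * critical_kernel n t x = 2 * x * (real n - 1) * critical_integrand n x t"
proof -
  have T: "1 + t > 0" using assms by simp
  have e: "real n * (real n - 1)\<^sup>2 * t\<^sup>2 / (1 + t) ^ 4 * x\<^sup>2 + 2 * (real n - 1) * (1 + t) ^ n / (1 + t) ^ 4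
    = (real n - 1) * (real n * (real n - 1) * t\<^sup>2 * x\<^sup>2 + 2 * (1 + t) ^ n) / (1 + t) ^ 4"
    by (simp add: add_divide_distrib[symmetric] power2_eq_square) (simp add: algebra_simps)
  have p: "(1 + t) ^ (2 * n + 2) = ((1 + t) ^ n)\<^sup>2 * (1 + t)\<^sup>2"
    by (simp add: power_add power_mult power2_eq_square algebra_simps power_mult_distrib)
  have q: "(1 + t)\<^sup>2 / ((1 + t) ^ n)\<^sup>2 / (1 + t) ^ 4 = 1 / (((1 + t) ^ n)\<^sup>2 * (1 + t)\<^sup>2)"
    using T by (simp add: eval_nat_numeral)
  have "pi * critical_kernel n t x = 2 * x * ((1 + t)\<^sup>2 / ((1 + t) ^ n)\<^sup>2 / (1 + t) ^ 4)
      * ((real n - 1) * (real n * (real n - 1) * t\<^sup>2 * x\<^sup>2 + 2 * (1 + t) ^ n))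
      * exp (- (x\<^sup>2 * ((1 + real n * t) / (1 + t) ^ n)))"
    unfolding critical_kernel_def e by simp
  then show ?thesis unfolding q p critical_integrand_def by simp
qed

text \<open>A single term of the binomial expansion is at most the whole. It bounds the quadratic
  part of the numerator and, at \<open>t = r / n\<close>, yields decay of order
  \<open>1 / r^2\<close> uniformly in \<open>n\<close>.\<close>

lemma choose_two_le_power:
  assumes "t \<ge> (0::real)"
  shows "real n * (real n - 1) * t\<^sup>2 \<le> 2 * (1 + t) ^ n"
proof -
  have "real (n choose 2) * t\<^sup>2 \<le> (1 + t) ^ n"
  proof (cases "n \<ge> 2")
    case True
    have "(\<Sum>j\<in>{2}. real (n choose j) * t ^ j) \<le> (\<Sum>j\<le>n. real (n choose j) * t ^ j)"
      using True assms by (intro sum_mono2) auto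
    also have "\<dots> = (1 + t) ^ n"
      using binomial_ring[of t 1 n] by (simp add: add.commute)
    finally show ?thesis by simp
  next
    case False
    then have c0: "n choose 2 = 0" by (simp add: binomial_eq_0)
    show ?thesis unfolding c0 using assms by simp
  qed
  then show ?thesis by (simp add: real_choose_2)
qed

lemma critical_integrand_bounds:
  assumes t: "t \<ge> 0" and n: "n \<ge> 2"
  shows "0 \<le> critical_integrand n x t" "critical_integrand n x t \<le> 2 * (x\<^sup>2 + 1) / (1 + t) ^ (n + 2)"
proof -
  have T: "1 + t > 0" using t by simp
  show 0: "0 \<le> critical_integrand n x t"
    unfolding critical_integrand_def
    using t n by (intro mult_nonneg_nonneg divide_nonneg_nonneg add_nonneg_nonneg) auto
  have "real n * (real n - 1) * t\<^sup>2 * x\<^sup>2 \<le> 2 * (1 + t) ^ n * x\<^sup>2"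
    using choose_two_le_power[OF t, of n] by (rule mult_right_mono) simp
  then have "(real n * (real n - 1) * t\<^sup>2 * x\<^sup>2 + 2 * (1 + t) ^ n) / (1 + t) ^ (2 * n + 2)
      \<le> (2 * (x\<^sup>2 + 1) * (1 + t) ^ n) / (1 + t) ^ (2 * n + 2)"
    using T by (intro divide_right_mono zero_le_power) (simp_all add: algebra_simps)
  also have "\<dots> = 2 * (x\<^sup>2 + 1) / (1 + t) ^ (n + 2)"
  proof -
    have "(1 + t) ^ (2 * n + 2) = (1 + t) ^ n * (1 + t) ^ (n + 2)"
      by (simp add: power_add[symmetric] mult_2)
    then show ?thesis using T by simp
  qed
  finally have 1: "(real n * (real n - 1) * t\<^sup>2 * x\<^sup>2 + 2 * (1 + t) ^ n) / (1 + t) ^ (2 * n + 2)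
     \<le> 2 * (x\<^sup>2 + 1) / (1 + t) ^ (n + 2)" .
  have "critical_integrand n x t \<le> 2 * (x\<^sup>2 + 1) / (1 + t) ^ (n + 2) * 1"
    unfolding critical_integrand_def
    using 1 t n by (intro mult_mono) (auto intro!: divide_nonneg_nonneg add_nonneg_nonneg mult_nonneg_nonneg)
  then show "critical_integrand n x t \<le> 2 * (x\<^sup>2 + 1) / (1 + t) ^ (n + 2)" by simp
qed

lemma set_integrable_inverse_square_Ici: "set_integrable lborel {0..} (\<lambda>t::real. 1 / (1 + t\<^sup>2))"
proof -
  have "set_integrable lborel (einterval (-\<infinity>) \<infinity>) (\<lambda>x::real. inverse (1 + x^2))"
    by (rule integrable_inverse_1_plus_square)
  then have "set_integrable lborel {0..} (\<lambda>x::real. inverse (1 + x^2))"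
    by (rule set_integrable_subset) auto
  then show ?thesis by (simp add: inverse_eq_divide)
qed

lemma critical_integrand_le_inverse_square:
  assumes "t \<ge> 0" "n \<ge> 2"
  shows "critical_integrand n x t \<le> 2 * (x\<^sup>2 + 1) * (1 / (1 + t\<^sup>2))"
proof -
  have "1 + t\<^sup>2 \<le> (1 + t) ^ 2" using assms by (simp add: power2_eq_square algebra_simps)
  also have "\<dots> \<le> (1 + t) ^ (n + 2)" using assms by (intro power_increasing) auto
  finally have "1 / (1 + t) ^ (n + 2) \<le> 1 / (1 + t\<^sup>2)"
    using assms by (intro divide_left_mono) (auto simp: add_pos_nonneg)
  then have "2 * (x\<^sup>2 + 1) * (1 / (1 + t) ^ (n + 2)) \<le> 2 * (x\<^sup>2 + 1) * (1 / (1 + t\<^sup>2))"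
    by (intro mult_left_mono) auto
  then show ?thesis using critical_integrand_bounds(2)[OF assms, of x] by simp
qed

lemma set_integrable_critical_integrand:
  assumes "n \<ge> 2"
  shows "set_integrable lborel {0..} (critical_integrand n x)"
proof (rule set_integrable_bound)
  show "set_integrable lborel {0..} (\<lambda>t::real. 2 * (x\<^sup>2 + 1) * (1 / (1 + t\<^sup>2)))"
    using set_integrable_inverse_square_Ici by (rule set_integrable_mult_right)
  show "AE t in lborel. t \<in> {0..} \<longrightarrow> norm (critical_integrand n x t) \<le> norm (2 * (x\<^sup>2 + 1) * (1 / (1 + t\<^sup>2)))"
    using critical_integrand_bounds(1)[OF _ assms] critical_integrand_le_inverse_square[OF _ assms]
    by (intro always_eventually allI impI) (simp add: abs_of_nonneg)
qed (auto simp: set_borel_measurable_def)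

lemma continuous_on_critical_density:
  assumes n: "n \<ge> 2"
  shows "continuous_on UNIV (critical_density n)"
proof -
  let ?c = "\<lambda>x t. indicator {0..} t *\<^sub>R critical_integrand n x t"
  let ?d = "\<lambda>K t. 2 * (K\<^sup>2 + 1) * (1 / (1 + t\<^sup>2))"
  have "isCont (\<lambda>x. LBINT t:{0..}. critical_integrand n x t) x" for x
    unfolding continuous_within_sequentially set_lebesgue_integral_def comp_def
  proof (intro allI impI, elim conjE)
    fix X :: "nat \<Rightarrow> real" assume X: "X \<longlonglongrightarrow> x"
    \<comment> \<open>A convergent sequence is bounded, and the majorant grows with
      \<open>|x|\<close>, so its value at the bound \<open>K\<close> dominates the whole
      sequence.\<close>
    obtain K where K: "\<And>i. \<bar>X i\<bar> \<le> K"
      using convergent_imp_Bseq[OF convergentI[OF X]] by (auto simp: Bseq_def)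
    show "(\<lambda>i. \<integral>t. ?c (X i) t \<partial>lborel)
        \<longlonglongrightarrow> (\<integral>t. ?c x t \<partial>lborel)"
    proof (rule integral_dominated_convergence)
      show "integrable lborel (\<lambda>t. indicator {0..} t *\<^sub>R ?d K t)"
        using set_integrable_mult_right[OF set_integrable_inverse_square_Ici, of "2 * (K\<^sup>2 + 1)"]
        by (simp add: set_integrable_def)
      show "AE t in lborel. (\<lambda>i. ?c (X i) t)
          \<longlonglongrightarrow> ?c x t"
      proof (intro always_eventually allI)
        fix t :: real
        show "(\<lambda>i. ?c (X i) t)
          \<longlonglongrightarrow> ?c x t"
        proof (cases "t \<ge> 0")
          case True
          then show ?thesis unfolding critical_integrand_def by (auto intro!: tendsto_intros X)
        qed simp
      qed
      show "AE t in lborel. norm (?c (X i) t)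
          \<le> indicator {0..} t *\<^sub>R ?d K t" for i
      proof (intro always_eventually allI)
        fix t :: real
        show "norm (?c (X i) t)
          \<le> indicator {0..} t *\<^sub>R ?d K t"
        proof (cases "t \<ge> 0")
          case True
          have "(X i)\<^sup>2 \<le> K\<^sup>2" using power_mono[OF K, of i 2] by simp
          then have "2 * ((X i)\<^sup>2 + 1) * (1 / (1 + t\<^sup>2)) \<le> ?d K t"
            by (intro mult_right_mono) (auto simp: add_nonneg_nonneg)
          then have "critical_integrand n (X i) t \<le> ?d K t"
            using critical_integrand_le_inverse_square[OF True n, of "X i"] by linarith
          then show ?thesis
            using critical_integrand_bounds(1)[OF True n, of "X i"] True by (simp add: abs_of_nonneg)
        qed simp
      qed
    qed auto
  qed
  then show ?thesis
    unfolding critical_density_def[abs_def]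
    by (intro continuous_intros) (simp add: continuous_on_eq_continuous_within)
qed

section \<open>The limit under the scaling t = r / n\<close>

definition limit_integrand :: "real \<Rightarrow> real \<Rightarrow> real" where
  "limit_integrand x r = (r\<^sup>2 * x\<^sup>2 * exp (- r) * exp (- r) + 2 * exp (- r)) * exp (- (x\<^sup>2 * ((1 + r) * exp (- r))))"

lemma limit_integrand_nonneg: "0 \<le> limit_integrand x r"
  by (simp add: limit_integrand_def)

text \<open>A majorant independent of \<open>n\<close>. For \<open>n \<ge> 2\<close> half of
  \<open>r\<^sup>2\<close> is at most \<open>(1 - 1 / n) * r\<^sup>2\<close>, hence at most
  \<open>2 * P\<close>; with \<open>1 \<le> P\<close> this gives
  \<open>1 + r\<^sup>2 \<le> 5 * P\<close>, the origin of the 5.\<close>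

lemma inverse_power_scaled_le:
  fixes r :: real
  assumes "r \<ge> 0" "n \<ge> 2"
  shows "1 / (1 + r / n) ^ (n + 2) \<le> 5 * (1 / (1 + r\<^sup>2))"
proof -
  have n: "real n \<ge> 2" using assms by simp
  define P where "P = (1 + r / n) ^ (n + 2)"
  have "real n * (real n - 1) * (r / n)\<^sup>2 \<le> 2 * (1 + r / n) ^ n"
    using assms by (intro choose_two_le_power) simp
  moreover have "(1 + r / n) ^ n \<le> P" unfolding P_def using assms by (intro power_increasing) auto
  moreover have "real n * (real n - 1) * (r / n)\<^sup>2 = (1 - 1 / n) * r\<^sup>2"
    using n by (simp add: power2_eq_square field_simps)
  moreover have "1 / 2 * r\<^sup>2 \<le> (1 - 1 / n) * r\<^sup>2"
    using n by (intro mult_right_mono) (auto simp: field_simps)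
  moreover have P: "1 \<le> P" unfolding P_def using assms by (intro one_le_power) simp
  ultimately have "1 + r\<^sup>2 \<le> 5 * P" by linarith
  then show ?thesis
    unfolding P_def[symmetric] using P by (simp add: field_simps add_pos_nonneg)
qed

lemma critical_integrand_tendsto:
  assumes r: "r \<ge> 0"
  shows "(\<lambda>n. critical_integrand n x (r / n)) \<longlonglongrightarrow> limit_integrand x r"
proof -
  have e: "(\<lambda>n. (1 + r / real n) ^ n) \<longlonglongrightarrow> exp r"
    by (rule tendsto_exp_limit_sequentially)
  have 1: "(\<lambda>n. 1 + r / real n) \<longlonglongrightarrow> 1" by real_asymp
  have "(\<lambda>n. (1 - 1 / real n) * r\<^sup>2) \<longlonglongrightarrow> (1 - 0) * r\<^sup>2"
    by (intro tendsto_intros lim_1_over_n)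
  then have lim2: "(\<lambda>n. (1 - 1 / real n) * r\<^sup>2) \<longlonglongrightarrow> r\<^sup>2" by simp
  have "\<forall>\<^sub>F n in sequentially. (1 - 1 / real n) * r\<^sup>2 = real n * (real n - 1) * (r / real n)\<^sup>2"
    using eventually_gt_at_top[of 0] by eventually_elim (simp add: power2_eq_square field_simps)
  then have 2: "(\<lambda>n. real n * (real n - 1) * (r / real n)\<^sup>2) \<longlonglongrightarrow> r\<^sup>2"
    by (rule Lim_transform_eventually[OF lim2])
  have 3: "\<forall>\<^sub>F n in sequentially. (r\<^sup>2 * 0 + (real n * (real n - 1) * (r / real n)\<^sup>2 * x\<^sup>2 + 2 * (1 + r / real n) ^ n) / (((1 + r / real n) ^ n)\<^sup>2 * (1 + r / real n)\<^sup>2))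
     * exp (- (x\<^sup>2 * ((1 + r) / (1 + r / real n) ^ n))) = critical_integrand n x (r / n)"
    using eventually_gt_at_top[of 0]
  proof eventually_elim
    case (elim n)
    have "(1 + r / real n) ^ (2 * n + 2) = ((1 + r / real n) ^ n)\<^sup>2 * (1 + r / real n)\<^sup>2"
      by (simp only: power_add power_mult[symmetric] mult.commute)
    then show ?case using elim by (simp add: critical_integrand_def)
  qed
  have "(\<lambda>n. (r\<^sup>2 * 0 + (real n * (real n - 1) * (r / real n)\<^sup>2 * x\<^sup>2 + 2 * (1 + r / real n) ^ n) / (((1 + r / real n) ^ n)\<^sup>2 * (1 + r / real n)\<^sup>2))
     * exp (- (x\<^sup>2 * ((1 + r) / (1 + r / real n) ^ n))))
    \<longlonglongrightarrow> (r\<^sup>2 * 0 + (r\<^sup>2 * x\<^sup>2 + 2 * exp r) / ((exp r)\<^sup>2 * 1\<^sup>2)) * exp (- (x\<^sup>2 * ((1 + r) / exp r)))"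
    by (intro tendsto_intros 1 2 e) auto
  also have "(r\<^sup>2 * 0 + (r\<^sup>2 * x\<^sup>2 + 2 * exp r) / ((exp r)\<^sup>2 * 1\<^sup>2)) * exp (- (x\<^sup>2 * ((1 + r) / exp r))) = limit_integrand x r"
    by (simp add: limit_integrand_def exp_minus power2_eq_square field_simps)
  finally show ?thesis by (rule Lim_transform_eventually[OF _ 3])
qed

lemma critical_density_tendsto:
  "(\<lambda>n. critical_density n x) \<longlonglongrightarrow> 2 * x * (LBINT r:{0..}. limit_integrand x r)"
proof -
  let ?b = "\<lambda>r. 10 * (x\<^sup>2 + 1) * (1 / (1 + r\<^sup>2))"
  let ?l = "\<lambda>r. indicator {0..} r *\<^sub>R limit_integrand x r"
  \<comment> \<open>The integrand after \<open>t = r / n\<close>. The limit is taken along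
    \<open>i + 2\<close> because the bounds require an index of at least 2.\<close>
  define f where "f n r = indicator {0..} r *\<^sub>R critical_integrand n x (r / n)" for n r
  have lim: "(\<lambda>i. \<integral>r. f (i + 2) r \<partial>lborel) \<longlonglongrightarrow> (\<integral>r. ?l r \<partial>lborel)"
  proof (rule integral_dominated_convergence)
    show "(\<lambda>r. ?l r) \<in> borel_measurable lborel"
      unfolding limit_integrand_def by measurable
    show "f (i + 2) \<in> borel_measurable lborel" for i unfolding f_def by measurable
    show "integrable lborel (\<lambda>r. indicator {0..} r *\<^sub>R ?b r)"
      using set_integrable_mult_right[OF set_integrable_inverse_square_Ici, of "10 * (x\<^sup>2 + 1)"]
      by (simp add: set_integrable_def)
    show "AE r in lborel. (\<lambda>i. f (i + 2) r) \<longlonglongrightarrow> ?l r"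
    proof (intro always_eventually allI)
      fix r :: real
      show "(\<lambda>i. f (i + 2) r) \<longlonglongrightarrow> ?l r"
      proof (cases "r \<ge> 0")
        case True
        then have "(\<lambda>i. critical_integrand (i + 2) x (r / (i + 2))) \<longlonglongrightarrow> limit_integrand x r"
          using LIMSEQ_ignore_initial_segment[OF critical_integrand_tendsto[OF True, of x], of 2] by simp
        then show ?thesis using True by (simp add: f_def)
      qed (simp add: f_def)
    qed
    show "AE r in lborel. norm (f (i + 2) r) \<le> indicator {0..} r *\<^sub>R ?b r" for i
    proof (intro always_eventually allI)
      fix r :: real
      show "norm (f (i + 2) r) \<le> indicator {0..} r *\<^sub>R ?b r"
      proof (cases "r \<ge> 0")
        case True
        have n: "i + 2 \<ge> 2" by simp
        have rn: "r / real (i + 2) \<ge> 0" using True by simp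
        have "critical_integrand (i + 2) x (r / real (i + 2)) \<le> 2 * (x\<^sup>2 + 1) * (1 / (1 + r / real (i + 2)) ^ (i + 2 + 2))"
          using critical_integrand_bounds(2)[OF rn n, of x] by simp
        also have "\<dots> \<le> 2 * (x\<^sup>2 + 1) * (5 * (1 / (1 + r\<^sup>2)))"
          using inverse_power_scaled_le[OF True n] by (intro mult_left_mono) auto
        finally show ?thesis
          using critical_integrand_bounds(1)[OF rn n, of x] True
          by (simp add: f_def abs_of_nonneg)
      qed (simp add: f_def)
    qed
  qed
  \<comment> \<open>The substitution contributes \<open>1 / n\<close>, which turns the prefactor
    \<open>n - 1\<close> into a ratio tending to 1.\<close>
  have scale: "critical_density (i + 2) x = 2 * x * ((real (i + 2) - 1) / real (i + 2)) * (\<integral>r. f (i + 2) r \<partial>lborel)" for i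
  proof -
    define n where "n = i + 2"
    have n: "real n > 0" by (simp add: n_def)
    have "(LBINT t:{0..}. critical_integrand n x t)
       = \<bar>1 / real n\<bar> *\<^sub>R (\<integral>r. indicator {0..} (0 + 1 / real n * r) *\<^sub>R critical_integrand n x (0 + 1 / real n * r) \<partial>lborel)"
      unfolding set_lebesgue_integral_def using n by (intro lborel_integral_real_affine) simp
    also have "(\<lambda>r. indicator {0..} (0 + 1 / real n * r) *\<^sub>R critical_integrand n x (0 + 1 / real n * r)) = f n"
      using n by (auto simp: f_def fun_eq_iff indicator_def zero_le_divide_iff)
    finally show ?thesis
      unfolding n_def[symmetric] critical_density_def using n by simp
  qed
  have "(\<lambda>i. 2 * x * ((real (i + 2) - 1) / real (i + 2)) * (\<integral>r. f (i + 2) r \<partial>lborel))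
    \<longlonglongrightarrow> 2 * x * 1 * (\<integral>r. ?l r \<partial>lborel)"
  proof (intro tendsto_mult tendsto_const lim)
    show "(\<lambda>i. (real (i + 2) - 1) / real (i + 2)) \<longlonglongrightarrow> 1" by real_asymp
  qed
  then have "(\<lambda>i. critical_density (i + 2) x) \<longlonglongrightarrow> 2 * x * (LBINT r:{0..}. limit_integrand x r)"
    unfolding scale set_lebesgue_integral_def by simp
  then show ?thesis by (rule LIMSEQ_offset)
qed

lemma tendsto_mult_ln_at_right_0: "((\<lambda>s::real. s * ln s) \<longlongrightarrow> 0) (at_right 0)"
  by real_asymp

text \<open>The value at 0 is 0 whatever \<open>ln 0\<close> is, which is the convention
  \<open>s log s = 0\<close>; continuity there is the limit from the right.\<close>

lemma continuous_on_mult_ln: "continuous_on {0..} (\<lambda>s::real. s * ln s)"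
proof (unfold continuous_on_def, intro ballI)
  fix s :: real assume "s \<in> {0..}"
  then consider "s = 0" | "s > 0" by fastforce
  then show "((\<lambda>s. s * ln s) \<longlongrightarrow> s * ln s) (at s within {0..})"
  proof cases
    case 1
    have "at (0::real) within {0..} = at_right 0"
      by (rule at_within_nhd[of _ UNIV]) (auto simp: greaterThan_def)
    then show ?thesis using tendsto_mult_ln_at_right_0 1 by simp
  next
    case 2
    then have "isCont (\<lambda>s. s * ln s) s" by (intro continuous_intros) auto
    then show ?thesis
      unfolding isCont_def by (rule tendsto_within_subset) simp
  qed
qed

text \<open>Both the integration by parts and the substitution \<open>s = exp (- r)\<close> are contained in the
  antiderivative \<open>G\<close>.\<close>

lemma integral_limit_integrand:
  assumes x: "x > 0"
  shows "(LBINT r:{0..}. limit_integrand x r)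
    = (1 - exp (- x\<^sup>2)) / x\<^sup>2 + (LBINT s:{0..1}. exp (- ((s - s * ln s) * x\<^sup>2)))"
proof -
  define F where "F s = exp (- ((s - s * ln s) * x\<^sup>2))" for s :: real
  define \<Phi> where "\<Phi> s = integral {0..s} F" for s
  \<comment> \<open>The interval reaches beyond 1 so that \<open>s = exp 0 = 1\<close> is an
    interior point and the primitive has a two-sided derivative also at
    \<open>r = 0\<close>.\<close>
  have contF: "continuous_on {0..2} F"
  proof -
    have "continuous_on {0..2} (\<lambda>s::real. s * ln s)"
      using continuous_on_mult_ln by (rule continuous_on_subset) auto
    then have "continuous_on {0..2} (\<lambda>s::real. s - s * ln s)"
      by (intro continuous_on_diff continuous_on_id)
    then show ?thesis unfolding F_def
      by (intro continuous_on_exp continuous_on_minus continuous_on_mult continuous_on_const)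
  qed
  have der\<Phi>: "(\<Phi> has_real_derivative F s) (at s)" if "0 < s" "s < 2" for s
  proof -
    have "(\<Phi> has_real_derivative F s) (at s within {0..2})"
      unfolding \<Phi>_def using that by (intro integral_has_real_derivative contF) auto
    moreover have "at s within {0..2} = at s"
      using that by (intro at_within_interior) auto
    ultimately show ?thesis by simp
  qed
  have \<Phi>0: "(\<Phi> \<longlongrightarrow> 0) (at_right 0)"
  proof -
    have "continuous_on {0..2} \<Phi>"
      unfolding \<Phi>_def by (intro indefinite_integral_continuous_1 integrable_continuous_interval contF)
    then have "(\<Phi> \<longlongrightarrow> \<Phi> 0) (at 0 within {0..2})" by (simp add: continuous_on_def)
    moreover have "at (0::real) within {0..2} = at_right 0"
      by (rule at_within_nhd[of _ "{..<2}"]) auto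
    ultimately show ?thesis by (simp add: \<Phi>_def)
  qed
  define Ee where "Ee r = exp (- (x\<^sup>2 * ((1 + r) * exp (- r))))" for r
  \<comment> \<open>The second and third summands have derivatives
    \<open>r * exp (- r) * Ee r\<close> and \<open>exp (- r) * Ee r\<close>. The product rule for
    the first adds \<open>(1 - r) * exp (- r) * Ee r\<close> and the term with
    \<open>x\<^sup>2\<close>, so the terms linear in \<open>r\<close> cancel and
    \<open>2 * exp (- r)\<close> remains.\<close>
  define G where "G r = r * exp (- r) * Ee r + Ee r / x\<^sup>2 - \<Phi> (exp (- r))" for r
  have dE: "(Ee has_real_derivative x\<^sup>2 * (r * exp (- r)) * Ee r) (at r)" for r
    unfolding Ee_def by (auto intro!: derivative_eq_intros simp: algebra_simps)
  have dG: "(G has_real_derivative limit_integrand x r) (at r)" if r: "0 \<le> r" for r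
  proof -
    have s: "0 < exp (- r)" "exp (- r) < 2" using r by (simp_all add: order.strict_trans1[of _ 1])
    have d\<Phi>: "((\<lambda>r. \<Phi> (exp (- r))) has_real_derivative F (exp (- r)) * (exp (- r) * - 1)) (at r)"
      by (rule DERIV_chain2[where f = \<Phi> and g = "\<lambda>r. exp (- r)", OF der\<Phi>[OF s]])
        (auto intro!: derivative_eq_intros)
    have Fs: "F (exp (- r)) = Ee r" by (simp add: F_def Ee_def algebra_simps)
    have d1: "((\<lambda>r. r * exp (- r)) has_real_derivative exp (- r) - r * exp (- r)) (at r)"
      by (auto intro!: derivative_eq_intros)
    have "(G has_real_derivative (exp (- r) - r * exp (- r)) * Ee r + x\<^sup>2 * (r * exp (- r)) * Ee r * (r * exp (- r))
        + x\<^sup>2 * (r * exp (- r)) * Ee r / x\<^sup>2 - F (exp (- r)) * (exp (- r) * - 1)) (at r)"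
      unfolding G_def[abs_def] by (intro DERIV_diff DERIV_add DERIV_mult DERIV_cdivide dE d\<Phi> d1)
    moreover have "(exp (- r) - r * exp (- r)) * Ee r + x\<^sup>2 * (r * exp (- r)) * Ee r * (r * exp (- r))
        + x\<^sup>2 * (r * exp (- r)) * Ee r / x\<^sup>2 - F (exp (- r)) * (exp (- r) * - 1) = limit_integrand x r"
      unfolding Fs limit_integrand_def Ee_def[symmetric] using x by (simp add: power2_eq_square) (simp add: algebra_simps)
    ultimately show ?thesis by simp
  qed
  have limE: "(Ee \<longlongrightarrow> 1) at_top" unfolding Ee_def by real_asymp
  have "filterlim (\<lambda>r::real. exp (- r)) (at_right 0) at_top" by real_asymp
  then have lim\<Phi>: "((\<lambda>r. \<Phi> (exp (- r))) \<longlongrightarrow> 0) at_top"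
    by (rule filterlim_compose[OF \<Phi>0])
  have limr: "((\<lambda>r::real. r * exp (- r)) \<longlongrightarrow> 0) at_top" by real_asymp
  have limG: "(G \<longlongrightarrow> 0 * 1 + 1 / x\<^sup>2 - 0) at_top"
    unfolding G_def using x by (intro tendsto_intros limE lim\<Phi> limr) auto
  have [measurable]: "limit_integrand x \<in> borel_measurable borel"
    unfolding limit_integrand_def by measurable
  \<comment> \<open>\<open>G\<close> tends to \<open>1 / x\<^sup>2\<close> and
    \<open>G 0 = exp (- x\<^sup>2) / x\<^sup>2 - \<Phi> 1\<close>. The integrand is nonnegative, so
    the fundamental theorem applies on the whole half-line without prior integrability.\<close>
  have "(\<integral>\<^sup>+r. ennreal (limit_integrand x r) * indicator {0..} r \<partial>lborel) = ennreal (0 * 1 + 1 / x\<^sup>2 - 0 - G 0)"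
    by (rule nn_integral_FTC_atLeast[OF _ dG limit_integrand_nonneg limG]) auto
  also have "0 * 1 + 1 / x\<^sup>2 - 0 - G 0 = (1 - exp (- x\<^sup>2)) / x\<^sup>2 + \<Phi> 1"
    by (simp add: G_def Ee_def diff_divide_distrib)
  finally have nn: "(\<integral>\<^sup>+r. ennreal (limit_integrand x r) * indicator {0..} r \<partial>lborel)
      = ennreal ((1 - exp (- x\<^sup>2)) / x\<^sup>2 + \<Phi> 1)" .
  have "(LBINT r:{0..}. limit_integrand x r)
    = enn2real (\<integral>\<^sup>+r. ennreal (indicator {0..} r *\<^sub>R limit_integrand x r) \<partial>lborel)"
    unfolding set_lebesgue_integral_def
    by (rule integral_eq_nn_integral) (auto simp: limit_integrand_nonneg)
  also have "(\<integral>\<^sup>+r. ennreal (indicator {0..} r *\<^sub>R limit_integrand x r) \<partial>lborel)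
     = (\<integral>\<^sup>+r. ennreal (limit_integrand x r) * indicator {0..} r \<partial>lborel)"
    by (intro nn_integral_cong) (auto split: split_indicator)
  also have "enn2real \<dots> = (1 - exp (- x\<^sup>2)) / x\<^sup>2 + \<Phi> 1"
  proof -
    have "\<Phi> 1 \<ge> 0" unfolding \<Phi>_def F_def by (rule integral_nonneg)
      (use contF in \<open>auto simp: F_def intro!: integrable_continuous_interval intro: continuous_on_subset\<close>)
    then show ?thesis unfolding nn by (subst enn2real_ennreal) (auto intro!: add_nonneg_nonneg divide_nonneg_nonneg)
  qed
  also have "\<Phi> 1 = (LBINT s:{0..1}. exp (- ((s - s * ln s) * x\<^sup>2)))"
  proof -
    have "set_integrable lborel {0..1} F"
      by (rule borel_integrable_atLeastAtMost') (use contF in \<open>auto intro: continuous_on_subset\<close>)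
    then show ?thesis
      using set_borel_integral_eq_integral(2)[of "{0..1}" F] by (simp add: \<Phi>_def F_def)
  qed
  finally show ?thesis .
qed

text \<open>At \<open>x = 0\<close> division by zero yields 0, which agrees with the limiting value
  of the quotient, and both sides vanish.\<close>

lemma critical_density_tendsto_limit:
  assumes x: "x \<ge> 0"
  shows "(\<lambda>n. critical_density n x) \<longlonglongrightarrow>
    2 * ((1 - exp (- x\<^sup>2)) / x) + 2 * x * (LBINT s:{0..1}. exp (- ((s - s * ln s) * x\<^sup>2)))"
proof (cases "x = 0")
  case False
  then have "x > 0" using x by simp
  note integral_limit_integrand[OF this]
  moreover have "2 * x * ((1 - exp (- x\<^sup>2)) / x\<^sup>2) = 2 * ((1 - exp (- x\<^sup>2)) / x)"
    using False by (simp add: power2_eq_square)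
  ultimately show ?thesis using critical_density_tendsto[of x] by (simp only: distrib_left)
qed (simp add: critical_density_def)

section \<open>The Kac-Rice formula\<close>

lemma poly_SU2_poly:
  "poly (SU2_poly c n) z = (\<Sum>j\<le>n. c j * of_real (sqrt (real (n choose j))) * z ^ j)"
  by (simp add: SU2_poly_def poly_sum poly_monom)

lemma pderiv_SU2_poly:
  "pderiv (SU2_poly c n) = (\<Sum>j\<le>n. monom (of_nat j * (c j * of_real (sqrt (real (n choose j))))) (j - 1))"
  using higher_pderiv_sum[of 1 "\<lambda>j. monom (c j * of_real (sqrt (real (n choose j)))) j" "{..n}"]
  by (simp add: SU2_poly_def pderiv_monom)

lemma poly_pderiv_SU2_poly:
  "poly (pderiv (SU2_poly c n)) z
    = (\<Sum>j\<le>n. of_nat j * (c j * of_real (sqrt (real (n choose j)))) * z ^ (j - 1))"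
  by (simp add: pderiv_SU2_poly poly_sum poly_monom)

lemma poly_pderiv_pderiv_SU2_poly:
  "poly (pderiv (pderiv (SU2_poly c n))) z
    = (\<Sum>j\<le>n. of_nat (j - 1) * (of_nat j * (c j * of_real (sqrt (real (n choose j))))) * z ^ (j - 2))"
proof -
  have "pderiv (pderiv (SU2_poly c n))
      = (\<Sum>j\<le>n. monom (of_nat (j - 1) * (of_nat j * (c j * of_real (sqrt (real (n choose j)))))) (j - 2))"
    unfolding pderiv_SU2_poly
    using higher_pderiv_sum[of 1 "\<lambda>j. monom (of_nat j * (c j * of_real (sqrt (real (n choose j))))) (j - 1)" "{..n}"]
    by (simp add: pderiv_monom numeral_2_eq_2)
  then show ?thesis by (simp add: poly_sum poly_monom)
qed

text \<open>If \<open>p' = 0\<close>, the zero set is infinite and the sum is 0 by convention.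
  Replacing \<open>p'\<close> by the constant 1 there gives an empty zero set and the same sum, so
  that the zero set is always finite.\<close>

lemma critical_value_sum_measurable:
  fixes a :: "'w \<Rightarrow> nat \<Rightarrow> complex"
  assumes a: "\<And>j. j \<le> n \<Longrightarrow> (\<lambda>\<omega>. a \<omega> j) \<in> borel_measurable M" and \<psi>: "continuous_on UNIV \<psi>"
  shows "(\<lambda>\<omega>. critical_value_sum (SU2_poly (a \<omega>) n) \<psi>) \<in> borel_measurable M"
proof -
  define Q where "Q \<omega> z = poly (pderiv (SU2_poly (a \<omega>) n)) z" for \<omega> z
  define F where "F \<omega> z = \<psi> (cmod (poly (SU2_poly (a \<omega>) n) z))" for \<omega> z
  have Q_m [measurable]: "(\<lambda>\<omega>. Q \<omega> z) \<in> borel_measurable M" for z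
    unfolding Q_def poly_pderiv_SU2_poly using a
    by (intro borel_measurable_sum borel_measurable_times borel_measurable_const) auto
  have P_m: "(\<lambda>\<omega>. poly (SU2_poly (a \<omega>) n) z) \<in> borel_measurable M" for z
    unfolding poly_SU2_poly using a
    by (intro borel_measurable_sum borel_measurable_times borel_measurable_const) auto
  have [measurable]: "\<psi> \<in> borel_measurable borel"
    using \<psi> by (rule borel_measurable_continuous_onI)
  have F_m: "(\<lambda>\<omega>. F \<omega> z) \<in> borel_measurable M" for z
    unfolding F_def using P_m by measurable
  \<comment> \<open>A polynomial that vanishes at all natural numbers is 0, so the exceptional event
    is described by countably many conditions.\<close>
  define q where "q \<omega> z = (if \<forall>k::nat. Q \<omega> (of_nat k) = 0 then 1 else Q \<omega> z)" for \<omega> z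
  have zero: "(\<forall>k::nat. Q \<omega> (of_nat k) = 0) \<longleftrightarrow> pderiv (SU2_poly (a \<omega>) n) = 0" for \<omega>
  proof
    assume *: "\<forall>k::nat. Q \<omega> (of_nat k) = 0"
    show "pderiv (SU2_poly (a \<omega>) n) = 0"
    proof (rule ccontr)
      assume "pderiv (SU2_poly (a \<omega>) n) \<noteq> 0"
      then have "finite {z. poly (pderiv (SU2_poly (a \<omega>) n)) z = 0}" by (rule poly_roots_finite)
      then have "finite (range (of_nat :: nat \<Rightarrow> complex))"
        by (rule finite_subset[rotated]) (use * in \<open>auto simp: Q_def\<close>)
      then show False using finite_imageD[OF _ inj_of_nat] infinite_UNIV_nat by blast
    qed
  qed (simp add: Q_def)
  have "(\<lambda>\<omega>. \<Sum>z\<in>{z. q \<omega> z = 0}. F \<omega> z) \<in> borel_measurable M"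
  proof (rule borel_measurable_sum_zeros)
    show "(\<lambda>\<omega>. q \<omega> z) \<in> borel_measurable M" for z unfolding q_def by measurable
    show "(\<lambda>\<omega>. F \<omega> z) \<in> borel_measurable M" for z by (rule F_m)
    show "continuous_on UNIV (q \<omega>)" for \<omega>
    proof (cases "\<forall>k::nat. Q \<omega> (of_nat k) = 0")
      case True
      then have "q \<omega> = (\<lambda>_. 1)" by (auto simp: q_def fun_eq_iff)
      then show ?thesis by simp
    next
      case False
      then have "q \<omega> = poly (pderiv (SU2_poly (a \<omega>) n))" by (auto simp: q_def Q_def fun_eq_iff)
      then show ?thesis by (auto intro!: continuous_intros)
    qed
    show "continuous_on UNIV (F \<omega>)" for \<omega>
      unfolding F_def by (rule continuous_on_compose2[OF \<psi>]) (auto intro!: continuous_intros)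
    show "finite {z. q \<omega> z = 0}" for \<omega>
      using poly_roots_finite[of "pderiv (SU2_poly (a \<omega>) n)"]
      by (auto simp: q_def zero) (simp add: Q_def)
  qed
  also have "(\<lambda>\<omega>. \<Sum>z\<in>{z. q \<omega> z = 0}. F \<omega> z) = (\<lambda>\<omega>. critical_value_sum (SU2_poly (a \<omega>) n) \<psi>)"
  proof
    fix \<omega>
    show "(\<Sum>z\<in>{z. q \<omega> z = 0}. F \<omega> z) = critical_value_sum (SU2_poly (a \<omega>) n) \<psi>"
    proof (cases "pderiv (SU2_poly (a \<omega>) n) = 0")
      case True
      then show ?thesis by (simp add: q_def zero critical_value_sum_def infinite_UNIV_char_0)
    next
      case False
      then show ?thesis by (simp add: q_def zero critical_value_sum_def F_def) (simp add: Q_def)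
    qed
  qed
  finally show ?thesis .
qed

text \<open>With all other coefficients fixed, \<open>p'(z) = sqrt n * (y - q(z))\<close>, so the
  critical points form the fibre of \<open>q\<close> over \<open>y\<close> and the area formula
  applies. On this fibre the term \<open>r * y * z\<close> of \<open>p\<close> can be expressed by
  the other coefficients, which is where the factors \<open>1 - j\<close> arise.\<close>

lemma nn_integral_linear_coefficient:
  fixes x :: "nat \<Rightarrow> complex"
  assumes n: "n \<ge> 1" and \<psi>: "continuous_on UNIV \<psi>" "\<And>t. 0 \<le> \<psi> t"
  defines "I \<equiv> {..n} - {1}" and "c \<equiv> (\<lambda>j. complex_of_real (sqrt (real (n choose j))))"
  defines "u \<equiv> (\<lambda>z j. c j * (1 - of_nat j) * z ^ j)"
    and "v \<equiv> (\<lambda>z j. c j * of_nat j * z ^ (j - 1) / of_real (sqrt (real n)))"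
    and "w \<equiv> (\<lambda>z j. c j * of_nat j * (of_nat j - 1) * z ^ (j - 2) / of_real (sqrt (real n)))"
  shows "(\<integral>\<^sup>+y. ennreal (critical_value_sum (SU2_poly (x(1 := y)) n) \<psi>) \<partial>cgauss)
    = (\<integral>\<^sup>+z. ennreal (\<psi> (cmod (\<Sum>j\<in>I. u z j * x j))) * ennreal ((cmod (\<Sum>j\<in>I. w z j * x j))\<^sup>2)
         * standard_complex_gaussian_density (\<Sum>j\<in>I. v z j * x j) \<partial>lborel)"
proof -
  let ?V = "\<lambda>z. \<Sum>j\<in>I. v z j * x j"
  let ?U = "\<lambda>z. \<Sum>j\<in>I. u z j * x j"
  let ?W = "\<lambda>z. \<Sum>j\<in>I. w z j * x j"
  let ?\<rho> = standard_complex_gaussian_density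
  define r where "r = complex_of_real (sqrt (real n))"
  have r: "r \<noteq> 0" "r * r = of_nat n" using n
    by (simp_all add: r_def of_real_mult[symmetric] del: of_real_mult)
  have c1: "c 1 = r" using n by (simp add: c_def r_def)
  define p0 where "p0 = SU2_poly (x(1 := 0)) n"
  define q where "q = smult (- 1 / r) (pderiv p0)"
  have split: "(\<Sum>j\<le>n. f j) = f 1 + (\<Sum>j\<in>I. f j)" for f :: "nat \<Rightarrow> complex"
    unfolding I_def using n by (subst sum.remove[of _ 1]) auto
  have xI: "(\<Sum>j\<in>I. h ((x(1 := y)) j) j) = (\<Sum>j\<in>I. h (x j) j)" for h :: "complex \<Rightarrow> nat \<Rightarrow> complex" and y
    by (intro sum.cong) (auto simp: I_def)
  have vsum: "(\<Sum>j\<in>I. of_nat j * (x j * c j) * z ^ (j - 1)) = r * ?V z" for z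
    using r unfolding v_def r_def[symmetric] sum_distrib_left by (intro sum.cong) (auto simp: field_simps)
  have q_eval: "poly q z = - ?V z" for z
  proof -
    have "poly (pderiv p0) z = (\<Sum>j\<in>I. of_nat j * (x j * c j) * z ^ (j - 1))"
      unfolding p0_def poly_pderiv_SU2_poly split
      using xI[of "\<lambda>a j. of_nat j * (a * c j) * z ^ (j - 1)" 0] by (simp add: c_def)
    then show ?thesis using r unfolding vsum by (simp add: q_def)
  qed
  have q'_eval: "poly (pderiv q) z = - ?W z" for z
  proof -
    have "poly (pderiv (pderiv p0)) z = (\<Sum>j\<in>I. of_nat (j - 1) * (of_nat j * (x j * c j)) * z ^ (j - 2))"
      unfolding p0_def poly_pderiv_pderiv_SU2_poly split
      using xI[of "\<lambda>a j. of_nat (j - 1) * (of_nat j * (a * c j)) * z ^ (j - 2)" 0] by (simp add: c_def)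
    also have "\<dots> = r * ?W z"
      unfolding w_def r_def[symmetric] sum_distrib_left
    proof (intro sum.cong refl)
      fix j
      show "of_nat (j - 1) * (of_nat j * (x j * c j)) * z ^ (j - 2)
          = r * (c j * of_nat j * (of_nat j - 1) * z ^ (j - 2) / r * x j)"
        using r by (cases j) (auto simp: field_simps)
    qed
    finally show ?thesis using r by (simp add: q_def pderiv_smult pderiv_minus)
  qed
  have p'_zero: "poly (pderiv (SU2_poly (x(1 := y)) n)) z = 0 \<longleftrightarrow> poly q z = y" for y z
  proof -
    have "poly (pderiv (SU2_poly (x(1 := y)) n)) z = r * y + (\<Sum>j\<in>I. of_nat j * (x j * c j) * z ^ (j - 1))"
      unfolding poly_pderiv_SU2_poly split
      using xI[of "\<lambda>a j. of_nat j * (a * c j) * z ^ (j - 1)" y] c1 by (simp add: c_def)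
    then have "poly (pderiv (SU2_poly (x(1 := y)) n)) z = r * (y - poly q z)"
      by (simp only: q_eval vsum diff_minus_eq_add distrib_left)
    then show ?thesis using r by auto
  qed
  have p_eval: "poly (SU2_poly (x(1 := y)) n) z = ?U z" if y: "poly q z = y" for y z
  proof -
    have "poly (SU2_poly (x(1 := y)) n) z = r * y * z + (\<Sum>j\<in>I. x j * c j * z ^ j)"
      unfolding poly_SU2_poly split
      using xI[of "\<lambda>a j. a * c j * z ^ j" y] c1 by (simp add: c_def)
    also have "r * y * z = - (\<Sum>j\<in>I. x j * c j * of_nat j * z ^ j)"
    proof -
      have "(\<Sum>j\<in>I. r * (v z j * x j) * z) = (\<Sum>j\<in>I. x j * c j * of_nat j * z ^ j)"
      proof (intro sum.cong refl)
        fix j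
        show "r * (v z j * x j) * z = x j * c j * of_nat j * z ^ j"
          using r by (cases j) (auto simp: v_def r_def[symmetric])
      qed
      then show ?thesis
        unfolding y[symmetric] q_eval by (simp add: sum_distrib_left sum_distrib_right)
    qed
    also have "- (\<Sum>j\<in>I. x j * c j * of_nat j * z ^ j) + (\<Sum>j\<in>I. x j * c j * z ^ j) = ?U z"
      unfolding sum_negf[symmetric] sum.distrib[symmetric]
      by (intro sum.cong) (auto simp: u_def algebra_simps)
    finally show ?thesis .
  qed
  have cont_v: "continuous_on UNIV (\<lambda>z. \<Sum>j\<in>I. v z j * x j)" and cont_u: "continuous_on UNIV (\<lambda>z. \<Sum>j\<in>I. u z j * x j)"
    unfolding v_def u_def by (intro continuous_intros; simp add: r_def[symmetric] r)+
  note [measurable] = borel_measurable_continuous_onI[OF cont_v] borel_measurable_continuous_onI[OF cont_u]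
    borel_measurable_continuous_onI[OF \<psi>(1)]
  have minus: "?\<rho> (- a) = ?\<rho> a" for a by (simp add: standard_complex_gaussian_density_def)
  have "(\<integral>\<^sup>+y. ennreal (critical_value_sum (SU2_poly (x(1 := y)) n) \<psi>) \<partial>cgauss)
      = (\<integral>\<^sup>+y. ?\<rho> y * ennreal (critical_value_sum (SU2_poly (x(1 := y)) n) \<psi>) \<partial>lborel)"
  proof (rule nn_integral_cgauss)
    have "(\<lambda>y. critical_value_sum (SU2_poly (x(1 := y)) n) \<psi>) \<in> borel_measurable borel"
      by (rule critical_value_sum_measurable[OF _ \<psi>(1)]) (auto simp: fun_upd_def)
    then show "(\<lambda>y. ennreal (critical_value_sum (SU2_poly (x(1 := y)) n) \<psi>)) \<in> borel_measurable borel"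
      by measurable
  qed
  also have "\<dots> = (\<integral>\<^sup>+y. (\<Sum>z\<in>{z. poly q z = y}. ?\<rho> (?V z) * ennreal (\<psi> (cmod (?U z)))) \<partial>lborel)"
  proof (intro nn_integral_cong)
    fix y
    have "critical_value_sum (SU2_poly (x(1 := y)) n) \<psi> = (\<Sum>z\<in>{z. poly q z = y}. \<psi> (cmod (?U z)))"
      unfolding critical_value_sum_def p'_zero
    proof (intro sum.cong refl)
      fix z assume "z \<in> {z. poly q z = y}"
      then have "poly q z = y" by simp
      from p_eval[OF this] show "\<psi> (cmod (poly (SU2_poly (x(1 := y)) n) z)) = \<psi> (cmod (?U z))"
        by (simp only:)
    qed
    moreover have "ennreal (\<Sum>z\<in>{z. poly q z = y}. \<psi> (cmod (?U z)))
        = (\<Sum>z\<in>{z. poly q z = y}. ennreal (\<psi> (cmod (?U z))))"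
      by (rule sum_ennreal[symmetric]) (rule \<psi>(2))
    ultimately have "?\<rho> y * ennreal (critical_value_sum (SU2_poly (x(1 := y)) n) \<psi>)
        = (\<Sum>z\<in>{z. poly q z = y}. ?\<rho> y * ennreal (\<psi> (cmod (?U z))))"
      by (simp only: sum_distrib_left)
    also have "\<dots> = (\<Sum>z\<in>{z. poly q z = y}. ?\<rho> (?V z) * ennreal (\<psi> (cmod (?U z))))"
    proof (intro sum.cong refl)
      fix z assume "z \<in> {z. poly q z = y}"
      then have "y = - ?V z" using q_eval[of z] by simp
      then show "?\<rho> y * ennreal (\<psi> (cmod (?U z)))
          = ?\<rho> (?V z) * ennreal (\<psi> (cmod (?U z)))"
        by (simp only: minus)
    qed
    finally show "?\<rho> y * ennreal (critical_value_sum (SU2_poly (x(1 := y)) n) \<psi>)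
        = (\<Sum>z\<in>{z. poly q z = y}. ?\<rho> (?V z) * ennreal (\<psi> (cmod (?U z))))" .
  qed
  also have "\<dots> = (\<integral>\<^sup>+z. ?\<rho> (?V z) * ennreal (\<psi> (cmod (?U z)))
      * ennreal ((cmod (poly (pderiv q) z))\<^sup>2) \<partial>lborel)"
    by (rule nn_integral_sum_poly_fibre) measurable
  also have "\<dots> = (\<integral>\<^sup>+z. ennreal (\<psi> (cmod (?U z))) * ennreal ((cmod (?W z))\<^sup>2)
         * ?\<rho> (?V z) \<partial>lborel)"
    unfolding q'_eval by (simp add: ac_simps)
  finally show ?thesis .
qed

section \<open>Uniqueness of the density\<close>

text \<open>The classical function flat at 0. The family in \<open>k\<close> is needed because each
  derivative is a polynomial times a member with a larger \<open>k\<close>; smoothness at 0 thus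
  reduces to first derivatives.\<close>

definition flat_exp :: "nat \<Rightarrow> real \<Rightarrow> real" where
  "flat_exp k u = (if u > 0 then exp (- 1 / u) / u ^ k else 0)"

lemma flat_exp_shift: "flat_exp k u = u ^ m * flat_exp (k + m) u"
  by (simp add: flat_exp_def power_add)

lemma flat_exp_quotient_tendsto: "((\<lambda>u. flat_exp k u / u) \<longlongrightarrow> 0) (at 0)"
proof (subst filterlim_at_split, intro conjI)
  show "((\<lambda>u. flat_exp k u / u) \<longlongrightarrow> 0) (at_left 0)"
    by (rule tendsto_eventually) (auto simp: flat_exp_def eventually_at_filter)
  have "((\<lambda>u::real. (inverse u) ^ (k + 1) / exp (inverse u)) \<longlongrightarrow> 0) (at_right 0)"
    by (rule filterlim_compose[OF tendsto_power_div_exp_0 filterlim_inverse_at_top_right])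
  moreover have "\<forall>\<^sub>F u in at_right 0. (inverse u) ^ (k + 1) / exp (inverse u) = flat_exp k u / u"
    by (auto simp: eventually_at_filter flat_exp_def exp_minus field_simps)
  ultimately show "((\<lambda>u. flat_exp k u / u) \<longlongrightarrow> 0) (at_right 0)"
    by (rule Lim_transform_eventually)
qed

lemma flat_exp_has_derivative:
  "(flat_exp k has_real_derivative (1 - real k * u) * flat_exp (k + 2) u) (at u)"
proof -
  consider "u > 0" | "u < 0" | "u = 0" by linarith
  then show ?thesis
  proof cases
    case 1
    have "((\<lambda>u. exp (- 1 / u) / u ^ k) has_real_derivative (1 - real k * u) * flat_exp (k + 2) u) (at u)"
    proof -
      have "((\<lambda>u. exp (- 1 / u)) has_real_derivative exp (- 1 / u) * (1 / u\<^sup>2)) (at u)"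
        using 1 by (auto intro!: derivative_eq_intros simp: power2_eq_square)
      moreover have "((\<lambda>u. u ^ k) has_real_derivative real k * u ^ (k - 1)) (at u)"
        by (auto intro!: derivative_eq_intros)
      ultimately have "((\<lambda>u. exp (- 1 / u) / u ^ k) has_real_derivative
          (exp (- 1 / u) * (1 / u\<^sup>2) * u ^ k - exp (- 1 / u) * (real k * u ^ (k - 1))) / (u ^ k * u ^ k)) (at u)"
        using 1 by (intro DERIV_divide) auto
      also have "(exp (- 1 / u) * (1 / u\<^sup>2) * u ^ k - exp (- 1 / u) * (real k * u ^ (k - 1))) / (u ^ k * u ^ k)
          = (1 - real k * u) * flat_exp (k + 2) u"
      proof (cases k)
        case (Suc m)
        then show ?thesis using 1 by (simp add: flat_exp_def field_simps power2_eq_square)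
      qed (use 1 in \<open>simp add: flat_exp_def power2_eq_square\<close>)
      finally show ?thesis .
    qed
    then show ?thesis
      by (rule has_field_derivative_transform_within_open[of _ _ _ "{0<..}"])
         (use 1 in \<open>auto simp: flat_exp_def\<close>)
  next
    case 2
    have "((\<lambda>u. 0) has_real_derivative 0) (at u)" by simp
    then have "(flat_exp k has_real_derivative 0) (at u)"
      by (rule has_field_derivative_transform_within_open[of _ _ _ "{..<0}"])
         (use 2 in \<open>auto simp: flat_exp_def\<close>)
    then show ?thesis using 2 by (simp add: flat_exp_def)
  next
    case 3
    then show ?thesis
      using flat_exp_quotient_tendsto[of k] by (simp add: has_field_derivative_iff flat_exp_def[of _ 0])
  qed
qed

text \<open>Polynomial factor in the \<open>m\<close>-th derivative of \<open>exp (- 1 / U)\<close>: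
  differentiation raises the power of \<open>U\<close> in the denominator by 2, and the recursion is
  the product rule over this common denominator. An explicit sequence is wanted because a test
  function is defined by exhibiting all its derivatives.\<close>

primrec bump_poly :: "real poly \<Rightarrow> nat \<Rightarrow> real poly" where
  "bump_poly U 0 = 1"
| "bump_poly U (Suc m) = pderiv (bump_poly U m) * U\<^sup>2 + bump_poly U m * pderiv U * (1 - smult (2 * real m) U)"

lemma bump_derivative:
  "((\<lambda>x. poly (bump_poly U m) x * flat_exp (2 * m) (poly U x)) has_real_derivative
     poly (bump_poly U (Suc m)) x * flat_exp (2 * Suc m) (poly U x)) (at x)"
proof -
  have "((\<lambda>x. flat_exp (2 * m) (poly U x)) has_real_derivative
      (1 - real (2 * m) * poly U x) * flat_exp (2 * m + 2) (poly U x) * poly (pderiv U) x) (at x)"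
    by (rule DERIV_chain2[where f = "flat_exp (2 * m)" and g = "poly U"])
       (rule flat_exp_has_derivative poly_DERIV)+
  then have "((\<lambda>x. poly (bump_poly U m) x * flat_exp (2 * m) (poly U x)) has_real_derivative
      poly (pderiv (bump_poly U m)) x * flat_exp (2 * m) (poly U x)
      + (1 - real (2 * m) * poly U x) * flat_exp (2 * m + 2) (poly U x) * poly (pderiv U) x * poly (bump_poly U m) x) (at x)"
    by (intro DERIV_mult poly_DERIV)
  moreover have "flat_exp (2 * m) (poly U x) = (poly U x)\<^sup>2 * flat_exp (2 * m + 2) (poly U x)"
    by (rule flat_exp_shift)
  ultimately show ?thesis by (simp add: algebra_simps)
qed

lemma exists_bump_test_function:
  assumes "0 \<le> a" "a < b"
  obtains \<phi> where "test_function_on_half_line \<phi>" "continuous_on UNIV \<phi>"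
    "\<And>x. a < x \<Longrightarrow> x < b \<Longrightarrow> \<phi> x > 0" "\<And>x. x \<notin> {a<..<b} \<Longrightarrow> \<phi> x = 0"
proof -
  \<comment> \<open>The coefficients of \<open>(x - a) * (b - x)\<close>, which is positive exactly
    between \<open>a\<close> and \<open>b\<close>.\<close>
  define U where "U = [:- a * b, a + b, - 1:]"
  have U: "poly U x = (x - a) * (b - x)" for x by (simp add: U_def algebra_simps)
  define d where "d m x = poly (bump_poly U m) x * flat_exp (2 * m) (poly U x)" for m x
  have der: "(d m has_real_derivative d (Suc m) x) (at x)" for m x
    unfolding d_def by (rule bump_derivative)
  have out: "d 0 x = 0" if "x \<notin> {a<..<b}" for x
    using that assms by (auto simp: d_def U flat_exp_def zero_less_mult_iff)
  show ?thesis
  proof (rule that)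
    show "test_function_on_half_line (d 0)"
      unfolding test_function_on_half_line_def
    proof (intro conjI)
      show "\<exists>D. (\<forall>x\<ge>0. D 0 x = d 0 x) \<and>
          (\<forall>k. \<forall>x\<ge>0. (D k has_real_derivative D (Suc k) x) (at x within {0..}))"
        by (rule exI[of _ d]) (auto intro: has_field_derivative_at_within der)
      show "\<exists>R. \<forall>x\<ge>0. x > R \<longrightarrow> d 0 x = 0"
        by (rule exI[of _ b]) (auto intro: out)
    qed
    show "continuous_on UNIV (d 0)"
      using der by (intro DERIV_continuous_on) (auto intro: has_field_derivative_at_within)
    show "d 0 x > 0" if "a < x" "x < b" for x
      using that by (simp add: d_def U flat_exp_def)
    show "d 0 x = 0" if "x \<notin> {a<..<b}" for x by (rule out[OF that])
  qed
qed

text \<open>If the densities differed at \<open>x\<close>, their difference, normalised by its sign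
  at \<open>x\<close>, would be positive just to the right of \<open>x\<close>, and a bump there
  gives a contradiction. Working to the right keeps the bump inside the half-line even for
  \<open>x = 0\<close>.\<close>

lemma continuous_density_unique:
  assumes D: "continuous_on {0..} D" and D': "continuous_on {0..} D'"
    and eq: "\<And>\<phi>. test_function_on_half_line \<phi> \<Longrightarrow> (LBINT x:{0..}. \<phi> x * D x) = (LBINT x:{0..}. \<phi> x * D' x)"
    and x: "0 \<le> x"
  shows "D x = D' x"
proof (rule ccontr)
  assume ne: "D x \<noteq> D' x"
  define E where "E y = sgn (D x - D' x) * (D y - D' y)" for y
  have contE: "continuous_on {0..} E" unfolding E_def using D D' by (intro continuous_intros)
  have "E x > 0" using ne by (auto simp: E_def sgn_if)
  then obtain \<delta> where \<delta>: "\<delta> > 0" "\<And>y. y \<ge> 0 \<Longrightarrow> \<bar>y - x\<bar> < \<delta> \<Longrightarrow> \<bar>E y - E x\<bar> < E x"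
    using contE x unfolding continuous_on_iff by (force simp: dist_real_def)
  define b where "b = x + \<delta>"
  have pos: "E y > 0" if "x < y" "y < b" for y
    using \<delta>(2)[of y] that x by (simp add: b_def)
  obtain \<phi> where \<phi>: "test_function_on_half_line \<phi>" "continuous_on UNIV \<phi>"
    "\<And>y. x < y \<Longrightarrow> y < b \<Longrightarrow> \<phi> y > 0" "\<And>y. y \<notin> {x<..<b} \<Longrightarrow> \<phi> y = 0"
    using exists_bump_test_function[of x b] x \<delta>(1) by (auto simp: b_def)
  have int: "set_integrable lborel {0..} (\<lambda>y. \<phi> y * G y)" if "continuous_on {0..} G" for G
  proof -
    have "set_integrable lborel {x..b} (\<lambda>y. \<phi> y * G y)"
      using that x \<phi>(2) by (intro borel_integrable_atLeastAtMost' continuous_intros)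
        (auto intro: continuous_on_subset)
    moreover have "(\<lambda>y. indicator {x..b} y *\<^sub>R (\<phi> y * G y)) = (\<lambda>y. indicator {0..} y *\<^sub>R (\<phi> y * G y))"
    proof
      fix y show "indicator {x..b} y *\<^sub>R (\<phi> y * G y) = indicator {0..} y *\<^sub>R (\<phi> y * G y)"
        using \<phi>(4)[of y] x by (cases "y \<in> {x<..<b}") auto
    qed
    ultimately show ?thesis by (simp only: set_integrable_def)
  qed
  have "(LBINT y:{0..}. \<phi> y * E y) = (LBINT y:{0..}. sgn (D x - D' x) * (\<phi> y * D y) - sgn (D x - D' x) * (\<phi> y * D' y))"
    by (simp add: E_def algebra_simps)
  also have "\<dots> = sgn (D x - D' x) * (LBINT y:{0..}. \<phi> y * D y) - sgn (D x - D' x) * (LBINT y:{0..}. \<phi> y * D' y)"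
    using int[OF D] int[OF D'] by (subst set_integral_diff) auto
  also have "\<dots> = 0" using eq[OF \<phi>(1)] by simp
  finally have "(\<integral>y. indicator {0..} y *\<^sub>R (\<phi> y * E y) \<partial>lborel) = 0"
    by (simp add: set_lebesgue_integral_def)
  moreover have nonneg: "indicator {0..} y *\<^sub>R (\<phi> y * E y) \<ge> 0" for y
    using \<phi>(3,4)[of y] pos[of y] by (cases "y \<in> {x<..<b}") (auto simp: less_imp_le)
  ultimately have "AE y in lborel. indicator {0..} y *\<^sub>R (\<phi> y * E y) = 0"
    using int[OF contE] by (subst (asm) integral_nonneg_eq_0_iff_AE) (auto simp: set_integrable_def)
  then have "AE y in lborel. y \<notin> {x<..<b}"
  proof (rule AE_mp, intro always_eventually allI impI notI)
    fix y assume "indicator {0..} y *\<^sub>R (\<phi> y * E y) = 0" "y \<in> {x<..<b}"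
    then show False using \<phi>(3)[of y] pos[of y] x by auto
  qed
  then have "emeasure lborel {x<..<b} = 0"
    using AE_iff_null_sets[of "{x<..<b}" "lborel :: real measure"] by (simp add: null_sets_def)
  then show False using \<delta>(1) by (simp add: b_def)
qed

section \<open>The expected density\<close>

lemma critical_kernel_measurable [measurable]:
  "(\<lambda>(t, r). critical_kernel n t r) \<in> borel_measurable (borel \<Otimes>\<^sub>M borel)"
  unfolding critical_kernel_def by measurable

text \<open>Radial integration over the plane contributes the factor \<open>pi\<close> that cancels
  the one in the denominator of the kernel.\<close>

lemma nn_integral_critical_kernel:
  assumes n: "n \<ge> 2" and r: "r \<ge> 0"
  shows "(\<integral>\<^sup>+z. ennreal (critical_kernel n ((cmod z)\<^sup>2) r) \<partial>(lborel :: complex measure)) = ennreal (critical_density n r)"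
proof -
  have nn: "2 * r * (real n - 1) \<ge> 0" using n r by simp
  have "(\<integral>\<^sup>+z. ennreal (critical_kernel n ((cmod z)\<^sup>2) r) \<partial>(lborel :: complex measure))
      = ennreal pi * (\<integral>\<^sup>+t\<in>{0..}. ennreal (critical_kernel n t r) \<partial>lborel)"
    by (rule nn_integral_complex_radial) measurable
  also have "\<dots> = (\<integral>\<^sup>+t. ennreal (2 * r * (real n - 1) * (indicator {0..} t *\<^sub>R critical_integrand n r t)) \<partial>lborel)"
  proof -
    have "ennreal pi * (ennreal (critical_kernel n t r) * indicator {0..} t)
        = ennreal (2 * r * (real n - 1) * (indicator {0..} t *\<^sub>R critical_integrand n r t))" for t
      using critical_kernel_eq[of t n r]
      by (cases "t \<ge> 0") (simp_all add: ennreal_mult'[symmetric])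
    then show ?thesis by (simp add: nn_integral_cmult[symmetric])
  qed
  also have "\<dots> = ennreal (2 * r * (real n - 1) * (LBINT t:{0..}. critical_integrand n r t))"
  proof -
    have "0 \<le> indicator {0..} t *\<^sub>R critical_integrand n r t" for t
      using critical_integrand_bounds(1)[OF _ n, of t r] by (cases "t \<ge> 0") auto
    then have "0 \<le> 2 * r * (real n - 1) * (indicator {0..} t *\<^sub>R critical_integrand n r t)" for t
      by (rule mult_nonneg_nonneg[OF nn])
    moreover have "integrable lborel (\<lambda>t. 2 * r * (real n - 1) * (indicator {0..} t *\<^sub>R critical_integrand n r t))"
      using set_integrable_critical_integrand[OF n, of r]
      unfolding set_integrable_def by (rule integrable_mult_right)
    ultimately show ?thesis
      unfolding set_lebesgue_integral_def integral_mult_right_zero[symmetric]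
      by (intro nn_integral_eq_integral always_eventually allI)
  qed
  finally show ?thesis by (simp add: critical_density_def)
qed

lemma critical_density_nonneg:
  assumes "n \<ge> 2" "x \<ge> 0"
  shows "critical_density n x \<ge> 0"
proof -
  have "(LBINT t:{0..}. critical_integrand n x t) \<ge> 0"
    unfolding set_lebesgue_integral_def using critical_integrand_bounds(1)[OF _ assms(1), of _ x]
    by (intro integral_nonneg_AE always_eventually allI) (auto simp: indicator_def)
  then show ?thesis using assms by (simp add: critical_density_def)
qed

text \<open>This is the Kac-Rice formula. Integrating the linear coefficient first produces an
  integral over the plane; the order is then exchanged so that the remaining coefficients are
  integrated for fixed \<open>z\<close>, and finally \<open>z\<close> for fixed \<open>r\<close>.
  Nonnegativity of \<open>\<psi>\<close> justifies both exchanges.\<close>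

lemma nn_integral_critical_value_sum_PiM:
  assumes n: "n \<ge> 2" and \<psi>: "continuous_on UNIV \<psi>" "\<And>t. 0 \<le> \<psi> t"
  shows "(\<integral>\<^sup>+x. ennreal (critical_value_sum (SU2_poly x n) \<psi>) \<partial>PiM {..n} (\<lambda>_. cgauss))
    = (\<integral>\<^sup>+r\<in>{0..}. ennreal (\<psi> r * critical_density n r) \<partial>lborel)"
proof -
  let ?K = "\<lambda>z r. ennreal (critical_kernel n ((cmod z)\<^sup>2) r)"
  interpret product_sigma_finite "\<lambda>_::nat. cgauss" ..
  define I where "I = {..n} - {1}"
  have I: "finite I" "1 \<notin> I" "insert 1 I = {..n}" using n by (auto simp: I_def)
  interpret P: sigma_finite_measure "PiM I (\<lambda>_. cgauss)"
    using I(1) by (rule sigma_finite)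
  interpret PL: pair_sigma_finite "PiM I (\<lambda>_. cgauss)" "lborel :: complex measure" ..
  define c where "c = (\<lambda>j. complex_of_real (sqrt (real (n choose j))))"
  define u where "u = (\<lambda>z j. c j * (1 - of_nat j) * z ^ j)"
  define v where "v = (\<lambda>z j. c j * of_nat j * z ^ (j - 1) / of_real (sqrt (real n)))"
  define w where "w = (\<lambda>z j. c j * of_nat j * (of_nat j - 1) * z ^ (j - 2) / of_real (sqrt (real n)))"
  let ?G = "\<lambda>x z. ennreal (\<psi> (cmod (\<Sum>j\<in>I. u z j * x j))) * ennreal ((cmod (\<Sum>j\<in>I. w z j * x j))\<^sup>2)
         * standard_complex_gaussian_density (\<Sum>j\<in>I. v z j * x j)"
  have n1: "n \<ge> 1" using n by simp
  have [measurable]: "\<psi> \<in> borel_measurable borel"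
    using \<psi>(1) by (rule borel_measurable_continuous_onI)
  have S_m: "(\<lambda>x. ennreal (critical_value_sum (SU2_poly x n) \<psi>)) \<in> borel_measurable (PiM (insert 1 I) (\<lambda>_. cgauss))"
  proof -
    have "(\<lambda>x. critical_value_sum (SU2_poly x n) \<psi>) \<in> borel_measurable (PiM (insert 1 I) (\<lambda>_. cgauss))"
    proof (rule critical_value_sum_measurable[OF _ \<psi>(1)])
      fix j assume "j \<le> n"
      then have "j \<in> insert 1 I" unfolding I(3) by simp
      then have "(\<lambda>x. x j) \<in> PiM (insert 1 I) (\<lambda>_. cgauss) \<rightarrow>\<^sub>M cgauss"
        by (rule measurable_component_singleton)
      moreover have "PiM (insert 1 I) (\<lambda>_. cgauss) \<rightarrow>\<^sub>M cgauss = borel_measurable (PiM (insert 1 I) (\<lambda>_. cgauss))"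
        by (rule measurable_cong_sets) (rule refl sets_cgauss)+
      ultimately show "(\<lambda>x. x j) \<in> borel_measurable (PiM (insert 1 I) (\<lambda>_. cgauss))" by (simp only:)
    qed
    then show ?thesis by measurable
  qed
  have "(\<integral>\<^sup>+x. ennreal (critical_value_sum (SU2_poly x n) \<psi>) \<partial>PiM {..n} (\<lambda>_. cgauss))
      = (\<integral>\<^sup>+x. \<integral>\<^sup>+y. ennreal (critical_value_sum (SU2_poly (x(1 := y)) n) \<psi>) \<partial>cgauss \<partial>PiM I (\<lambda>_. cgauss))"
    unfolding I(3)[symmetric] by (rule product_nn_integral_insert[OF I(1,2) S_m])
  also have "\<dots> = (\<integral>\<^sup>+x. \<integral>\<^sup>+z. ?G x z \<partial>lborel \<partial>PiM I (\<lambda>_. cgauss))"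
    unfolding nn_integral_linear_coefficient[OF n1 \<psi>] I_def u_def v_def w_def c_def ..
  also have "\<dots> = (\<integral>\<^sup>+z. \<integral>\<^sup>+x. ?G x z \<partial>PiM I (\<lambda>_. cgauss) \<partial>lborel)"
  proof (rule PL.Fubini'[symmetric])
    show "(\<lambda>(x, z). ?G x z) \<in> borel_measurable (PiM I (\<lambda>_. cgauss) \<Otimes>\<^sub>M lborel)"
      unfolding u_def v_def w_def by measurable
  qed
  also have "\<dots> = (\<integral>\<^sup>+z. (\<integral>\<^sup>+r\<in>{0..}. ennreal (\<psi> r) * ?K z r \<partial>lborel) \<partial>lborel)"
  proof (rule nn_integral_cong)
    fix z :: complex
    show "(\<integral>\<^sup>+x. ?G x z \<partial>PiM I (\<lambda>_. cgauss)) = (\<integral>\<^sup>+r\<in>{0..}. ennreal (\<psi> r) * ?K z r \<partial>lborel)"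
      unfolding I_def u_def v_def w_def c_def
      by (rule SU2_conditional_integral[OF n1, of "\<lambda>r. ennreal (\<psi> r)"]) measurable
  qed
  also have "\<dots> = (\<integral>\<^sup>+r. \<integral>\<^sup>+z. ennreal (\<psi> r) * ?K z r * indicator {0..} r \<partial>(lborel :: complex measure) \<partial>lborel)"
    by (rule nn_integral_lborel_swap[of "\<lambda>(z, r). ennreal (\<psi> r) * ?K z r * indicator {0..} r",
        unfolded prod.case]) measurable
  also have "\<dots> = (\<integral>\<^sup>+r\<in>{0..}. ennreal (\<psi> r * critical_density n r) \<partial>lborel)"
  proof (rule nn_integral_cong)
    fix r :: real
    show "(\<integral>\<^sup>+z. ennreal (\<psi> r) * ?K z r * indicator {0..} r \<partial>(lborel :: complex measure))
        = ennreal (\<psi> r * critical_density n r) * indicator {0..} r"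
    proof (cases "r \<ge> 0")
      case True
      then have "(\<integral>\<^sup>+z. ennreal (\<psi> r) * ?K z r * indicator {0..} r \<partial>(lborel :: complex measure))
          = ennreal (\<psi> r) * (\<integral>\<^sup>+z. ?K z r \<partial>(lborel :: complex measure))"
        by (simp add: nn_integral_cmult)
      then show ?thesis
        using True \<psi>(2)[of r] by (simp add: nn_integral_critical_kernel[OF n True] ennreal_mult')
    qed simp
  qed
  finally show ?thesis .
qed

section \<open>Transfer to the given coefficients and identification of the density\<close>

context
  fixes M :: "'w measure" and a :: "nat \<Rightarrow> 'w \<Rightarrow> complex" and n :: nat
  assumes prob: "prob_space M"
    and indep: "prob_space.indep_vars M (\<lambda>_. borel) a UNIV"
    and gauss: "\<And>j. distributed M lborel (a j) standard_complex_gaussian_density"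
    and n: "n \<ge> 2"
begin

lemma coefficient_measurable [measurable]: "a j \<in> borel_measurable M"
  using gauss[of j] by (simp add: distributed_def)

lemma distr_coefficients:
  "distr M (PiM {..n} (\<lambda>_. borel)) (\<lambda>\<omega>. \<lambda>j\<in>{..n}. a j \<omega>) = PiM {..n} (\<lambda>_. cgauss)"
proof -
  interpret prob_space M by (rule prob)
  have "indep_vars (\<lambda>_. borel) a {..n}" using indep by (rule indep_vars_subset) simp
  then have "distr M (PiM {..n} (\<lambda>_. borel)) (\<lambda>\<omega>. \<lambda>j\<in>{..n}. a j \<omega>) = PiM {..n} (\<lambda>j. distr M borel (a j))"
    by (subst (asm) indep_vars_iff_distr_eq_PiM') auto
  also have "\<dots> = PiM {..n} (\<lambda>_. cgauss)"
  proof (rule PiM_cong[OF refl])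
    fix j
    have "distr M borel (a j) = distr M lborel (a j)" by (rule distr_cong) auto
    then show "distr M borel (a j) = cgauss"
      using gauss[of j] by (simp add: distributed_def cgauss_def)
  qed
  finally show ?thesis .
qed

lemma nn_integral_critical_value_sum:
  assumes \<psi>: "continuous_on UNIV \<psi>" "\<And>t. 0 \<le> \<psi> t"
  shows "(\<integral>\<^sup>+\<omega>. ennreal (critical_value_sum (SU2_poly (\<lambda>j. a j \<omega>) n) \<psi>) \<partial>M)
    = (\<integral>\<^sup>+r\<in>{0..}. ennreal (\<psi> r * critical_density n r) \<partial>lborel)"
proof -
  \<comment> \<open>The joint law is that of the restricted family; the polynomial reads only the
    indices up to \<open>n\<close>, so the restriction does not change it.\<close>
  have cut: "SU2_poly (\<lambda>j\<in>{..n}. a j \<omega>) n = SU2_poly (\<lambda>j. a j \<omega>) n" for \<omega>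
    unfolding SU2_poly_def by (intro sum.cong) auto
  have "(\<lambda>x. critical_value_sum (SU2_poly x n) \<psi>) \<in> borel_measurable (PiM {..n} (\<lambda>_. borel))"
    by (rule critical_value_sum_measurable[OF _ \<psi>(1)]) (auto intro: measurable_component_singleton)
  then have "(\<integral>\<^sup>+x. ennreal (critical_value_sum (SU2_poly x n) \<psi>) \<partial>distr M (PiM {..n} (\<lambda>_. borel)) (\<lambda>\<omega>. \<lambda>j\<in>{..n}. a j \<omega>))
      = (\<integral>\<^sup>+\<omega>. ennreal (critical_value_sum (SU2_poly (\<lambda>j. a j \<omega>) n) \<psi>) \<partial>M)"
    by (subst nn_integral_distr) (auto simp: cut)
  then show ?thesis
    unfolding distr_coefficients nn_integral_critical_value_sum_PiM[OF n \<psi>] by simp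
qed

text \<open>Bounded support and continuity of the density make the right-hand integral finite; with
  the formula for nonnegative integrals this gives integrability of the sum.\<close>

lemma has_bochner_integral_critical_value_sum:
  assumes \<psi>: "continuous_on UNIV \<psi>" "\<And>t. 0 \<le> \<psi> t" and R: "\<And>t. t > R \<Longrightarrow> \<psi> t = 0"
  shows "has_bochner_integral M (\<lambda>\<omega>. critical_value_sum (SU2_poly (\<lambda>j. a j \<omega>) n) \<psi>)
      (LBINT x:{0..}. \<psi> x * critical_density n x)"
    and "set_integrable lborel {0..} (\<lambda>x. \<psi> x * critical_density n x)"
proof -
  let ?S = "\<lambda>\<psi> \<omega>. critical_value_sum (SU2_poly (\<lambda>j. a j \<omega>) n) \<psi>"
  let ?I = "\<lambda>\<psi>. LBINT x:{0..}. \<psi> x * critical_density n x"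
  show int: "set_integrable lborel {0..} (\<lambda>x. \<psi> x * critical_density n x)"
  proof -
    have "set_integrable lborel {0..R} (\<lambda>x. \<psi> x * critical_density n x)"
      using \<psi>(1) continuous_on_critical_density[OF n]
      by (intro borel_integrable_atLeastAtMost' continuous_on_mult) (auto intro: continuous_on_subset)
    moreover have "(\<lambda>x. indicator {0..R} x *\<^sub>R (\<psi> x * critical_density n x))
        = (\<lambda>x. indicator {0..} x *\<^sub>R (\<psi> x * critical_density n x))"
    proof
      fix x show "indicator {0..R} x *\<^sub>R (\<psi> x * critical_density n x) = indicator {0..} x *\<^sub>R (\<psi> x * critical_density n x)"
        using R[of x] by (cases "x \<le> R") (auto simp: indicator_def)
    qed
    ultimately show ?thesis by (simp only: set_integrable_def)
  qed
  have nn: "0 \<le> indicator {0..} x *\<^sub>R (\<psi> x * critical_density n x)" for x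
    using critical_density_nonneg[OF n, of x] \<psi>(2)[of x] by (cases "x \<ge> 0") auto
  have "(\<integral>\<^sup>+\<omega>. ennreal (?S \<psi> \<omega>) \<partial>M)
     = (\<integral>\<^sup>+r. ennreal (indicator {0..} r *\<^sub>R (\<psi> r * critical_density n r)) \<partial>lborel)"
    unfolding nn_integral_critical_value_sum[OF \<psi>]
    by (intro nn_integral_cong) (auto split: split_indicator)
  also have "\<dots> = ennreal (?I \<psi>)"
    unfolding set_lebesgue_integral_def
    using int nn by (intro nn_integral_eq_integral) (auto simp: set_integrable_def)
  finally have E: "(\<integral>\<^sup>+\<omega>. ennreal (?S \<psi> \<omega>) \<partial>M)
     = ennreal (?I \<psi>)" .
  show "has_bochner_integral M (?S \<psi>)
      (?I \<psi>)"
  proof (rule has_bochner_integral_nn_integral)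
    show "(?S \<psi>) \<in> borel_measurable M"
      by (rule critical_value_sum_measurable[OF _ \<psi>(1)]) measurable
    show "AE \<omega> in M. 0 \<le> ?S \<psi> \<omega>"
      using \<psi>(2) by (auto simp: critical_value_sum_def intro!: sum_nonneg)
    show "0 \<le> (?I \<psi>)"
      unfolding set_lebesgue_integral_def using nn by (intro integral_nonneg_AE) auto
  qed (rule E)
qed

text \<open>A test function is signed and constrained only on \<open>{0..}\<close>. Extending it by
  its value at 0 makes it continuous on the line. Its positive and negative parts need not be
  smooth, but continuity is all that the formula for nonnegative functions asks for.\<close>

lemma is_expected_density_critical_density: "is_expected_density M a n (critical_density n)"
  unfolding is_expected_density_def
proof (intro conjI allI impI)
  let ?S = "\<lambda>\<psi> \<omega>. critical_value_sum (SU2_poly (\<lambda>j. a j \<omega>) n) \<psi>"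
  let ?I = "\<lambda>\<psi>. LBINT x:{0..}. \<psi> x * critical_density n x"
  show "continuous_on {0..} (critical_density n)"
    using continuous_on_critical_density[OF n] by (rule continuous_on_subset) simp
  fix \<phi> assume \<phi>: "test_function_on_half_line \<phi>"
  obtain d :: "nat \<Rightarrow> real \<Rightarrow> real" and R where d: "\<And>x. x \<ge> 0 \<Longrightarrow> d 0 x = \<phi> x"
    "\<And>k x. x \<ge> 0 \<Longrightarrow> (d k has_real_derivative d (Suc k) x) (at x within {0..})"
    and R: "\<And>x. x \<ge> 0 \<Longrightarrow> x > R \<Longrightarrow> \<phi> x = 0"
    using \<phi> unfolding test_function_on_half_line_def by blast
  have "continuous_on {0..} (d 0)" using d(2) by (intro DERIV_continuous_on) auto
  then have cont: "continuous_on {0..} \<phi>" by (rule continuous_on_eq) (use d(1) in auto)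
  define \<psi> where "\<psi> t = \<phi> (max 0 t)" for t
  have cont\<psi>: "continuous_on UNIV \<psi>"
    unfolding \<psi>_def by (rule continuous_on_compose2[OF cont]) (auto intro!: continuous_intros)
  define p where "p t = max 0 (\<psi> t)" for t
  define m where "m t = max 0 (- \<psi> t)" for t
  have pm: "continuous_on UNIV p" "continuous_on UNIV m"
    unfolding p_def m_def using cont\<psi> by (auto intro!: continuous_intros)
  have "\<psi> t = 0" if "t > max 0 R" for t
    using R[of t] that by (simp add: \<psi>_def)
  then have pmR: "t > max 0 R \<Longrightarrow> p t = 0" "t > max 0 R \<Longrightarrow> m t = 0" for t
    by (simp_all add: p_def m_def)
  have eq: "\<phi> t = p t - m t" if "t \<ge> 0" for t
    using that by (simp add: p_def m_def \<psi>_def max_def)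
  note hp = has_bochner_integral_critical_value_sum[OF pm(1) _ pmR(1)]
  note hm = has_bochner_integral_critical_value_sum[OF pm(2) _ pmR(2)]
  have nonneg: "0 \<le> p t" "0 \<le> m t" for t by (simp_all add: p_def m_def)
  have "has_bochner_integral M
     (\<lambda>\<omega>. ?S p \<omega> - ?S m \<omega>)
     ((?I p) - (?I m))"
    by (intro has_bochner_integral_diff hp(1) hm(1) nonneg)
  moreover have "(\<lambda>\<omega>. ?S p \<omega> - ?S m \<omega>)
     = (?S \<phi>)"
    by (simp add: critical_value_sum_def eq sum_subtractf)
  moreover have "(?I p) - (?I m)
     = (?I \<phi>)"
  proof -
    have "(?I \<phi>)
        = (LBINT x:{0..}. p x * critical_density n x - m x * critical_density n x)"
      by (rule set_lebesgue_integral_cong) (auto simp: eq left_diff_distrib)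
    also have "\<dots> = (?I p) - (?I m)"
      by (intro set_integral_diff hp(2) hm(2) nonneg)
    finally show ?thesis ..
  qed
  ultimately show "has_bochner_integral M (?S \<phi>)
      (?I \<phi>)" by simp
qed

lemma expected_density_eq:
  assumes x: "x \<ge> 0"
  shows "expected_density M a n x = critical_density n x"
proof -
  \<comment> \<open>The normalised representative: the definite description asks for value 0 at
    negative arguments.\<close>
  define D0 where "D0 y = (if y < 0 then 0 else critical_density n y)" for y
  have "continuous_on {0..} D0 \<longleftrightarrow> continuous_on {0..} (critical_density n)"
    by (rule continuous_on_cong) (auto simp: D0_def)
  moreover have "(LBINT x:{0..}. \<phi> x * D0 x) = (LBINT x:{0..}. \<phi> x * critical_density n x)" for \<phi>
    by (rule set_lebesgue_integral_cong) (auto simp: D0_def)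
  ultimately have D0: "is_expected_density M a n D0"
    using is_expected_density_critical_density by (simp add: is_expected_density_def)
  have "expected_density M a n = D0"
    unfolding expected_density_def
  proof (rule the_equality)
    show "is_expected_density M a n D0 \<and> (\<forall>x<0. D0 x = 0)" using D0 by (simp add: D0_def)
    fix D assume D: "is_expected_density M a n D \<and> (\<forall>x<0. D x = 0)"
    show "D = D0"
    proof
      fix y
      show "D y = D0 y"
      proof (cases "y < 0")
        case True
        then show ?thesis using D by (simp add: D0_def)
      next
        case False
        show ?thesis
        proof (rule continuous_density_unique[of D D0 y])
          show "continuous_on {0..} D" "continuous_on {0..} D0"
            using D D0 by (auto simp: is_expected_density_def)
          show "(LBINT x:{0..}. \<phi> x * D x) = (LBINT x:{0..}. \<phi> x * D0 x)"
            if "test_function_on_half_line \<phi>" for \<phi>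
            using D D0 that unfolding is_expected_density_def
            by (meson has_bochner_integral_eq)
        qed (use False in simp)
      qed
    qed
  qed
  then show ?thesis using x by (simp add: D0_def)
qed

end

theorem theorem2:
  fixes M :: "'w measure" and a :: "nat \<Rightarrow> 'w \<Rightarrow> complex" and x :: real
  assumes "prob_space M"
    and "prob_space.indep_vars M (\<lambda>_. borel) a UNIV"
    and "\<And>j. distributed M lborel (a j) standard_complex_gaussian_density"
    and "x \<ge> 0"
  shows "(\<lambda>n. expected_density M a n x) \<longlonglongrightarrow>
           2 * ((1 - exp (- x\<^sup>2)) / x)
           + 2 * x * (LBINT s:{0..1}. exp (- ((s - s * ln s) * x\<^sup>2)))"
proof (rule Lim_transform_eventually[OF critical_density_tendsto_limit[OF assms(4)]])
  show "\<forall>\<^sub>F n in sequentially. critical_density n x = expected_density M a n x"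
    \<comment> \<open>The exact formula is available from \<open>n = 2\<close> on, which suffices
      for the limit.\<close>
    using eventually_ge_at_top[of 2]
    by eventually_elim (rule expected_density_eq[OF assms(1-3) _ assms(4), symmetric])
qed

end
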